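(* If $\mathcal D$ is a compactly generated triangulated category, the maps $$(\mathcal X,\mathcal Y,\mathcal Z)\mapsto\mathcal Mor(\mathcal D^c)^{\mathcal Y}\qquad\text{and}\qquad\mathcal I\mapsto({}^\perp(\mathcal I^\perp),\mathcal I^\perp,\mathcal I^{\perp\perp})$$ define a bijection between the set of all triangulated TTF triples on $\mathcal D$ and the set of all closed idempotent two-sided ideals $\mathcal I$ of $\mathcal D^c$ such that $\mathcal I[1]=\mathcal I$.
   Context: $\mathcal D$ compactly generated: it has small coproducts and a set of compact objects (objects $P$ with $\mathcal D(P,?)$ preserving small coproducts) such that $M=0$ whenever all shifts of these objects have no non-zero morphisms to $M$. $\mathcal D^c$ is the full subcategory of compact objects and $\mathcal Mor(\mathcal D^c)$ its class of morphisms. A two-sided ideal of $\mathcal D^c$ is a class $\mathcal I$ of morphisms such that $\mathcal I\cap\mathcal D^c(M,N)$ is a subgroup for all $M,N$ and $hgf\in\mathcal I$ whenever $g\in\mathcal I$ and $f,g,h$ are composable; it is idempotent if $\mathcal I=\mathcal I^2$; $\mathcal I[1]=\{f[1]:f\in\mathcal I\}$. For a class $\mathcal I$ of morphisms of $\mathcal D^c$, $\mathcal I^\perp$ is the class of objects $Y$ of $\mathcal D$ with $\mathcal D(f,Y)=0$ for all $f\in\mathcal I$. For a class $\mathcal Y$ of objects of $\mathcal D$, $\mathcal Mor(\mathcal D^c)^{\mathcal Y}$ is the class of morphisms $f$ of $\mathcal D^c$ with $\mathcal D(f,Y)=0$ for all $Y\in\mathcal Y$. $\mathcal I$ is closed if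 $\mathcal I=\mathcal Mor(\mathcal D^c)^{\mathcal I^\perp}$. For a class $\mathcal Y$ of objects, ${}^\perp\mathcal Y=\{M:\mathcal D(M,Y)=0\ \forall Y\in\mathcal Y\}$ and $\mathcal Y^\perp=\{M:\mathcal D(Y,M)=0\ \forall Y\in\mathcal Y\}$; $\mathcal I^{\perp\perp}=(\mathcal I^\perp)^\perp$. A t-structure is a pair $(\mathcal U,\mathcal V[1])$ with $\mathcal U,\mathcal V$ strictly full, $\mathcal D(U,V)=0$ for $U\in\mathcal U$, $V\in\mathcal V$, $\mathcal U[1]\subseteq\mathcal U$, $\mathcal V[-1]\subseteq\mathcal V$, and each $M$ in a triangle $M_{\mathcal U}\to M\to M^{\mathcal V}\to M_{\mathcal U}[1]$ with $M_{\mathcal U}\in\mathcal U$, $M^{\mathcal V}\in\mathcal V$. A triangulated TTF triple is a triple $(\mathcal X,\mathcal Y,\mathcal Z)$ of full subcategories with $(\mathcal X,\mathcal Y)$ and $(\mathcal Y,\mathcal Z)$ t-structures. *)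

theory Defs
  imports "HOL-Algebra.Product_Groups" "HOL-Algebra.Free_Abelian_Groups"
begin

unbundle cardinal_syntax

text \<open>Objects and morphisms form explicit carriers. Every morphism knows its domain and codomain,
  so that a class of morphisms is just a set of type \<^typ>\<open>'m set\<close>. \<open>Add\<close> and \<open>Zer A B\<close> are
  the addition of parallel morphisms and the zero morphism from \<open>A\<close> to \<open>B\<close>.\<close>

record ('o, 'm) precat =
  Obj :: "'o set"
  Arr :: "'m set"
  Dom :: "'m \<Rightarrow> 'o"
  Cod :: "'m \<Rightarrow> 'o"
  Ident :: "'o \<Rightarrow> 'm"
  Comp :: "'m \<Rightarrow> 'm \<Rightarrow> 'm"  (infixl \<open>\<cdot>\<index>\<close> 70)
  Add :: "'m \<Rightarrow> 'm \<Rightarrow> 'm"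
  Zer :: "'o \<Rightarrow> 'o \<Rightarrow> 'm"

definition homs :: "('o, 'm, 'z) precat_scheme \<Rightarrow> 'o \<Rightarrow> 'o \<Rightarrow> 'm set" where
  "homs C A B = {f \<in> Arr C. Dom C f = A \<and> Cod C f = B}"

text \<open>The abelian group of morphisms from \<open>A\<close> to \<open>B\<close>, written multiplicatively as usual in HOL-Algebra.\<close>

definition hom_group :: "('o, 'm, 'z) precat_scheme \<Rightarrow> 'o \<Rightarrow> 'o \<Rightarrow> 'm monoid" where
  "hom_group C A B = \<lparr>carrier = homs C A B, mult = Add C, one = Zer C A B\<rparr>"

definition neg_mor :: "('o, 'm, 'z) precat_scheme \<Rightarrow> 'm \<Rightarrow> 'm" where
  "neg_mor C f = inv\<^bsub>hom_group C (Dom C f) (Cod C f)\<^esub> f"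

locale preadditive_category =
  fixes C :: "('o, 'm, 'z) precat_scheme" (structure)
  assumes Dom_Obj: "f \<in> Arr C \<Longrightarrow> Dom C f \<in> Obj C"
    and Cod_Obj: "f \<in> Arr C \<Longrightarrow> Cod C f \<in> Obj C"
    and Ident_homs: "A \<in> Obj C \<Longrightarrow> Ident C A \<in> homs C A A"
    and Comp_homs: "f \<in> homs C A B \<Longrightarrow> g \<in> homs C B B' \<Longrightarrow> g \<cdot> f \<in> homs C A B'"
    and Comp_assoc: "f \<in> homs C A B \<Longrightarrow> g \<in> homs C B B' \<Longrightarrow> h \<in> homs C B' B'' \<Longrightarrow>
      h \<cdot> (g \<cdot> f) = (h \<cdot> g) \<cdot> f"
    and Comp_Ident: "f \<in> homs C A B \<Longrightarrow> f \<cdot> Ident C A = f"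
    and Ident_Comp: "f \<in> homs C A B \<Longrightarrow> Ident C B \<cdot> f = f"
    and comm_group_hom_group: "A \<in> Obj C \<Longrightarrow> B \<in> Obj C \<Longrightarrow> comm_group (hom_group C A B)"
    and Comp_Add: "f \<in> homs C A B \<Longrightarrow> f' \<in> homs C A B \<Longrightarrow> g \<in> homs C B B' \<Longrightarrow>
      g \<cdot> Add C f f' = Add C (g \<cdot> f) (g \<cdot> f')"
    and Add_Comp: "f \<in> homs C A B \<Longrightarrow> g \<in> homs C B B' \<Longrightarrow> g' \<in> homs C B B' \<Longrightarrow>
      Add C g g' \<cdot> f = Add C (g \<cdot> f) (g' \<cdot> f)"

definition is_zero_object :: "('o, 'm, 'z) precat_scheme \<Rightarrow> 'o \<Rightarrow> bool" where
  "is_zero_object C Z \<longleftrightarrow> Z \<in> Obj C \<and> Ident C Z = Zer C Z Z"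

definition is_iso :: "('o, 'm, 'z) precat_scheme \<Rightarrow> 'm \<Rightarrow> bool" where
  "is_iso C f \<longleftrightarrow> f \<in> Arr C \<and> (\<exists>g \<in> homs C (Cod C f) (Dom C f).
     g \<cdot>\<^bsub>C\<^esub> f = Ident C (Dom C f) \<and> f \<cdot>\<^bsub>C\<^esub> g = Ident C (Cod C f))"

definition is_biproduct ::
  "('o, 'm, 'z) precat_scheme \<Rightarrow> 'o \<Rightarrow> 'o \<Rightarrow> 'o \<Rightarrow> 'm \<Rightarrow> 'm \<Rightarrow> 'm \<Rightarrow> 'm \<Rightarrow> bool" where
  "is_biproduct C A B S i j p q \<longleftrightarrow>
     S \<in> Obj C \<and> i \<in> homs C A S \<and> j \<in> homs C B S \<and> p \<in> homs C S A \<and> q \<in> homs C S B \<and>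
     p \<cdot>\<^bsub>C\<^esub> i = Ident C A \<and> q \<cdot>\<^bsub>C\<^esub> j = Ident C B \<and>
     p \<cdot>\<^bsub>C\<^esub> j = Zer C B A \<and> q \<cdot>\<^bsub>C\<^esub> i = Zer C A B \<and>
     Add C (i \<cdot>\<^bsub>C\<^esub> p) (j \<cdot>\<^bsub>C\<^esub> q) = Ident C S"

locale additive_category = preadditive_category +
  assumes zero_object: "\<exists>Z. is_zero_object C Z"
    and biproduct: "A \<in> Obj C \<Longrightarrow> B \<in> Obj C \<Longrightarrow> \<exists>S i j p q. is_biproduct C A B S i j p q"

text \<open>\<open>ShO\<close> and \<open>ShA\<close> are the effect of the shift functor on objects and on morphisms. It is an
  automorphism of the category, not just a self-equivalence, so that expressions like \<open>\<V>[-1]\<close>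
  and \<open>\<I>[1] = \<I>\<close> can be read literally. An element \<open>(f, g, h)\<close> of \<open>Tri\<close> is a
  distinguished triangle with third morphism ending in the shift of the domain of \<open>f\<close>.\<close>

record ('o, 'm) tricat = "('o, 'm) precat" +
  ShO :: "'o \<Rightarrow> 'o"
  ShA :: "'m \<Rightarrow> 'm"
  Tri :: "('m \<times> 'm \<times> 'm) set"

definition candidate_triangle :: "('o, 'm, 'z) tricat_scheme \<Rightarrow> 'm \<Rightarrow> 'm \<Rightarrow> 'm \<Rightarrow> bool" where
  "candidate_triangle D f g h \<longleftrightarrow> f \<in> Arr D \<and> g \<in> Arr D \<and> h \<in> Arr D \<and>
     Cod D f = Dom D g \<and> Cod D g = Dom D h \<and> Cod D h = ShO D (Dom D f)"

definition triangle_morphism :: "('o, 'm, 'z) tricat_scheme \<Rightarrow>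
    'm \<times> 'm \<times> 'm \<Rightarrow> 'm \<times> 'm \<times> 'm \<Rightarrow> 'm \<Rightarrow> 'm \<Rightarrow> 'm \<Rightarrow> bool" where
  "triangle_morphism D = (\<lambda>(f, g, h) (f', g', h') a b c.
     a \<in> homs D (Dom D f) (Dom D f') \<and> b \<in> homs D (Dom D g) (Dom D g') \<and>
     c \<in> homs D (Dom D h) (Dom D h') \<and>
     b \<cdot>\<^bsub>D\<^esub> f = f' \<cdot>\<^bsub>D\<^esub> a \<and> c \<cdot>\<^bsub>D\<^esub> g = g' \<cdot>\<^bsub>D\<^esub> b \<and> ShA D a \<cdot>\<^bsub>D\<^esub> h = h' \<cdot>\<^bsub>D\<^esub> c)"

locale triangulated_category = additive_category D
  for D :: "('o, 'm, 'z) tricat_scheme" (structure) +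
  assumes ShO_bij: "bij_betw (ShO D) (Obj D) (Obj D)"
    and ShA_bij: "bij_betw (ShA D) (Arr D) (Arr D)"
    and ShA_homs: "f \<in> homs D A B \<Longrightarrow> ShA D f \<in> homs D (ShO D A) (ShO D B)"
    and ShA_Ident: "A \<in> Obj D \<Longrightarrow> ShA D (Ident D A) = Ident D (ShO D A)"
    and ShA_Comp: "f \<in> homs D A B \<Longrightarrow> g \<in> homs D B B' \<Longrightarrow> ShA D (g \<cdot> f) = ShA D g \<cdot> ShA D f"
    and ShA_Add: "f \<in> homs D A B \<Longrightarrow> g \<in> homs D A B \<Longrightarrow>
      ShA D (Add D f g) = Add D (ShA D f) (ShA D g)"
    and Tri_candidate: "(f, g, h) \<in> Tri D \<Longrightarrow> candidate_triangle D f g h"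
    and Tri_iso: "(f, g, h) \<in> Tri D \<Longrightarrow> candidate_triangle D f' g' h' \<Longrightarrow>
      triangle_morphism D (f, g, h) (f', g', h') a b c \<Longrightarrow>
      is_iso D a \<Longrightarrow> is_iso D b \<Longrightarrow> is_iso D c \<Longrightarrow> (f', g', h') \<in> Tri D"
    and Tri_Ident: "X \<in> Obj D \<Longrightarrow> is_zero_object D Z \<Longrightarrow>
      (Ident D X, Zer D X Z, Zer D Z (ShO D X)) \<in> Tri D"
    and Tri_exists: "f \<in> Arr D \<Longrightarrow> \<exists>g h. (f, g, h) \<in> Tri D"
    and Tri_rotate: "candidate_triangle D f g h \<Longrightarrow>
      (f, g, h) \<in> Tri D \<longleftrightarrow> (g, h, neg_mor D (ShA D f)) \<in> Tri D"
    and Tri_morphism: "(f, g, h) \<in> Tri D \<Longrightarrow> (f', g', h') \<in> Tri D \<Longrightarrow>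
      a \<in> homs D (Dom D f) (Dom D f') \<Longrightarrow> b \<in> homs D (Dom D g) (Dom D g') \<Longrightarrow>
      b \<cdot> f = f' \<cdot> a \<Longrightarrow> \<exists>c. triangle_morphism D (f, g, h) (f', g', h') a b c"
    and octahedral: "(f, f', f'') \<in> Tri D \<Longrightarrow> (g, g', g'') \<in> Tri D \<Longrightarrow>
      Cod D f = Dom D g \<Longrightarrow> (g \<cdot> f, h', h'') \<in> Tri D \<Longrightarrow>
      \<exists>u v. (u, v, ShA D f' \<cdot> g'') \<in> Tri D \<and>
        u \<in> homs D (Cod D f') (Cod D h') \<and> v \<in> homs D (Cod D h') (Cod D g') \<and>
        u \<cdot> f' = h' \<cdot> g \<and> h'' \<cdot> u = f'' \<and> v \<cdot> h' = g' \<and> g'' \<cdot> v = ShA D f \<cdot> h''"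

definition obj_shift :: "('o, 'm, 'z) tricat_scheme \<Rightarrow> int \<Rightarrow> 'o \<Rightarrow> 'o" where
  "obj_shift D n X = (if 0 \<le> n then (ShO D ^^ nat n) X
     else (inv_into (Obj D) (ShO D) ^^ nat (- n)) X)"

text \<open>Smallness is relative to a universe, given by an (uncountable, strongly) inaccessible
  cardinal \<open>\<kappa>\<close>: a set is small if it has fewer than \<open>\<kappa>\<close> elements. Every small set is in bijection
  with a subset of the field of \<open>\<kappa>\<close>, so it is enough to index small families by sets of that type.
  Without such a bound (with families indexed by arbitrary sets of morphisms, say) only the zero
  category would have all coproducts.\<close>

definition inaccessible :: "'u rel \<Rightarrow> bool" where
  "inaccessible \<kappa> \<longleftrightarrow> Card_order \<kappa> \<and> natLeq <o \<kappa> \<and> regularCard \<kappa> \<and>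
     (\<forall>A :: 'u set. |A| <o \<kappa> \<longrightarrow> |Pow A| <o \<kappa>)"

definition locally_small :: "'u rel \<Rightarrow> ('o, 'm, 'z) precat_scheme \<Rightarrow> bool" where
  "locally_small \<kappa> C \<longleftrightarrow> (\<forall>A \<in> Obj C. \<forall>B \<in> Obj C. |homs C A B| <o \<kappa>)"

definition is_coproduct ::
  "('o, 'm, 'z) precat_scheme \<Rightarrow> 'i set \<Rightarrow> ('i \<Rightarrow> 'o) \<Rightarrow> 'o \<Rightarrow> ('i \<Rightarrow> 'm) \<Rightarrow> bool" where
  "is_coproduct C I M S \<iota> \<longleftrightarrow> S \<in> Obj C \<and> (\<forall>i \<in> I. \<iota> i \<in> homs C (M i) S) \<and>
     (\<forall>Z \<in> Obj C. \<forall>g. (\<forall>i \<in> I. g i \<in> homs C (M i) Z) \<longrightarrow>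
        (\<exists>!u. u \<in> homs C S Z \<and> (\<forall>i \<in> I. u \<cdot>\<^bsub>C\<^esub> \<iota> i = g i)))"

definition has_small_coproducts :: "'u rel \<Rightarrow> ('o, 'm, 'z) precat_scheme \<Rightarrow> bool" where
  "has_small_coproducts \<kappa> C \<longleftrightarrow> (\<forall>(I :: 'u set) M. |I| <o \<kappa> \<longrightarrow> (\<forall>i \<in> I. M i \<in> Obj C) \<longrightarrow>
     (\<exists>S \<iota>. is_coproduct C I M S \<iota>))"

text \<open>\<open>P\<close> is compact if \<open>C(P, ?)\<close> preserves small coproducts, that is, if for each small
  coproduct \<open>S\<close> of objects \<open>M i\<close> the canonical map from the direct sum of the groups
  \<open>C(P, M i)\<close> to \<open>C(P, S)\<close>, sending a finitely supported family \<open>x\<close> to the sum of the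
  morphisms \<open>\<iota> i \<cdot> x i\<close>, is an isomorphism.\<close>

definition compact_object :: "'u rel \<Rightarrow> ('o, 'm, 'z) precat_scheme \<Rightarrow> 'o \<Rightarrow> bool" where
  "compact_object \<kappa> C P \<longleftrightarrow> P \<in> Obj C \<and>
     (\<forall>(I :: 'u set) M S \<iota>. |I| <o \<kappa> \<longrightarrow> (\<forall>i \<in> I. M i \<in> Obj C) \<longrightarrow> is_coproduct C I M S \<iota> \<longrightarrow>
       (\<lambda>x. gfinprod (hom_group C P S) (\<lambda>i. \<iota> i \<cdot>\<^bsub>C\<^esub> x i) I)
         \<in> iso (sum_group I (\<lambda>i. hom_group C P (M i))) (hom_group C P S))"

definition compactly_generated :: "'u rel \<Rightarrow> ('o, 'm, 'z) tricat_scheme \<Rightarrow> bool" where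
  "compactly_generated \<kappa> D \<longleftrightarrow> has_small_coproducts \<kappa> D \<and>
     (\<exists>\<P>. |\<P>| <o \<kappa> \<and> (\<forall>P \<in> \<P>. compact_object \<kappa> D P) \<and>
       (\<forall>M \<in> Obj D. (\<forall>P \<in> \<P>. \<forall>n. homs D (obj_shift D n P) M = {Zer D (obj_shift D n P) M}) \<longrightarrow>
          is_zero_object D M))"

definition full_subcategory ::
  "('o, 'm, 'z) precat_scheme \<Rightarrow> 'o set \<Rightarrow> ('o, 'm, 'z) precat_scheme" where
  "full_subcategory C \<U> =
     C\<lparr>Obj := Obj C \<inter> \<U>, Arr := {f \<in> Arr C. Dom C f \<in> \<U> \<and> Cod C f \<in> \<U>}\<rparr>"

definition compacts :: "'u rel \<Rightarrow> ('o, 'm, 'z) precat_scheme \<Rightarrow> ('o, 'm, 'z) precat_scheme" where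
  "compacts \<kappa> C = full_subcategory C {P. compact_object \<kappa> C P}"

definition two_sided_ideal :: "('o, 'm, 'z) precat_scheme \<Rightarrow> 'm set \<Rightarrow> bool" where
  "two_sided_ideal C \<I> \<longleftrightarrow> \<I> \<subseteq> Arr C \<and>
     (\<forall>M \<in> Obj C. \<forall>N \<in> Obj C. subgroup (\<I> \<inter> homs C M N) (hom_group C M N)) \<and>
     (\<forall>f \<in> Arr C. \<forall>g \<in> \<I>. \<forall>h \<in> Arr C. Cod C f = Dom C g \<longrightarrow> Cod C g = Dom C h \<longrightarrow>
        h \<cdot>\<^bsub>C\<^esub> g \<cdot>\<^bsub>C\<^esub> f \<in> \<I>)"

text \<open>The product is the subgroup generated by the composites in each group of morphisms; for ideals of
  an additive category every element is already a single composite.\<close>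

definition ideal_product :: "('o, 'm, 'z) precat_scheme \<Rightarrow> 'm set \<Rightarrow> 'm set \<Rightarrow> 'm set" where
  "ideal_product C \<I> \<J> = {f \<in> Arr C. f \<in> generate (hom_group C (Dom C f) (Cod C f))
     {h \<cdot>\<^bsub>C\<^esub> g | g h. g \<in> \<J> \<and> h \<in> \<I> \<and> Dom C g = Dom C f \<and> Cod C g = Dom C h \<and> Cod C h = Cod C f}}"

definition idempotent_class :: "('o, 'm, 'z) precat_scheme \<Rightarrow> 'm set \<Rightarrow> bool" where
  "idempotent_class C \<I> \<longleftrightarrow> \<I> = ideal_product C \<I> \<I>"

text \<open>\<open>kills C f Y\<close> means \<open>C(f, Y) = 0\<close>.\<close>

definition kills :: "('o, 'm, 'z) precat_scheme \<Rightarrow> 'm \<Rightarrow> 'o \<Rightarrow> bool" where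
  "kills C f Y \<longleftrightarrow> (\<forall>g \<in> homs C (Cod C f) Y. g \<cdot>\<^bsub>C\<^esub> f = Zer C (Dom C f) Y)"

definition mor_perp :: "('o, 'm, 'z) precat_scheme \<Rightarrow> 'm set \<Rightarrow> 'o set" where
  "mor_perp C \<I> = {Y \<in> Obj C. \<forall>f \<in> \<I>. kills C f Y}"

definition compact_annihilator ::
  "'u rel \<Rightarrow> ('o, 'm, 'z) precat_scheme \<Rightarrow> 'o set \<Rightarrow> 'm set" where
  "compact_annihilator \<kappa> C \<Y> = {f \<in> Arr (compacts \<kappa> C). \<forall>Y \<in> \<Y>. kills C f Y}"

definition closed_class :: "'u rel \<Rightarrow> ('o, 'm, 'z) precat_scheme \<Rightarrow> 'm set \<Rightarrow> bool" where
  "closed_class \<kappa> C \<I> \<longleftrightarrow> \<I> = compact_annihilator \<kappa> C (mor_perp C \<I>)"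

definition left_perp :: "('o, 'm, 'z) precat_scheme \<Rightarrow> 'o set \<Rightarrow> 'o set" where
  "left_perp C \<Y> = {M \<in> Obj C. \<forall>Y \<in> \<Y>. homs C M Y = {Zer C M Y}}"

definition right_perp :: "('o, 'm, 'z) precat_scheme \<Rightarrow> 'o set \<Rightarrow> 'o set" where
  "right_perp C \<Y> = {M \<in> Obj C. \<forall>Y \<in> \<Y>. homs C Y M = {Zer C Y M}}"

text \<open>Full subcategories are represented by their sets of objects; strict means closed under
  isomorphism.\<close>

definition strictly_full :: "('o, 'm, 'z) precat_scheme \<Rightarrow> 'o set \<Rightarrow> bool" where
  "strictly_full C \<U> \<longleftrightarrow> \<U> \<subseteq> Obj C \<and> (\<forall>f. is_iso C f \<longrightarrow> Dom C f \<in> \<U> \<longrightarrow> Cod C f \<in> \<U>)"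

text \<open>The second component of a t-structure is \<open>\<V>[1]\<close>, not the right orthogonal \<open>\<V>\<close> of the aisle.\<close>

definition t_structure :: "('o, 'm, 'z) tricat_scheme \<Rightarrow> 'o set \<Rightarrow> 'o set \<Rightarrow> bool" where
  "t_structure D \<U> \<W> \<longleftrightarrow> (\<exists>\<V>. \<W> = ShO D ` \<V> \<and>
     strictly_full D \<U> \<and> strictly_full D \<V> \<and>
     (\<forall>U \<in> \<U>. \<forall>V \<in> \<V>. homs D U V = {Zer D U V}) \<and>
     ShO D ` \<U> \<subseteq> \<U> \<and> obj_shift D (- 1) ` \<V> \<subseteq> \<V> \<and>
     (\<forall>M \<in> Obj D. \<exists>f g h. (f, g, h) \<in> Tri D \<and> Dom D f \<in> \<U> \<and> Cod D f = M \<and> Cod D g \<in> \<V>))"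

definition TTF_triples :: "('o, 'm, 'z) tricat_scheme \<Rightarrow> ('o set \<times> 'o set \<times> 'o set) set" where
  "TTF_triples D = {(\<X>, \<Y>, \<Z>). t_structure D \<X> \<Y> \<and> t_structure D \<Y> \<Z>}"

definition closed_idempotent_stable_ideals ::
  "'u rel \<Rightarrow> ('o, 'm, 'z) tricat_scheme \<Rightarrow> 'm set set" where
  "closed_idempotent_stable_ideals \<kappa> D = {\<I>. two_sided_ideal (compacts \<kappa> D) \<I> \<and>
     closed_class \<kappa> D \<I> \<and> idempotent_class (compacts \<kappa> D) \<I> \<and> ShA D ` \<I> = \<I>}"

definition TTF_to_ideal ::
  "'u rel \<Rightarrow> ('o, 'm, 'z) tricat_scheme \<Rightarrow> 'o set \<times> 'o set \<times> 'o set \<Rightarrow> 'm set" where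
  "TTF_to_ideal \<kappa> D = (\<lambda>(\<X>, \<Y>, \<Z>). compact_annihilator \<kappa> D \<Y>)"

definition ideal_to_TTF ::
  "('o, 'm, 'z) tricat_scheme \<Rightarrow> 'm set \<Rightarrow> 'o set \<times> 'o set \<times> 'o set" where
  "ideal_to_TTF D \<I> = (left_perp D (mor_perp D \<I>), mor_perp D \<I>, right_perp D (mor_perp D \<I>))"

end

theory Submission
  imports Defs
begin

text \<open>Smashing subcategories are governed by ideals because of a factorization property: if \<open>Y\<close> is a
  localizing class with a left adjoint \<open>L\<close> of its inclusion, then every map from a compact object \<open>P\<close>
  to \<open>M\<close> that is killed by \<open>Y\<close> factors as \<open>P \<rightarrow> Q \<rightarrow> M\<close> with \<open>Q\<close> compact and \<open>P \<rightarrow> Q\<close> already killed by \<open>Y\<close>.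
  Indeed \<open>M\<close> is the homotopy colimit of a Brown tower \<open>B n\<close> built from compact generators, \<open>L\<close>
  commutes with coproducts, so \<open>P \<rightarrow> B n \<rightarrow> L (B n)\<close> vanishes for some \<open>n\<close>, and the homological functor
  \<open>D(P, L -)\<close> is determined on \<open>B n\<close> by compact objects over \<open>B n\<close>, by induction on \<open>n\<close>.

  For a TTF triple \<open>(X, Y, Z)\<close>, applying this to the fibre of \<open>Q \<rightarrow> L Q\<close> shows that the ideal of maps
  killed by \<open>Y\<close> is idempotent, and applying it to the fibre of \<open>M \<rightarrow> L M\<close> that \<open>Y\<close> is recovered from it.
  The case \<open>Y = 0\<close> shows that the compact objects are essentially small up to direct summands.

  Conversely, each map of an idempotent ideal factors through the homotopy colimit of a sequence of
  maps of the ideal, which lies in the left orthogonal of \<open>Y = \<I>\<^sup>\<bottom>\<close>. A Brown tower on a small set of such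
  colimits has a cone in \<open>Y\<close>, which yields the first t-structure. The reflections of the compact
  generators are compact generators of \<open>Y\<close>, and Brown towers on them yield the second one.\<close>

section \<open>Preadditive categories\<close>

text \<open>Two obstacles shape the details. The objects from which Brown towers are built need not
  be compact in \<open>D\<close>. Reflections \<open>L G\<close> are compact only against coproducts
  of objects of \<open>Y\<close>, hence the relative notion \<open>rcompact N\<close>. The homotopy
  colimits attached to maps of an ideal have no compactness available at all, but such an object
  \<open>T\<close> comes with a map \<open>r\<close> to a compact \<open>Q\<close>: every map from
  \<open>Q\<close> to the cone of the tower dies after composition with \<open>r\<close>, which is
  enough to put the cone into \<open>mor_perp\<close>. This is why \<open>tower_cone_zero\<close>
  carries a map \<open>r\<close>; the identity gives the usual case. The second obstacle is size: an
  ideal need not be small, while a tower consumes a small set, so the ideal is cut down to maps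
  between members of a small set of compact objects of which all others are retracts. The functor
  \<open>L\<close> is not assumed to be triangulated: half-exactness (\<open>LA_exact\<close>) and
  finite parts of coproducts (\<open>LA_finite_part\<close>) are derived from its universal
  property. Closedness of an ideal amounts to one of the two round trips; the other one is the
  recovery of \<open>Y\<close>.\<close>

lemma mem_homs [simp]: "f \<in> homs C A B \<longleftrightarrow> f \<in> Arr C \<and> Dom C f = A \<and> Cod C f = B"
  by (simp add: homs_def)

lemma hom_group_simps [simp]:
  "carrier (hom_group C A B) = homs C A B"
  "f \<otimes>\<^bsub>hom_group C A B\<^esub> g = Add C f g"
  "\<one>\<^bsub>hom_group C A B\<^esub> = Zer C A B"
  by (simp_all add: hom_group_def)

context preadditive_category
begin

definition sub :: "'m \<Rightarrow> 'm \<Rightarrow> 'm"  (infixl \<open>\<^bold>-\<close> 65) where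
  "f \<^bold>- g = Add C f (neg_mor C g)"

abbreviation add :: "'m \<Rightarrow> 'm \<Rightarrow> 'm"  (infixl \<open>\<^bold>+\<close> 65) where
  "f \<^bold>+ g \<equiv> Add C f g"

declare Dom_Obj [simp] Cod_Obj [simp]

lemma homsD:
  assumes "f \<in> homs C A B" shows "f \<in> Arr C" "Dom C f = A" "Cod C f = B"
  using assms by simp_all

lemma homs_Obj:
  assumes "f \<in> homs C A B" shows "A \<in> Obj C" "B \<in> Obj C"
  using assms Dom_Obj[of f] Cod_Obj[of f] by auto

lemma Ident_simps [simp]:
  assumes "A \<in> Obj C"
  shows "Ident C A \<in> Arr C" "Dom C (Ident C A) = A" "Cod C (Ident C A) = A"
  using Ident_homs[OF assms] by auto

lemma Comp_simps [simp]:
  assumes "f \<in> Arr C" "g \<in> Arr C" "Cod C f = Dom C g"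
  shows "g \<cdot> f \<in> Arr C" "Dom C (g \<cdot> f) = Dom C f" "Cod C (g \<cdot> f) = Cod C g"
  using Comp_homs[of f "Dom C f" "Cod C f" g "Cod C g"] assms by auto

lemma assoc [simp]:
  assumes "f \<in> Arr C" "g \<in> Arr C" "h \<in> Arr C" "Cod C f = Dom C g" "Cod C g = Dom C h"
  shows "(h \<cdot> g) \<cdot> f = h \<cdot> (g \<cdot> f)"
  using Comp_assoc[of f "Dom C f" "Cod C f" g "Cod C g" h "Cod C h"] assms by auto

lemma Comp_Ident_simps [simp]:
  assumes "f \<in> Arr C"
  shows "Dom C f = A \<Longrightarrow> f \<cdot> Ident C A = f" "Cod C f = A \<Longrightarrow> Ident C A \<cdot> f = f"
  using Comp_Ident[of f "Dom C f" "Cod C f"] Ident_Comp[of f "Dom C f" "Cod C f"] assms by auto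

lemma Zer_simps [simp]:
  assumes "A \<in> Obj C" "B \<in> Obj C"
  shows "Zer C A B \<in> Arr C" "Dom C (Zer C A B) = A" "Cod C (Zer C A B) = B"
proof -
  interpret comm_group "hom_group C A B" by (rule comm_group_hom_group[OF assms])
  show "Zer C A B \<in> Arr C" "Dom C (Zer C A B) = A" "Cod C (Zer C A B) = B"
    using one_closed by simp_all
qed

lemma Add_simps [simp]:
  assumes "f \<in> Arr C" "g \<in> Arr C" "Dom C f = Dom C g" "Cod C f = Cod C g"
  shows "f \<^bold>+ g \<in> Arr C" "Dom C (f \<^bold>+ g) = Dom C g" "Cod C (f \<^bold>+ g) = Cod C g"
proof -
  interpret comm_group "hom_group C (Dom C g) (Cod C g)"
    using assms by (intro comm_group_hom_group) auto
  show "f \<^bold>+ g \<in> Arr C" "Dom C (f \<^bold>+ g) = Dom C g" "Cod C (f \<^bold>+ g) = Cod C g"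
    using m_closed[of f g] assms by simp_all
qed

lemma neg_simps [simp]:
  assumes "f \<in> Arr C"
  shows "neg_mor C f \<in> Arr C" "Dom C (neg_mor C f) = Dom C f" "Cod C (neg_mor C f) = Cod C f"
    "f \<^bold>+ neg_mor C f = Zer C (Dom C f) (Cod C f)"
    "neg_mor C f \<^bold>+ f = Zer C (Dom C f) (Cod C f)"
    "neg_mor C (neg_mor C f) = f"
proof -
  interpret comm_group "hom_group C (Dom C f) (Cod C f)"
    using assms by (intro comm_group_hom_group) auto
  have f: "f \<in> carrier (hom_group C (Dom C f) (Cod C f))" using assms by simp
  show *: "neg_mor C f \<in> Arr C" "Dom C (neg_mor C f) = Dom C f" "Cod C (neg_mor C f) = Cod C f"
    using inv_closed[OF f] by (simp_all add: neg_mor_def)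
  show "f \<^bold>+ neg_mor C f = Zer C (Dom C f) (Cod C f)"
    "neg_mor C f \<^bold>+ f = Zer C (Dom C f) (Cod C f)"
    using r_inv[OF f] l_inv[OF f] by (simp_all add: neg_mor_def)
  show "neg_mor C (neg_mor C f) = f"
    using inv_inv[OF f] * by (simp add: neg_mor_def)
qed

lemma Add_Zer [simp]:
  assumes "f \<in> Arr C" "Dom C f = A" "Cod C f = B"
  shows "f \<^bold>+ Zer C A B = f" "Zer C A B \<^bold>+ f = f"
proof -
  interpret comm_group "hom_group C A B"
    using assms by (intro comm_group_hom_group) auto
  show "f \<^bold>+ Zer C A B = f" "Zer C A B \<^bold>+ f = f"
    using r_one[of f] l_one[of f] assms by simp_all
qed

lemma Add_assoc:
  assumes "f \<in> homs C A B" "g \<in> homs C A B" "h \<in> homs C A B"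
  shows "f \<^bold>+ g \<^bold>+ h = f \<^bold>+ (g \<^bold>+ h)"
proof -
  interpret comm_group "hom_group C A B"
    using assms by (intro comm_group_hom_group) auto
  show ?thesis using m_assoc[of f g h] assms by simp
qed

lemma Add_commute:
  assumes "f \<in> homs C A B" "g \<in> homs C A B"
  shows "f \<^bold>+ g = g \<^bold>+ f"
proof -
  interpret comm_group "hom_group C A B"
    using assms by (intro comm_group_hom_group) auto
  show ?thesis using m_comm[of f g] assms by simp
qed

lemma Add_left_cancel:
  assumes "f \<in> homs C A B" "g \<in> homs C A B" "h \<in> homs C A B"
  shows "f \<^bold>+ g = f \<^bold>+ h \<longleftrightarrow> g = h"
proof -
  interpret comm_group "hom_group C A B"
    using assms by (intro comm_group_hom_group) auto
  show ?thesis using Units_l_cancel[of f g h] assms by auto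
qed

lemma Comp_Add_simps [simp]:
  assumes "f \<in> Arr C" "g \<in> Arr C" "h \<in> Arr C" "Dom C f = Dom C g" "Cod C f = Cod C g"
  shows "Cod C f = Dom C h \<Longrightarrow> h \<cdot> (f \<^bold>+ g) = h \<cdot> f \<^bold>+ h \<cdot> g"
    "Cod C h = Dom C f \<Longrightarrow> (f \<^bold>+ g) \<cdot> h = f \<cdot> h \<^bold>+ g \<cdot> h"
  using Comp_Add[of f "Dom C f" "Cod C f" g h "Cod C h"]
    Add_Comp[of h "Dom C h" "Cod C h" f "Cod C f" g] assms by auto

lemma Comp_Zer [simp]:
  assumes "f \<in> Arr C" "A \<in> Obj C"
  shows "Dom C f = B \<Longrightarrow> f \<cdot> Zer C A B = Zer C A (Cod C f)"
    "Cod C f = B \<Longrightarrow> Zer C B A \<cdot> f = Zer C (Dom C f) A"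
proof -
  assume B: "Dom C f = B"
  have "f \<cdot> (Zer C A B \<^bold>+ Zer C A B) = f \<cdot> Zer C A B \<^bold>+ f \<cdot> Zer C A B"
    using assms B by (intro Comp_Add_simps) auto
  then have "f \<cdot> Zer C A B \<^bold>+ f \<cdot> Zer C A B = f \<cdot> Zer C A B \<^bold>+ Zer C A (Cod C f)"
    using assms B by auto
  then show "f \<cdot> Zer C A B = Zer C A (Cod C f)"
    using assms B by (subst (asm) Add_left_cancel[of _ A "Cod C f"]) auto
next
  assume B: "Cod C f = B"
  have "(Zer C B A \<^bold>+ Zer C B A) \<cdot> f = Zer C B A \<cdot> f \<^bold>+ Zer C B A \<cdot> f"
    using assms B by (intro Comp_Add_simps) auto
  then have "Zer C B A \<cdot> f \<^bold>+ Zer C B A \<cdot> f = Zer C B A \<cdot> f \<^bold>+ Zer C (Dom C f) A"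
    using assms B by auto
  then show "Zer C B A \<cdot> f = Zer C (Dom C f) A"
    using assms B by (subst (asm) Add_left_cancel[of _ "Dom C f" A]) auto
qed

lemma neg_eqI:
  assumes "f \<in> homs C A B" "g \<in> homs C A B" "f \<^bold>+ g = Zer C A B"
  shows "neg_mor C f = g"
proof -
  have "f \<^bold>+ neg_mor C f = f \<^bold>+ g" using assms by simp
  then show ?thesis using assms by (subst (asm) Add_left_cancel[of _ A B]) auto
qed

lemma neg_Comp:
  assumes "f \<in> Arr C" "g \<in> Arr C" "Cod C f = Dom C g"
  shows "neg_mor C g \<cdot> f = neg_mor C (g \<cdot> f)" "g \<cdot> neg_mor C f = neg_mor C (g \<cdot> f)"
proof -
  have "(g \<^bold>+ neg_mor C g) \<cdot> f = g \<cdot> f \<^bold>+ neg_mor C g \<cdot> f"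
    using assms by (intro Comp_Add_simps) auto
  then show "neg_mor C g \<cdot> f = neg_mor C (g \<cdot> f)"
    using assms by (intro neg_eqI[symmetric, of _ "Dom C f" "Cod C g"]) auto
  have "g \<cdot> (f \<^bold>+ neg_mor C f) = g \<cdot> f \<^bold>+ g \<cdot> neg_mor C f"
    using assms by (intro Comp_Add_simps) auto
  then show "g \<cdot> neg_mor C f = neg_mor C (g \<cdot> f)"
    using assms by (intro neg_eqI[symmetric, of _ "Dom C f" "Cod C g"]) auto
qed

lemma neg_Zer [simp]: "A \<in> Obj C \<Longrightarrow> B \<in> Obj C \<Longrightarrow> neg_mor C (Zer C A B) = Zer C A B"
  by (intro neg_eqI[of _ A B]) auto

lemma neg_eq_Zer_iff:
  assumes "f \<in> homs C A B" shows "neg_mor C f = Zer C A B \<longleftrightarrow> f = Zer C A B"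
  using assms neg_simps(6)[of f] neg_Zer[of A B] by (metis Cod_Obj Dom_Obj mem_homs)

lemma sub_simps [simp]:
  assumes "f \<in> Arr C" "g \<in> Arr C" "Dom C f = Dom C g" "Cod C f = Cod C g"
  shows "f \<^bold>- g \<in> Arr C" "Dom C (f \<^bold>- g) = Dom C g" "Cod C (f \<^bold>- g) = Cod C g"
  using assms by (simp_all add: sub_def)

lemma sub_Zer [simp]:
  assumes "f \<in> Arr C" "Dom C f = A" "Cod C f = B"
  shows "f \<^bold>- Zer C A B = f"
  using assms by (auto simp: sub_def)

lemma sub_self [simp]: "f \<in> Arr C \<Longrightarrow> f \<^bold>- f = Zer C (Dom C f) (Cod C f)"
  by (simp add: sub_def)

lemma sub_add_cancel:
  assumes "f \<in> homs C A B" "g \<in> homs C A B"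
  shows "f \<^bold>- g \<^bold>+ g = f"
  using assms Add_assoc[of f A B "neg_mor C g" g] by (simp add: sub_def)

lemma add_eq_iff_sub:
  assumes "f \<in> homs C A B" "g \<in> homs C A B" "h \<in> homs C A B"
  shows "f \<^bold>- g = h \<longleftrightarrow> f = h \<^bold>+ g"
proof
  assume "f \<^bold>- g = h" then show "f = h \<^bold>+ g" using sub_add_cancel[OF assms(1,2)] by simp
next
  assume "f = h \<^bold>+ g" then show "f \<^bold>- g = h"
    using assms Add_assoc[of h A B g "neg_mor C g"] by (simp add: sub_def)
qed

lemma sub_eq_Zer_iff:
  assumes "f \<in> homs C A B" "g \<in> homs C A B"
  shows "f \<^bold>- g = Zer C A B \<longleftrightarrow> f = g"
proof -
  have "Zer C A B \<in> homs C A B" using assms by auto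
  with assms show ?thesis by (subst add_eq_iff_sub[of _ A B]) auto
qed

lemma sub_sub:
  assumes "f \<in> homs C A B" "g \<in> homs C A B"
  shows "f \<^bold>- (f \<^bold>- g) = g"
  using assms Add_commute[of "f \<^bold>- g" A B g] sub_add_cancel[OF assms]
  by (subst add_eq_iff_sub[of _ A B]) auto

lemma Comp_sub [simp]:
  assumes "f \<in> Arr C" "g \<in> Arr C" "h \<in> Arr C" "Dom C f = Dom C g" "Cod C f = Cod C g"
  shows "Cod C f = Dom C h \<Longrightarrow> h \<cdot> (f \<^bold>- g) = h \<cdot> f \<^bold>- h \<cdot> g"
    "Cod C h = Dom C f \<Longrightarrow> (f \<^bold>- g) \<cdot> h = f \<cdot> h \<^bold>- g \<cdot> h"
  using assms by (simp_all add: sub_def neg_Comp)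

lemma zero_object_Arr_out:
  assumes "is_zero_object C Z" "f \<in> homs C Z A" shows "f = Zer C Z A"
  using assms Comp_Ident_simps(1)[of f Z] Comp_Zer(1)[of f Z Z] unfolding is_zero_object_def by auto

lemma zero_object_Arr_in:
  assumes "is_zero_object C Z" "f \<in> homs C A Z" shows "f = Zer C A Z"
  using assms Comp_Ident_simps(2)[of f Z] Comp_Zer(2)[of f Z Z] unfolding is_zero_object_def by auto

lemma homs_eq_ZerI:
  assumes "A \<in> Obj C" "B \<in> Obj C" "\<And>f. f \<in> homs C A B \<Longrightarrow> f = Zer C A B"
  shows "homs C A B = {Zer C A B}"
  using assms by (auto simp del: mem_homs) (auto)

lemma biproduct_copair:
  assumes "is_biproduct C A B S i j p q" "f \<in> homs C A X" "g \<in> homs C B X"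
  shows "\<exists>u \<in> homs C S X. u \<cdot> i = f \<and> u \<cdot> j = g"
proof (intro bexI[of _ "f \<cdot> p \<^bold>+ g \<cdot> q"] conjI)
  have ob: "A \<in> Obj C" "B \<in> Obj C" "X \<in> Obj C" using assms by auto
  show "(f \<cdot> p \<^bold>+ g \<cdot> q) \<cdot> i = f" "(f \<cdot> p \<^bold>+ g \<cdot> q) \<cdot> j = g"
    using assms ob by (auto simp: is_biproduct_def)
  show "f \<cdot> p \<^bold>+ g \<cdot> q \<in> homs C S X"
    using assms by (auto simp: is_biproduct_def)
qed

lemma biproduct_ext:
  assumes bp: "is_biproduct C A B S i j p q" and uv: "u \<in> homs C S X" "v \<in> homs C S X"
    and eq: "u \<cdot> i = v \<cdot> i" "u \<cdot> j = v \<cdot> j"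
  shows "u = v"
proof -
  have dec: "w = (w \<cdot> i) \<cdot> p \<^bold>+ (w \<cdot> j) \<cdot> q" if "w \<in> homs C S X" for w
  proof -
    have "w = w \<cdot> (i \<cdot> p \<^bold>+ j \<cdot> q)"
      using bp that by (auto simp: is_biproduct_def simp del: Comp_Add_simps)
    also have "\<dots> = (w \<cdot> i) \<cdot> p \<^bold>+ (w \<cdot> j) \<cdot> q"
      using bp that by (subst Comp_Add_simps(1)) (simp_all add: is_biproduct_def)
    finally show ?thesis .
  qed
  show ?thesis using dec[OF uv(1)] dec[OF uv(2)] eq by metis
qed

end

section \<open>Triangulated categories\<close>

context triangulated_category
begin

notation sub (infixl \<open>\<^bold>-\<close> 65)
notation add (infixl \<open>\<^bold>+\<close> 65)

lemma ShO_Obj [simp]: "X \<in> Obj D \<Longrightarrow> ShO D X \<in> Obj D"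
  using ShO_bij by (auto simp: bij_betw_def)

lemma ShO_eq_iff: "X \<in> Obj D \<Longrightarrow> Y \<in> Obj D \<Longrightarrow> ShO D X = ShO D Y \<longleftrightarrow> X = Y"
  using ShO_bij by (auto simp: bij_betw_def inj_on_def)

lemma ShA_eq_iff: "f \<in> Arr D \<Longrightarrow> g \<in> Arr D \<Longrightarrow> ShA D f = ShA D g \<longleftrightarrow> f = g"
  using ShA_bij by (auto simp: bij_betw_def inj_on_def)

lemma ShA_simps [simp]:
  assumes "f \<in> Arr D"
  shows "ShA D f \<in> Arr D" "Dom D (ShA D f) = ShO D (Dom D f)" "Cod D (ShA D f) = ShO D (Cod D f)"
  using ShA_homs[of f "Dom D f" "Cod D f"] assms by auto

declare ShA_Ident [simp]

lemma ShA_Comp_simp [simp]: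
  "f \<in> Arr D \<Longrightarrow> g \<in> Arr D \<Longrightarrow> Cod D f = Dom D g \<Longrightarrow> ShA D (g \<cdot> f) = ShA D g \<cdot> ShA D f"
  using ShA_Comp[of f "Dom D f" "Cod D f" g "Cod D g"] by simp

lemma ShA_Zer [simp]:
  assumes "A \<in> Obj D" "B \<in> Obj D"
  shows "ShA D (Zer D A B) = Zer D (ShO D A) (ShO D B)"
proof -
  have "ShA D (Zer D A B \<^bold>+ Zer D A B) = ShA D (Zer D A B) \<^bold>+ ShA D (Zer D A B)"
    using assms by (intro ShA_Add[of _ A B]) auto
  then have "ShA D (Zer D A B) \<^bold>+ ShA D (Zer D A B) =
      ShA D (Zer D A B) \<^bold>+ Zer D (ShO D A) (ShO D B)"
    using assms by simp
  then show ?thesis using assms by (subst (asm) Add_left_cancel[of _ "ShO D A" "ShO D B"]) auto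
qed

lemma ShA_neg [simp]:
  assumes "f \<in> Arr D" shows "ShA D (neg_mor D f) = neg_mor D (ShA D f)"
proof -
  have "ShA D (f \<^bold>+ neg_mor D f) = ShA D f \<^bold>+ ShA D (neg_mor D f)"
    using assms by (intro ShA_Add[of _ "Dom D f" "Cod D f"]) auto
  then show ?thesis
    using assms by (intro neg_eqI[symmetric, of _ "ShO D (Dom D f)" "ShO D (Cod D f)"]) auto
qed

lemma ShA_sub [simp]:
  assumes "f \<in> Arr D" "g \<in> Arr D" "Dom D f = Dom D g" "Cod D f = Cod D g"
  shows "ShA D (f \<^bold>- g) = ShA D f \<^bold>- ShA D g"
  using assms ShA_Add[of f "Dom D g" "Cod D g" "neg_mor D g"] by (simp add: sub_def)

lemma unshift_Obj:
  assumes "X \<in> Obj D" obtains X' where "X' \<in> Obj D" "ShO D X' = X"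
  using ShO_bij assms by (metis bij_betw_iff_bijections)

lemma unshift_homs:
  assumes "f \<in> homs D (ShO D A) (ShO D B)" "A \<in> Obj D" "B \<in> Obj D"
  obtains f' where "f' \<in> homs D A B" "ShA D f' = f"
proof -
  obtain f' where "f' \<in> Arr D" "ShA D f' = f"
    using ShA_bij assms(1) by (metis bij_betw_iff_bijections mem_homs)
  moreover from this have "f' \<in> homs D A B"
    using assms by (auto simp: ShO_eq_iff)
  ultimately show ?thesis using that by blast
qed

lemma zero_object_shift:
  assumes "X \<in> Obj D" shows "is_zero_object D (ShO D X) \<longleftrightarrow> is_zero_object D X"
  using assms ShA_eq_iff[of "Ident D X" "Zer D X X"] by (auto simp: is_zero_object_def)

text \<open>Naming the three vertices makes all domains and codomains available to the simplifier
  through \<open>triD\<close>; \<open>Tri\<close> leaves them implicit.\<close>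

definition tri :: "'o \<Rightarrow> 'o \<Rightarrow> 'o \<Rightarrow> 'm \<Rightarrow> 'm \<Rightarrow> 'm \<Rightarrow> bool" where
  "tri A B B' f g h \<longleftrightarrow> (f, g, h) \<in> Tri D \<and>
     f \<in> homs D A B \<and> g \<in> homs D B B' \<and> h \<in> homs D B' (ShO D A)"

lemma triI: "(f, g, h) \<in> Tri D \<Longrightarrow> tri (Dom D f) (Cod D f) (Cod D g) f g h"
  using Tri_candidate[of f g h] unfolding tri_def by (auto simp: candidate_triangle_def)

lemma triD:
  assumes "tri A B B' f g h"
  shows "f \<in> Arr D" "Dom D f = A" "Cod D f = B" "g \<in> Arr D" "Dom D g = B" "Cod D g = B'"
    "h \<in> Arr D" "Dom D h = B'" "Cod D h = ShO D A" "A \<in> Obj D" "B \<in> Obj D" "B' \<in> Obj D"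
  using assms unfolding tri_def by auto

lemma tri_Tri: "tri A B B' f g h \<Longrightarrow> (f, g, h) \<in> Tri D"
  unfolding tri_def by blast

lemma cone_exists:
  assumes "f \<in> homs D A B" obtains B' g h where "tri A B B' f g h"
proof -
  obtain g h where "(f, g, h) \<in> Tri D" using assms Tri_exists[of f] by auto
  from triI[OF this] show ?thesis using assms that[of "Cod D g" g h] by simp
qed

lemma tri_rotate:
  assumes t: "tri A B B' f g h" shows "tri B B' (ShO D A) g h (neg_mor D (ShA D f))"
proof -
  note assms = t and [simp] = triD[OF t]
  have "candidate_triangle D f g h" using Tri_candidate[OF tri_Tri[OF t]] .
  then have "(g, h, neg_mor D (ShA D f)) \<in> Tri D" using tri_Tri[OF t] Tri_rotate by blast
  from triI[OF this] show ?thesis by simp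
qed

text \<open>Rotation puts \<open>-k[1]\<close> in third place, so \<open>k\<close> has to be the
  desuspension of \<open>-h\<close>.\<close>

lemma tri_rotate_back:
  assumes t: "tri A B B' f g h"
  obtains F k where "tri F A B k f g" "ShO D F = B'" "neg_mor D (ShA D k) = h"
proof -
  note [simp] = triD[OF t]
  obtain F where F: "F \<in> Obj D" "ShO D F = B'" using unshift_Obj triD(12)[OF t] by blast
  have "neg_mor D h \<in> homs D (ShO D F) (ShO D A)" using t F by simp
  then obtain k where k: "k \<in> homs D F A" "ShA D k = neg_mor D h"
    using unshift_homs F triD[OF t] by blast
  have h: "neg_mor D (ShA D k) = h" using k t by simp
  have "candidate_triangle D k f g" using k t F by (simp add: candidate_triangle_def)
  then have "(k, f, g) \<in> Tri D" using Tri_rotate[of k f g] h tri_Tri[OF t] by simp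
  from triI[OF this] have "tri F A B k f g" using k by simp
  then show ?thesis using that F h by blast
qed

lemma fibre_exists:
  assumes "f \<in> homs D A B" obtains F k h where "tri F A B k f h"
  using assms cone_exists tri_rotate_back by metis

lemma tri_Ident:
  assumes "X \<in> Obj D" "is_zero_object D Z"
  shows "tri X X Z (Ident D X) (Zer D X Z) (Zer D Z (ShO D X))"
  using assms Tri_Ident[OF assms] unfolding tri_def by (auto simp: is_zero_object_def)

lemma zero_obtain: obtains Z where "is_zero_object D Z" "Z \<in> Obj D"
  using zero_object by (auto simp: is_zero_object_def)

lemma tri_map:
  assumes t: "tri A B B' f g h" and t': "tri X Y Y' f' g' h'"
    and "a \<in> homs D A X" "b \<in> homs D B Y" "b \<cdot> f = f' \<cdot> a"
  obtains c where "c \<in> homs D B' Y'" "c \<cdot> g = g' \<cdot> b" "ShA D a \<cdot> h = h' \<cdot> c"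
proof -
  note [simp] = triD[OF t] triD[OF t']
  obtain c where "triangle_morphism D (f, g, h) (f', g', h') a b c"
    using Tri_morphism[OF tri_Tri[OF t] tri_Tri[OF t'], of a b] assms triD[OF t] triD[OF t'] by auto
  then show ?thesis using that triD[OF t] triD[OF t'] by (auto simp: triangle_morphism_def)
qed

text \<open>The pair \<open>(1, f)\<close> maps the triangle \<open>A = A \<rightarrow> 0\<close> to
  the given one; its second square exhibits \<open>g f\<close> as a map through zero.\<close>

lemma tri_comp1: assumes t: "tri A B B' f g h" shows "g \<cdot> f = Zer D A B'"
proof -
  note [simp] = triD[OF t]
  obtain Z where Z: "is_zero_object D Z" "Z \<in> Obj D" by (rule zero_obtain)
  obtain c where c: "c \<in> homs D Z B'" "c \<cdot> Zer D A Z = g \<cdot> f"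
    using tri_map[OF tri_Ident[OF triD(10)[OF t] Z(1)] t, of "Ident D A" f] t by auto
  then show ?thesis using t Z by auto
qed

lemma tri_comp2: "tri A B B' f g h \<Longrightarrow> h \<cdot> g = Zer D B (ShO D A)"
  using tri_comp1[OF tri_rotate] .

lemma tri_comp3: assumes t: "tri A B B' f g h" shows "ShA D f \<cdot> h = Zer D B' (ShO D B)"
proof -
  note [simp] = triD[OF t]
  have "neg_mor D (ShA D f) \<cdot> h = Zer D B' (ShO D B)"
    using tri_comp2[OF tri_rotate[OF t]] .
  then have "neg_mor D (ShA D f \<cdot> h) = Zer D B' (ShO D B)" using t by (simp add: neg_Comp)
  then show ?thesis using t by (subst (asm) neg_eq_Zer_iff[of _ B' "ShO D B"]) auto
qed

text \<open>Exactness of \<open>D(-, X)\<close>: \<open>u\<close> and a zero map form a morphism to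
  the triangle \<open>F \<rightarrow> X = X\<close> obtained by rotating
  \<open>X = X \<rightarrow> 0\<close> back. Its third component is \<open>v\<close>, which need not
  be unique.\<close>

lemma weak_cokernel:
  assumes t: "tri A B B' f g h" and u: "u \<in> homs D B X" "u \<cdot> f = Zer D A X"
  obtains v where "v \<in> homs D B' X" "v \<cdot> g = u"
proof -
  note [simp] = triD[OF t]
  obtain Z where Z: "is_zero_object D Z" "Z \<in> Obj D" by (rule zero_obtain)
  have X: "X \<in> Obj D" using u by auto
  obtain F k where F: "tri F X X k (Ident D X) (Zer D X Z)"
    by (rule tri_rotate_back[OF tri_Ident[OF X Z(1)]])
  note [simp] = triD[OF F]
  have "Zer D A F \<in> homs D A F" "u \<cdot> f = k \<cdot> Zer D A F" using t u F by auto
  then obtain c where "c \<in> homs D B' X" "c \<cdot> g = Ident D X \<cdot> u"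
    using tri_map[OF t F _ u(1), of "Zer D A F"] by metis
  then show ?thesis using that u by simp
qed

text \<open>Dually, the rotated triangle \<open>X \<rightarrow> 0 \<rightarrow> X[1]\<close> is
  mapped to the rotation of the given one. The third component goes from \<open>X[1]\<close> to
  \<open>A[1]\<close> and \<open>v\<close> is its desuspension; the two signs cancel.\<close>

lemma weak_kernel:
  assumes t: "tri A B B' f g h" and u: "u \<in> homs D X B" "g \<cdot> u = Zer D X B'"
  obtains v where "v \<in> homs D X A" "f \<cdot> v = u"
proof -
  note [simp] = triD[OF t]
  obtain Z where Z: "is_zero_object D Z" "Z \<in> Obj D" by (rule zero_obtain)
  have X: "X \<in> Obj D" using u by auto
  have "Zer D Z B' \<cdot> Zer D X Z = g \<cdot> u" using t u Z X by auto
  then obtain c where c: "c \<in> homs D (ShO D X) (ShO D A)"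
      "ShA D u \<cdot> neg_mor D (ShA D (Ident D X)) = neg_mor D (ShA D f) \<cdot> c"
    using tri_map[OF tri_rotate[OF tri_Ident[OF X Z(1)]] tri_rotate[OF t] u(1), of "Zer D Z B'"]
      Z t by auto
  obtain v where v: "v \<in> homs D X A" "ShA D v = c"
    using unshift_homs[OF c(1) X triD(10)[OF t]] by blast
  have "neg_mor D (ShA D u) = neg_mor D (ShA D (f \<cdot> v))"
    using c(2) v(1) u(1) X by (simp add: neg_Comp v(2)[symmetric])
  then have "ShA D u = ShA D (f \<cdot> v)"
    using neg_simps(6)[of "ShA D u"] neg_simps(6)[of "ShA D (f \<cdot> v)"] u(1) v(1)
    by (metis Comp_simps(1) ShA_simps(1) mem_homs triD(1,2)[OF t])
  then have "u = f \<cdot> v" using u v t by (subst (asm) ShA_eq_iff) auto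
  then show ?thesis using that v by blast
qed

lemma weak_cokernel2:
  assumes t: "tri A B B' f g h" and u: "u \<in> homs D B' X" "u \<cdot> g = Zer D B X"
  obtains v where "v \<in> homs D (ShO D A) X" "v \<cdot> h = u"
  using weak_cokernel[OF tri_rotate[OF t] u] .

lemma weak_kernel2:
  assumes t: "tri A B B' f g h" and u: "u \<in> homs D X B'" "h \<cdot> u = Zer D X (ShO D A)"
  obtains v where "v \<in> homs D X B" "g \<cdot> v = u"
  using weak_kernel[OF tri_rotate[OF t] u] .

lemma weak_kernel3:
  assumes t: "tri A B B' f g h" and u: "u \<in> homs D X (ShO D A)" "ShA D f \<cdot> u = Zer D X (ShO D B)"
  obtains v where "v \<in> homs D X B'" "h \<cdot> v = u"
proof -
  note [simp] = triD[OF t]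
  have "neg_mor D (ShA D f) \<cdot> u = Zer D X (ShO D B)"
    using u triD[OF t] by (auto simp: neg_Comp)
  then show ?thesis using that weak_kernel2[OF tri_rotate[OF t] u(1)] by blast
qed

text \<open>The octahedral axiom produces \<open>u\<close> with \<open>e \<cdot> u = k\<close>; a map out of \<open>P\<close> with the right
  restriction to \<open>W\<close> can then be corrected by a map factoring through \<open>e\<close>.\<close>

lemma weak_pushout:
  assumes t: "tri R F Q d f k" and w: "w \<in> homs D F W" and t': "tri R W P (w \<cdot> d) a e"
  obtains u where "u \<in> homs D Q P" "u \<cdot> f = a \<cdot> w"
    "\<And>X q w'. q \<in> homs D Q X \<Longrightarrow> w' \<in> homs D W X \<Longrightarrow> q \<cdot> f = w' \<cdot> w \<Longrightarrow>
       \<exists>v \<in> homs D P X. v \<cdot> u = q \<and> v \<cdot> a = w'"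
proof -
  note [simp] = triD[OF t] triD[OF t']
  obtain V w1 w2 where t2: "tri F W V w w1 w2" by (rule cone_exists[OF w])
  note [simp] = triD[OF t2]
  obtain u where u: "u \<in> homs D Q P" "u \<cdot> f = a \<cdot> w" "e \<cdot> u = k"
    using octahedral[OF tri_Tri[OF t] tri_Tri[OF t2] _ tri_Tri[OF t']] t t2 t' by auto
  show ?thesis
  proof (rule that[OF u(1,2)])
    fix X q w' assume q: "q \<in> homs D Q X" and w': "w' \<in> homs D W X" and qf: "q \<cdot> f = w' \<cdot> w"
    have X: "X \<in> Obj D" using q by auto
    have "w' \<cdot> (w \<cdot> d) = (w' \<cdot> w) \<cdot> d" using w w' t by simp
    also have "\<dots> = q \<cdot> (f \<cdot> d)" using q t by (simp add: qf[symmetric])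
    also have "\<dots> = Zer D R X" using q t X by (simp add: tri_comp1[OF t])
    finally obtain c where c: "c \<in> homs D P X" "c \<cdot> a = w'"
      using weak_cokernel[OF t' w'] by blast
    have "(c \<cdot> u) \<cdot> f = (c \<cdot> a) \<cdot> w" using c(1) u t t' w by simp
    then have "(c \<cdot> u \<^bold>- q) \<cdot> f = Zer D F X" using c u q qf t w w' X by (simp del: assoc)
    then obtain s where s: "s \<in> homs D (ShO D R) X" "s \<cdot> k = c \<cdot> u \<^bold>- q"
      using weak_cokernel2[OF t, of "c \<cdot> u \<^bold>- q"] c u q by auto
    show "\<exists>v \<in> homs D P X. v \<cdot> u = q \<and> v \<cdot> a = w'"
    proof (intro bexI conjI)
      show "c \<^bold>- s \<cdot> e \<in> homs D P X" using c s t' by simp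
      have "(c \<^bold>- s \<cdot> e) \<cdot> u = c \<cdot> u \<^bold>- s \<cdot> k" using c s t' u by simp
      also have "\<dots> = q" using sub_sub[of "c \<cdot> u" Q X q] s(2) c u q by simp
      finally show "(c \<^bold>- s \<cdot> e) \<cdot> u = q" .
      have "(c \<^bold>- s \<cdot> e) \<cdot> a = c \<cdot> a \<^bold>- s \<cdot> (e \<cdot> a)" using c s t' by simp
      also have "\<dots> = w'" using c(2) s t' w' X by (simp add: tri_comp2[OF t'])
      finally show "(c \<^bold>- s \<cdot> e) \<cdot> a = w'" .
    qed
  qed
qed

lemma is_isoI:
  assumes "f \<in> homs D A B" "g \<in> homs D B A" "g \<cdot> f = Ident D A" "f \<cdot> g = Ident D B"
  shows "is_iso D f"
  using assms by (auto simp: is_iso_def)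

text \<open>Since \<open>g\<close> is zero, the identity of \<open>B\<close> lifts along
  \<open>f\<close> to \<open>s\<close>. That \<open>s\<close> is also a left inverse comes from the
  fibre: \<open>s f - 1\<close> is killed by \<open>f\<close>, hence factors through the zero object
  \<open>F\<close>.\<close>

lemma zero_cone_iso:
  assumes t: "tri A B B' f g h" and z: "is_zero_object D B'"
  obtains s where "s \<in> homs D B A" "f \<cdot> s = Ident D B" "s \<cdot> f = Ident D A"
proof -
  note [simp] = triD[OF t]
  have "g \<cdot> Ident D B = Zer D B B'"
    using zero_object_Arr_in[OF z, of g B] t by simp
  then obtain s where s: "s \<in> homs D B A" "f \<cdot> s = Ident D B"
    using weak_kernel[OF t, of "Ident D B" B] t by auto
  obtain F k where F: "tri F A B k f g" "ShO D F = B'" by (rule tri_rotate_back[OF t])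
  note [simp] = triD[OF F(1)]
  have zF: "is_zero_object D F" using z F zero_object_shift[of F] by simp
  have "f \<cdot> (s \<cdot> f \<^bold>- Ident D A) = (f \<cdot> s) \<cdot> f \<^bold>- f" using s(1) t by simp
  also have "\<dots> = Zer D A B" using s(2) t by simp
  finally obtain v where v: "v \<in> homs D A F" "k \<cdot> v = s \<cdot> f \<^bold>- Ident D A"
    using weak_kernel[OF F(1), of "s \<cdot> f \<^bold>- Ident D A" A] s t by auto
  have "v = Zer D A F" using zero_object_Arr_in[OF zF v(1)] .
  then have "s \<cdot> f \<^bold>- Ident D A = Zer D A A" using v by auto
  then have "s \<cdot> f = Ident D A" using s t by (subst (asm) sub_eq_Zer_iff[of _ A A]) auto
  then show ?thesis using that s by blast
qed

end

section \<open>Small sets and small coproducts\<close>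

lemma inaccessible_infinite:
  assumes "inaccessible \<kappa>" shows "Card_order \<kappa>" "\<not> finite (Field \<kappa>)" "stable \<kappa>" "natLeq <o \<kappa>"
proof -
  show c: "Card_order \<kappa>" "natLeq <o \<kappa>" using assms by (auto simp: inaccessible_def)
  then show inf: "\<not> finite (Field \<kappa>)"
    using cinfinite_mono[OF ordLess_imp_ordLeq natLeq_cinfinite] by (auto simp: cinfinite_def)
  show "stable \<kappa>"
    using regularCard_stable[OF c(1) inf] assms by (auto simp: inaccessible_def)
qed

lemma small_countable:
  assumes "inaccessible \<kappa>" "countable A" shows "|A| <o \<kappa>"
proof -
  have "|A| \<le>o natLeq"
    using assms(2) card_of_nat ordLeq_ordIso_trans card_of_ordLeqI[of _ A "UNIV :: nat set"]
    by (auto simp: countable_def)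
  then show ?thesis using inaccessible_infinite(4)[OF assms(1)] ordLeq_ordLess_trans by blast
qed

lemma small_image: "|A| <o \<kappa> \<Longrightarrow> |f ` A| <o \<kappa>"
  using card_of_image ordLeq_ordLess_trans by blast

lemma small_subset: "|A| <o \<kappa> \<Longrightarrow> B \<subseteq> A \<Longrightarrow> |B| <o \<kappa>"
  using card_of_mono1 ordLeq_ordLess_trans by blast

lemma small_UN:
  assumes "inaccessible \<kappa>" "|A| <o \<kappa>" "\<And>a. a \<in> A \<Longrightarrow> |F a| <o \<kappa>"
  shows "|\<Union>a\<in>A. F a| <o \<kappa>"
  using stable_UNION[OF inaccessible_infinite(3)[OF assms(1)] assms(2)] assms(3) by blast

lemma small_Un:
  assumes "inaccessible \<kappa>" "|A| <o \<kappa>" "|B| <o \<kappa>" shows "|A \<union> B| <o \<kappa>"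
  using card_of_Un_ordLess_infinite_Field inaccessible_infinite[OF assms(1)] assms by blast

lemma small_Times:
  assumes "inaccessible \<kappa>" "|A| <o \<kappa>" "|B| <o \<kappa>" shows "|A \<times> B| <o \<kappa>"
proof -
  have "A \<times> B = (\<Union>a\<in>A. Pair a ` B)" by auto
  then show ?thesis using small_UN[OF assms(1,2), of "\<lambda>a. Pair a ` B"] small_image[OF assms(3)] by metis
qed

section \<open>Coproducts, their projections and their finite parts\<close>

context preadditive_category
begin

definition cotuple :: "'i set \<Rightarrow> 'o \<Rightarrow> ('i \<Rightarrow> 'm) \<Rightarrow> 'o \<Rightarrow> ('i \<Rightarrow> 'm) \<Rightarrow> 'm" where
  "cotuple I S \<iota> Z g = (THE u. u \<in> homs C S Z \<and> (\<forall>i \<in> I. u \<cdot> \<iota> i = g i))"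

definition cproj :: "'i set \<Rightarrow> ('i \<Rightarrow> 'o) \<Rightarrow> 'o \<Rightarrow> ('i \<Rightarrow> 'm) \<Rightarrow> 'i \<Rightarrow> 'm" where
  "cproj I M S \<iota> k = cotuple I S \<iota> (M k) (\<lambda>i. if i = k then Ident C (M k) else Zer C (M i) (M k))"

text \<open>An object \<open>P\<close> is compact if and only if each morphism \<open>P \<rightarrow> S\<close> is fixed by the idempotent \<open>cpart\<close>
  of some finite \<open>J\<close>; in this form compactness involves no sums of morphisms.\<close>

definition cpart :: "'i set \<Rightarrow> ('i \<Rightarrow> 'o) \<Rightarrow> 'o \<Rightarrow> ('i \<Rightarrow> 'm) \<Rightarrow> 'i set \<Rightarrow> 'm" where
  "cpart I M S \<iota> J = cotuple I S \<iota> S (\<lambda>i. if i \<in> J then \<iota> i else Zer C (M i) S)"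

lemma coproductD:
  assumes "is_coproduct C I M S \<iota>"
  shows "S \<in> Obj C" "i \<in> I \<Longrightarrow> \<iota> i \<in> Arr C" "i \<in> I \<Longrightarrow> Dom C (\<iota> i) = M i"
    "i \<in> I \<Longrightarrow> Cod C (\<iota> i) = S" "i \<in> I \<Longrightarrow> M i \<in> Obj C"
proof -
  show "S \<in> Obj C" using assms by (simp add: is_coproduct_def)
  have "\<iota> i \<in> homs C (M i) S" if "i \<in> I" using assms that unfolding is_coproduct_def by blast
  then show "i \<in> I \<Longrightarrow> \<iota> i \<in> Arr C" "i \<in> I \<Longrightarrow> Dom C (\<iota> i) = M i"
    "i \<in> I \<Longrightarrow> Cod C (\<iota> i) = S" "i \<in> I \<Longrightarrow> M i \<in> Obj C"
    using Dom_Obj[of "\<iota> i"] by auto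
qed

lemma cotuple:
  assumes cp: "is_coproduct C I M S \<iota>" and "Z \<in> Obj C" and g: "\<And>i. i \<in> I \<Longrightarrow> g i \<in> homs C (M i) Z"
  shows "cotuple I S \<iota> Z g \<in> homs C S Z" "i \<in> I \<Longrightarrow> cotuple I S \<iota> Z g \<cdot> \<iota> i = g i"
proof -
  have "\<exists>!u. u \<in> homs C S Z \<and> (\<forall>i \<in> I. u \<cdot> \<iota> i = g i)"
    using assms unfolding is_coproduct_def by blast
  from theI'[OF this] show "cotuple I S \<iota> Z g \<in> homs C S Z" "i \<in> I \<Longrightarrow> cotuple I S \<iota> Z g \<cdot> \<iota> i = g i"
    unfolding cotuple_def by blast+
qed

lemma coproduct_ext:
  assumes cp: "is_coproduct C I M S \<iota>" and u: "u \<in> homs C S Z" and v: "v \<in> homs C S Z"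
    and eq: "\<And>i. i \<in> I \<Longrightarrow> u \<cdot> \<iota> i = v \<cdot> \<iota> i"
  shows "u = v"
proof -
  have "Z \<in> Obj C" "\<And>i. i \<in> I \<Longrightarrow> u \<cdot> \<iota> i \<in> homs C (M i) Z"
    using u coproductD[OF cp] by auto
  then have "\<exists>!w. w \<in> homs C S Z \<and> (\<forall>i \<in> I. w \<cdot> \<iota> i = u \<cdot> \<iota> i)"
    using cp unfolding is_coproduct_def by simp
  moreover have "v \<in> homs C S Z \<and> (\<forall>i \<in> I. v \<cdot> \<iota> i = u \<cdot> \<iota> i)" using v eq by simp
  ultimately show ?thesis using u by blast
qed

lemma cproj:
  assumes cp: "is_coproduct C I M S \<iota>" and k: "k \<in> I"
  shows "cproj I M S \<iota> k \<in> Arr C" "Dom C (cproj I M S \<iota> k) = S" "Cod C (cproj I M S \<iota> k) = M k"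
    "i \<in> I \<Longrightarrow> cproj I M S \<iota> k \<cdot> \<iota> i = (if i = k then Ident C (M k) else Zer C (M i) (M k))"
proof -
  note [simp] = coproductD[OF cp]
  have "(if i = k then Ident C (M k) else Zer C (M i) (M k)) \<in> homs C (M i) (M k)" if "i \<in> I" for i
    using that k by auto
  from cotuple[OF cp coproductD(5)[OF cp k], of "\<lambda>i. if i = k then Ident C (M k) else Zer C (M i) (M k)", OF this]
  show "cproj I M S \<iota> k \<in> Arr C" "Dom C (cproj I M S \<iota> k) = S" "Cod C (cproj I M S \<iota> k) = M k"
    "i \<in> I \<Longrightarrow> cproj I M S \<iota> k \<cdot> \<iota> i = (if i = k then Ident C (M k) else Zer C (M i) (M k))"
    unfolding cproj_def by auto
qed

lemma cpart:
  assumes cp: "is_coproduct C I M S \<iota>"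
  shows "cpart I M S \<iota> J \<in> Arr C" "Dom C (cpart I M S \<iota> J) = S" "Cod C (cpart I M S \<iota> J) = S"
    "i \<in> I \<Longrightarrow> cpart I M S \<iota> J \<cdot> \<iota> i = (if i \<in> J then \<iota> i else Zer C (M i) S)"
proof -
  note [simp] = coproductD[OF cp]
  have "(if i \<in> J then \<iota> i else Zer C (M i) S) \<in> homs C (M i) S" if "i \<in> I" for i
    using that by auto
  from cotuple[OF cp coproductD(1)[OF cp], of "\<lambda>i. if i \<in> J then \<iota> i else Zer C (M i) S", OF this]
  show "cpart I M S \<iota> J \<in> Arr C" "Dom C (cpart I M S \<iota> J) = S" "Cod C (cpart I M S \<iota> J) = S"
    "i \<in> I \<Longrightarrow> cpart I M S \<iota> J \<cdot> \<iota> i = (if i \<in> J then \<iota> i else Zer C (M i) S)"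
    unfolding cpart_def by auto
qed

lemma cpart_mono:
  assumes cp: "is_coproduct C I M S \<iota>" and "J \<subseteq> K"
  shows "cpart I M S \<iota> K \<cdot> cpart I M S \<iota> J = cpart I M S \<iota> J"
proof (rule coproduct_ext[OF cp])
  note [simp] = coproductD[OF cp] cpart[OF cp]
  show "cpart I M S \<iota> K \<cdot> cpart I M S \<iota> J \<in> homs C S S" "cpart I M S \<iota> J \<in> homs C S S" by auto
  show "cpart I M S \<iota> K \<cdot> cpart I M S \<iota> J \<cdot> \<iota> i = cpart I M S \<iota> J \<cdot> \<iota> i" if "i \<in> I" for i
    using that assms by auto
qed

lemma cpart_mono_fix:
  assumes cp: "is_coproduct C I M S \<iota>" and "J \<subseteq> K" and u: "u \<in> homs C Q S" "cpart I M S \<iota> J \<cdot> u = u"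
  shows "cpart I M S \<iota> K \<cdot> u = u"
proof -
  have "cpart I M S \<iota> K \<cdot> (cpart I M S \<iota> J \<cdot> u) = (cpart I M S \<iota> K \<cdot> cpart I M S \<iota> J) \<cdot> u"
    using u(1) cpart[OF cp] by simp
  then show ?thesis using u(2) cpart_mono[OF assms(1,2)] by simp
qed

lemma cpart_empty:
  assumes cp: "is_coproduct C I M S \<iota>" shows "cpart I M S \<iota> {} = Zer C S S"
proof (rule coproduct_ext[OF cp])
  note [simp] = coproductD[OF cp] cpart[OF cp]
  show "cpart I M S \<iota> {} \<in> homs C S S" "Zer C S S \<in> homs C S S" by auto
  show "cpart I M S \<iota> {} \<cdot> \<iota> i = Zer C S S \<cdot> \<iota> i" if "i \<in> I" for i using that by auto
qed

lemma cpart_insert: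
  assumes cp: "is_coproduct C I M S \<iota>" and j: "j \<in> I" "j \<notin> J"
  shows "cpart I M S \<iota> (insert j J) = cpart I M S \<iota> J \<^bold>+ \<iota> j \<cdot> cproj I M S \<iota> j"
proof (rule coproduct_ext[OF cp])
  note [simp] = coproductD[OF cp] cpart[OF cp] cproj[OF cp j(1)] j
  show "cpart I M S \<iota> (insert j J) \<in> homs C S S"
    "cpart I M S \<iota> J \<^bold>+ \<iota> j \<cdot> cproj I M S \<iota> j \<in> homs C S S" by auto
  show "cpart I M S \<iota> (insert j J) \<cdot> \<iota> i = (cpart I M S \<iota> J \<^bold>+ \<iota> j \<cdot> cproj I M S \<iota> j) \<cdot> \<iota> i"
    if "i \<in> I" for i using that by auto
qed

lemma cproj_cpart:
  assumes cp: "is_coproduct C I M S \<iota>" and k: "k \<in> I"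
  shows "cproj I M S \<iota> k \<cdot> cpart I M S \<iota> J = (if k \<in> J then cproj I M S \<iota> k else Zer C S (M k))"
proof (rule coproduct_ext[OF cp])
  note [simp] = coproductD[OF cp] cpart[OF cp] cproj[OF cp k] k
  show "cproj I M S \<iota> k \<cdot> cpart I M S \<iota> J \<in> homs C S (M k)"
    "(if k \<in> J then cproj I M S \<iota> k else Zer C S (M k)) \<in> homs C S (M k)" by auto
  show "cproj I M S \<iota> k \<cdot> cpart I M S \<iota> J \<cdot> \<iota> i =
    (if k \<in> J then cproj I M S \<iota> k else Zer C S (M k)) \<cdot> \<iota> i" if "i \<in> I" for i
    using that by auto
qed

text \<open>A map into an infinite coproduct need not be determined by its projections. One that
  lives on a finite part is, because \<open>cpart J\<close> is the finite sum of the idempotents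
  \<open>\<iota> j\<close> after \<open>cproj j\<close>; the induction adds one index at a
  time.\<close>

lemma finite_part_eq_Zer:
  assumes cp: "is_coproduct C I M S \<iota>" and w: "w \<in> homs C Q S" "cpart I M S \<iota> J \<cdot> w = w"
    and J: "finite J" "J \<subseteq> I" and z: "\<And>k. k \<in> I \<Longrightarrow> cproj I M S \<iota> k \<cdot> w = Zer C Q (M k)"
  shows "w = Zer C Q S"
proof -
  note [simp] = coproductD[OF cp] cpart[OF cp]
  have "cpart I M S \<iota> J \<cdot> w = Zer C Q S"
    using J
  proof (induction J)
    case empty then show ?case using cpart_empty[OF cp] w(1) by auto
  next
    case (insert j J)
    note [simp] = cproj[OF cp, of j]
    have "cpart I M S \<iota> (insert j J) \<cdot> w = cpart I M S \<iota> J \<cdot> w \<^bold>+ \<iota> j \<cdot> (cproj I M S \<iota> j \<cdot> w)"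
      using insert cpart_insert[OF cp, of j J] w(1) by simp
    then show ?case using insert z w(1) by auto
  qed
  then show ?thesis using w by simp
qed

text \<open>Small coproducts are postulated only for index sets of type \<open>'u set\<close>;
  reindexing carries them to families indexed by natural numbers or by morphisms.\<close>

lemma coproduct_reindex:
  assumes cp: "is_coproduct C I M S \<iota>" and e: "bij_betw e I' I"
  shows "is_coproduct C I' (M \<circ> e) S (\<iota> \<circ> e)"
  unfolding is_coproduct_def
proof (intro conjI ballI allI impI)
  note [simp] = coproductD[OF cp]
  have eI: "e i \<in> I" if "i \<in> I'" for i using that e by (auto simp: bij_betw_def)
  show "S \<in> Obj C" by simp
  show "(\<iota> \<circ> e) i \<in> homs C ((M \<circ> e) i) S" if "i \<in> I'" for i using eI[OF that] by simp
  fix Z g assume Z: "Z \<in> Obj C" and g: "\<forall>i \<in> I'. g i \<in> homs C ((M \<circ> e) i) Z"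
  define g' where "g' = g \<circ> the_inv_into I' e"
  have g'e: "g' (e i) = g i" if "i \<in> I'" for i
    using that e by (auto simp: g'_def bij_betw_def the_inv_into_f_f)
  have surj: "\<exists>i' \<in> I'. i = e i'" if "i \<in> I" for i using that e by (auto simp: bij_betw_def)
  have g': "g' i \<in> homs C (M i) Z" if i: "i \<in> I" for i
  proof -
    obtain i' where i': "i' \<in> I'" "i = e i'" using surj[OF i] by blast
    have "g i' \<in> homs C (M (e i')) Z" using g i' by auto
    then show ?thesis using i' g'e by simp
  qed
  show "\<exists>!u. u \<in> homs C S Z \<and> (\<forall>i \<in> I'. u \<cdot> (\<iota> \<circ> e) i = g i)"
  proof (intro ex1I[of _ "cotuple I S \<iota> Z g'"] conjI ballI)
    show "cotuple I S \<iota> Z g' \<in> homs C S Z" using cotuple(1)[OF cp Z g'] .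
    show "cotuple I S \<iota> Z g' \<cdot> (\<iota> \<circ> e) i = g i" if "i \<in> I'" for i
      using cotuple(2)[OF cp Z g' eI[OF that]] g'e that by simp
    fix u assume u: "u \<in> homs C S Z \<and> (\<forall>i \<in> I'. u \<cdot> (\<iota> \<circ> e) i = g i)"
    show "u = cotuple I S \<iota> Z g'"
    proof (rule coproduct_ext[OF cp])
      show "u \<in> homs C S Z" "cotuple I S \<iota> Z g' \<in> homs C S Z" using u cotuple(1)[OF cp Z g'] by auto
      fix i assume i: "i \<in> I"
      then obtain i' where i': "i' \<in> I'" "i = e i'" using surj by blast
      have "u \<cdot> \<iota> i = g' i" using u i' g'e by simp
      then show "u \<cdot> \<iota> i = cotuple I S \<iota> Z g' \<cdot> \<iota> i"
        using cotuple(2)[OF cp Z g' i] by simp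
    qed
  qed
qed

text \<open>Link between the sums \<open>gfinprod\<close> in the definition of compactness and the
  calculus of \<open>cpart\<close> and \<open>cproj\<close>, in which all later arguments are
  phrased.\<close>

lemma coproduct_finite_sum:
  assumes cp: "is_coproduct C I M S \<iota>" and J: "finite J" "J \<subseteq> I" and Q: "Q \<in> Obj C"
    and x: "\<And>i. i \<in> I \<Longrightarrow> x i \<in> homs C Q (M i)"
  defines "s \<equiv> gfinprod (hom_group C Q S) (\<lambda>i. \<iota> i \<cdot> x i) J"
  shows "s \<in> homs C Q S \<and> cpart I M S \<iota> J \<cdot> s = s \<and>
    (\<forall>k \<in> I. cproj I M S \<iota> k \<cdot> s = (if k \<in> J then x k else Zer C Q (M k)))"
  using J unfolding s_def
proof (induction J)
  case empty
  note [simp] = coproductD[OF cp] cpart[OF cp] cproj[OF cp]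
  interpret G: comm_group "hom_group C Q S" by (rule comm_group_hom_group[OF Q coproductD(1)[OF cp]])
  show ?case using Q by (auto simp: gfinprod_def cpart_empty[OF cp])
next
  case (insert j J)
  note [simp] = coproductD[OF cp] cpart[OF cp] cproj[OF cp]
  interpret G: comm_group "hom_group C Q S" by (rule comm_group_hom_group[OF Q coproductD(1)[OF cp]])
  define s where "s = gfinprod (hom_group C Q S) (\<lambda>i. \<iota> i \<cdot> x i) J"
  have s: "s \<in> homs C Q S" "cpart I M S \<iota> J \<cdot> s = s"
    "\<And>k. k \<in> I \<Longrightarrow> cproj I M S \<iota> k \<cdot> s = (if k \<in> J then x k else Zer C Q (M k))"
    using insert by (auto simp: s_def)
  have carr: "(\<lambda>i. \<iota> i \<cdot> x i) \<in> J \<rightarrow> carrier (hom_group C Q S)" "\<iota> j \<cdot> x j \<in> carrier (hom_group C Q S)"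
    using x insert.prems by fastforce+
  have eq: "gfinprod (hom_group C Q S) (\<lambda>i. \<iota> i \<cdot> x i) (insert j J) = \<iota> j \<cdot> x j \<^bold>+ s"
    using G.gfinprod_insert[OF _ carr] insert.hyps by (simp add: s_def)
  have j: "j \<in> I" using insert by simp
  have "cpart I M S \<iota> (insert j J) \<cdot> s = s" using cpart_mono_fix[OF cp _ s(1,2)] by blast
  moreover have "cpart I M S \<iota> (insert j J) \<cdot> (\<iota> j \<cdot> x j) = \<iota> j \<cdot> x j"
  proof -
    have "cpart I M S \<iota> (insert j J) \<cdot> (\<iota> j \<cdot> x j) = (cpart I M S \<iota> (insert j J) \<cdot> \<iota> j) \<cdot> x j"
      using x[OF j] j by (simp del: cpart(4)[OF cp])
    also have "\<dots> = \<iota> j \<cdot> x j" using cpart(4)[OF cp j, of "insert j J"] by simp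
    finally show ?thesis .
  qed
  ultimately have 1: "cpart I M S \<iota> (insert j J) \<cdot> (\<iota> j \<cdot> x j \<^bold>+ s) = \<iota> j \<cdot> x j \<^bold>+ s"
    using s(1) x[OF j] j by simp
  have 2: "cproj I M S \<iota> k \<cdot> (\<iota> j \<cdot> x j \<^bold>+ s) = (if k \<in> insert j J then x k else Zer C Q (M k))"
    if k: "k \<in> I" for k
  proof -
    have "cproj I M S \<iota> k \<cdot> (\<iota> j \<cdot> x j \<^bold>+ s) = (cproj I M S \<iota> k \<cdot> \<iota> j) \<cdot> x j \<^bold>+ cproj I M S \<iota> k \<cdot> s"
      using x[OF j] j k s(1) by (simp del: cproj(4)[OF cp])
    then show ?thesis using x[OF j] x[OF k] j k s(1) s(3)[OF k] insert.hyps Q by auto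
  qed
  show ?case unfolding eq using 1 2 s(1) x[OF j] j by simp
qed

end

section \<open>Coproducts under the shift\<close>

context triangulated_category
begin

text \<open>The shift is an automorphism, so test objects and test maps can be desuspended. This is
  needed for boundary maps, which end in a shifted coproduct.\<close>

lemma coproduct_shift:
  assumes cp: "is_coproduct D I M S \<iota>"
  shows "is_coproduct D I (ShO D \<circ> M) (ShO D S) (ShA D \<circ> \<iota>)"
  unfolding is_coproduct_def
proof (intro conjI ballI allI impI)
  note [simp] = coproductD[OF cp]
  show "(ShA D \<circ> \<iota>) i \<in> homs D ((ShO D \<circ> M) i) (ShO D S)" if "i \<in> I" for i
    using that by auto
  show "ShO D S \<in> Obj D" by simp
  fix Z g assume Z: "Z \<in> Obj D" and g: "\<forall>i \<in> I. g i \<in> homs D ((ShO D \<circ> M) i) Z"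
  obtain Z' where Z': "Z' \<in> Obj D" "ShO D Z' = Z" by (rule unshift_Obj[OF Z])
  have "\<exists>g'. g' \<in> homs D (M i) Z' \<and> ShA D g' = g i" if "i \<in> I" for i
    using unshift_homs[of "g i" "M i" Z'] that g Z' by auto
  then obtain g' where g': "\<And>i. i \<in> I \<Longrightarrow> g' i \<in> homs D (M i) Z'" "\<And>i. i \<in> I \<Longrightarrow> ShA D (g' i) = g i"
    by metis
  note c = cotuple[OF cp Z'(1) g'(1)]
  show "\<exists>!u. u \<in> homs D (ShO D S) Z \<and> (\<forall>i \<in> I. u \<cdot> (ShA D \<circ> \<iota>) i = g i)"
  proof (intro ex1I[of _ "ShA D (cotuple I S \<iota> Z' g')"] conjI ballI)
    show "ShA D (cotuple I S \<iota> Z' g') \<in> homs D (ShO D S) Z" using c(1) Z' by auto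
    show "ShA D (cotuple I S \<iota> Z' g') \<cdot> (ShA D \<circ> \<iota>) i = g i" if "i \<in> I" for i
      using c that g'(2)[OF that] ShA_Comp_simp[of "\<iota> i" "cotuple I S \<iota> Z' g'"] by simp
    fix u assume u: "u \<in> homs D (ShO D S) Z \<and> (\<forall>i \<in> I. u \<cdot> (ShA D \<circ> \<iota>) i = g i)"
    obtain u' where u': "u' \<in> homs D S Z'" "ShA D u' = u"
      using unshift_homs[of u S Z'] u Z' by auto
    have "u' = cotuple I S \<iota> Z' g'"
    proof (rule coproduct_ext[OF cp u'(1) c(1)])
      fix i assume i: "i \<in> I"
      have "ShA D (u' \<cdot> \<iota> i) = ShA D (g' i)" using u u' i g'(2) by auto
      then have "u' \<cdot> \<iota> i = g' i" using u' i g'(1)[OF i] by (subst (asm) ShA_eq_iff) auto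
      then show "u' \<cdot> \<iota> i = cotuple I S \<iota> Z' g' \<cdot> \<iota> i" using c(2)[OF _ i] i by simp
    qed
    then show "u = ShA D (cotuple I S \<iota> Z' g')" using u' by simp
  qed
qed

lemma coproduct_unshift:
  assumes cp: "is_coproduct D I (ShO D \<circ> M) (ShO D S) (ShA D \<circ> \<iota>)"
    and S: "S \<in> Obj D" and \<iota>: "\<And>i. i \<in> I \<Longrightarrow> \<iota> i \<in> homs D (M i) S"
  shows "is_coproduct D I M S \<iota>"
  unfolding is_coproduct_def
proof (intro conjI ballI allI impI)
  show "S \<in> Obj D" by fact
  show "\<iota> i \<in> homs D (M i) S" if "i \<in> I" for i using \<iota>[OF that] .
  fix Z g assume Z: "Z \<in> Obj D" and g: "\<forall>i \<in> I. g i \<in> homs D (M i) Z"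
  have g': "(ShA D \<circ> g) i \<in> homs D ((ShO D \<circ> M) i) (ShO D Z)" if "i \<in> I" for i using g that by auto
  note c = cotuple[OF cp ShO_Obj[OF Z] g']
  obtain u where u: "u \<in> homs D S Z" "ShA D u = cotuple I (ShO D S) (ShA D \<circ> \<iota>) (ShO D Z) (ShA D \<circ> g)"
    using unshift_homs[OF c(1) S Z] by blast
  show "\<exists>!u. u \<in> homs D S Z \<and> (\<forall>i \<in> I. u \<cdot> \<iota> i = g i)"
  proof (intro ex1I[of _ u] conjI ballI)
    show "u \<in> homs D S Z" by fact
    fix i assume i: "i \<in> I"
    have "ShA D (u \<cdot> \<iota> i) = ShA D (g i)" using u \<iota>[OF i] c(2)[OF _ i] i by (simp add: comp_def)
    then show "u \<cdot> \<iota> i = g i" using u \<iota>[OF i] i g by (subst (asm) ShA_eq_iff) auto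
  next
    fix v assume v: "v \<in> homs D S Z \<and> (\<forall>i \<in> I. v \<cdot> \<iota> i = g i)"
    have "ShA D v = ShA D u"
    proof (rule coproduct_ext[OF cp])
      show "ShA D v \<in> homs D (ShO D S) (ShO D Z)" "ShA D u \<in> homs D (ShO D S) (ShO D Z)"
        using u(1) v by auto
      fix i assume i: "i \<in> I"
      have "ShA D v \<cdot> (ShA D \<circ> \<iota>) i = ShA D (v \<cdot> \<iota> i)" using v \<iota>[OF i] by simp
      then show "ShA D v \<cdot> (ShA D \<circ> \<iota>) i = ShA D u \<cdot> (ShA D \<circ> \<iota>) i" using v i u(2) c(2)[OF _ i] by (simp add: comp_def)
    qed
    then show "v = u" using ShA_eq_iff[of v u] u(1) v by simp
  qed
qed

lemma ShA_cpart:
  assumes cp: "is_coproduct D I M S \<iota>"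
  shows "ShA D (cpart I M S \<iota> J) = cpart I (ShO D \<circ> M) (ShO D S) (ShA D \<circ> \<iota>) J"
proof (rule coproduct_ext[OF coproduct_shift[OF cp]])
  note [simp] = coproductD[OF cp] cpart[OF cp] cpart[OF coproduct_shift[OF cp]]
  show "ShA D (cpart I M S \<iota> J) \<in> homs D (ShO D S) (ShO D S)"
    "cpart I (ShO D \<circ> M) (ShO D S) (ShA D \<circ> \<iota>) J \<in> homs D (ShO D S) (ShO D S)" by auto
  fix i assume i: "i \<in> I"
  have "ShA D (cpart I M S \<iota> J) \<cdot> (ShA D \<circ> \<iota>) i = ShA D (cpart I M S \<iota> J \<cdot> \<iota> i)"
    using i by (simp del: cpart(4)[OF cp])
  also have "\<dots> = cpart I (ShO D \<circ> M) (ShO D S) (ShA D \<circ> \<iota>) J \<cdot> (ShA D \<circ> \<iota>) i"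
    unfolding cpart(4)[OF cp i] cpart(4)[OF coproduct_shift[OF cp] i] using i by simp
  finally show "ShA D (cpart I M S \<iota> J) \<cdot> (ShA D \<circ> \<iota>) i =
      cpart I (ShO D \<circ> M) (ShO D S) (ShA D \<circ> \<iota>) J \<cdot> (ShA D \<circ> \<iota>) i" .
qed

lemma ShA_cproj:
  assumes cp: "is_coproduct D I M S \<iota>" and k: "k \<in> I"
  shows "ShA D (cproj I M S \<iota> k) = cproj I (ShO D \<circ> M) (ShO D S) (ShA D \<circ> \<iota>) k"
proof (rule coproduct_ext[OF coproduct_shift[OF cp]])
  note [simp] = coproductD[OF cp] cproj[OF cp k] cproj[OF coproduct_shift[OF cp] k] k
  show "ShA D (cproj I M S \<iota> k) \<in> homs D (ShO D S) (ShO D (M k))"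
    "cproj I (ShO D \<circ> M) (ShO D S) (ShA D \<circ> \<iota>) k \<in> homs D (ShO D S) (ShO D (M k))" by auto
  fix i assume i: "i \<in> I"
  have "ShA D (cproj I M S \<iota> k) \<cdot> (ShA D \<circ> \<iota>) i = ShA D (cproj I M S \<iota> k \<cdot> \<iota> i)"
    using i by (simp del: cproj(4)[OF cp k])
  also have "\<dots> = cproj I (ShO D \<circ> M) (ShO D S) (ShA D \<circ> \<iota>) k \<cdot> (ShA D \<circ> \<iota>) i"
    unfolding cproj(4)[OF cp k i] cproj(4)[OF coproduct_shift[OF cp] k i] using i by simp
  finally show "ShA D (cproj I M S \<iota> k) \<cdot> (ShA D \<circ> \<iota>) i =
      cproj I (ShO D \<circ> M) (ShO D S) (ShA D \<circ> \<iota>) k \<cdot> (ShA D \<circ> \<iota>) i" .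
qed

end

lemma (in preadditive_category) is_coproduct_cong:
  assumes "is_coproduct C I M S \<iota>" "\<And>i. i \<in> I \<Longrightarrow> M i = M' i" "\<And>i. i \<in> I \<Longrightarrow> \<iota> i = \<iota>' i"
  shows "is_coproduct C I M' S \<iota>'"
  using assms by (simp add: is_coproduct_def)

lemma (in preadditive_category) cpart_cong:
  assumes "\<And>i. i \<in> I \<Longrightarrow> M i = M' i" "\<And>i. i \<in> I \<Longrightarrow> \<iota> i = \<iota>' i"
  shows "cpart I M S \<iota> J = cpart I M' S \<iota>' J"
proof -
  have "(\<forall>i \<in> I. u \<cdot> \<iota> i = (if i \<in> J then \<iota> i else Zer C (M i) S)) \<longleftrightarrow>
      (\<forall>i \<in> I. u \<cdot> \<iota>' i = (if i \<in> J then \<iota>' i else Zer C (M' i) S))" for u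
    using assms by simp
  then show ?thesis by (simp add: cpart_def cotuple_def)
qed

lemma (in preadditive_category) sub_eq_sub_right:
  assumes "f \<in> homs C A B" "g \<in> homs C A B" "h \<in> homs C A B" "f \<^bold>- h = g \<^bold>- h"
  shows "f = g"
  using sub_add_cancel[OF assms(1,3)] sub_add_cancel[OF assms(2,3)] assms(4) by metis

lemma left_perpD: "M \<in> left_perp C \<Y> \<Longrightarrow> Y \<in> \<Y> \<Longrightarrow> f \<in> homs C M Y \<Longrightarrow> f = Zer C M Y"
  unfolding left_perp_def by blast

lemma right_perpD: "M \<in> right_perp C \<Y> \<Longrightarrow> Y \<in> \<Y> \<Longrightarrow> f \<in> homs C Y M \<Longrightarrow> f = Zer C Y M"
  unfolding right_perp_def by blast

lemma (in preadditive_category) left_perpI: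
  assumes "M \<in> Obj C" "\<Y> \<subseteq> Obj C" "\<And>Y f. Y \<in> \<Y> \<Longrightarrow> f \<in> homs C M Y \<Longrightarrow> f = Zer C M Y"
  shows "M \<in> left_perp C \<Y>"
  using assms homs_eq_ZerI[of M] unfolding left_perp_def by blast

lemma (in preadditive_category) right_perpI:
  assumes "M \<in> Obj C" "\<Y> \<subseteq> Obj C" "\<And>Y f. Y \<in> \<Y> \<Longrightarrow> f \<in> homs C Y M \<Longrightarrow> f = Zer C Y M"
  shows "M \<in> right_perp C \<Y>"
  using assms homs_eq_ZerI[of _ M] unfolding right_perp_def by blast

lemma left_perp_Obj: "M \<in> left_perp C \<Y> \<Longrightarrow> M \<in> Obj C"
  by (simp add: left_perp_def)

lemma right_perp_Obj: "M \<in> right_perp C \<Y> \<Longrightarrow> M \<in> Obj C"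
  by (simp add: right_perp_def)

section \<open>Localizing classes and relative compactness\<close>

locale cocomplete_triangulated_category = triangulated_category D
  for D :: "('o, 'm, 'z) tricat_scheme" (structure) +
  fixes \<kappa> :: "'u rel"
  assumes inaccessible: "inaccessible \<kappa>"
    and coproducts: "has_small_coproducts \<kappa> D"
    and locally_small: "locally_small \<kappa> D"
begin

notation sub (infixl \<open>\<^bold>-\<close> 65)
notation add (infixl \<open>\<^bold>+\<close> 65)

lemma small_reindex:
  assumes "|A| <o \<kappa>"
  obtains I :: "'u set" and e where "|I| <o \<kappa>" "bij_betw e I A"
proof -
  obtain B :: "'u set" where "|A| =o |B|" "|B| <o \<kappa>"
    using assms internalize_card_of_ordLess by metis
  then show ?thesis using that card_of_ordIso ordIso_symmetric by metis
qed

lemma coproduct_exists: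
  assumes "|I| <o \<kappa>" and M: "\<And>i. i \<in> I \<Longrightarrow> M i \<in> Obj D"
  obtains S \<iota> where "is_coproduct D I M S \<iota>"
proof -
  obtain I' :: "'u set" and e where I': "|I'| <o \<kappa>" and e: "bij_betw e I' I"
    by (rule small_reindex[OF assms(1)])
  have "\<forall>i \<in> I'. (M \<circ> e) i \<in> Obj D" using M e by (auto simp: bij_betw_def)
  then obtain S \<iota> where "is_coproduct D I' (M \<circ> e) S \<iota>"
    using coproducts I' unfolding has_small_coproducts_def by blast
  from coproduct_reindex[OF this bij_betw_the_inv_into[OF e]]
  have "is_coproduct D I (M \<circ> e \<circ> the_inv_into I' e) S (\<iota> \<circ> the_inv_into I' e)" .
  moreover have "(M \<circ> e \<circ> the_inv_into I' e) i = M i" if "i \<in> I" for i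
    using that e f_the_inv_into_f_bij_betw[OF e] by simp
  ultimately have "is_coproduct D I M S (\<iota> \<circ> the_inv_into I' e)"
    by (rule is_coproduct_cong) auto
  then show ?thesis by (rule that)
qed

text \<open>The equivalence expresses closure under both shifts without mentioning the inverse
  shift.\<close>

definition shift_stable :: "'o set \<Rightarrow> bool" where
  "shift_stable N \<longleftrightarrow> N \<subseteq> Obj D \<and> (\<forall>X \<in> Obj D. ShO D X \<in> N \<longleftrightarrow> X \<in> N)"

text \<open>Only cones are required to stay in \<open>N\<close>; with shift stability, rotation
  yields the other vertices. Closure under isomorphism follows from containing all zero objects, see
  \<open>localizing_strictly_full\<close>.\<close>

definition localizing :: "'o set \<Rightarrow> bool" where
  "localizing N \<longleftrightarrow> shift_stable N \<and> (\<forall>Z. is_zero_object D Z \<longrightarrow> Z \<in> N) \<and>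
     (\<forall>A B B' f g h. tri A B B' f g h \<longrightarrow> A \<in> N \<longrightarrow> B \<in> N \<longrightarrow> B' \<in> N) \<and>
     (\<forall>(I :: 'u set) M S \<iota>. |I| <o \<kappa> \<longrightarrow> (\<forall>i \<in> I. M i \<in> N) \<longrightarrow> is_coproduct D I M S \<iota> \<longrightarrow> S \<in> N)"

text \<open>Compactness tested against coproducts with summands in \<open>N\<close> only. For
  \<open>N = Obj D\<close> it is ordinary compactness by \<open>compact_iff\<close>; for
  \<open>N = Y\<close> it is what reflections of compact objects satisfy by
  \<open>unit_rcompact\<close>.\<close>

definition rcompact :: "'o set \<Rightarrow> 'o \<Rightarrow> bool" where
  "rcompact N Q \<longleftrightarrow> Q \<in> Obj D \<and>
     (\<forall>(I :: 'u set) M S \<iota> u. |I| <o \<kappa> \<longrightarrow> (\<forall>i \<in> I. M i \<in> N) \<longrightarrow> is_coproduct D I M S \<iota> \<longrightarrow>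
        u \<in> homs D Q S \<longrightarrow> (\<exists>J \<subseteq> I. finite J \<and> cpart I M S \<iota> J \<cdot> u = u))"

lemma shift_stableD:
  assumes "shift_stable N"
  shows "X \<in> N \<Longrightarrow> X \<in> Obj D" "X \<in> N \<Longrightarrow> ShO D X \<in> N" "X \<in> Obj D \<Longrightarrow> ShO D X \<in> N \<Longrightarrow> X \<in> N"
  using assms unfolding shift_stable_def by blast+

lemma localizingD:
  assumes "localizing N"
  shows "shift_stable N" "is_zero_object D Z \<Longrightarrow> Z \<in> N"
    "tri A B B' f g h \<Longrightarrow> A \<in> N \<Longrightarrow> B \<in> N \<Longrightarrow> B' \<in> N"
  using assms unfolding localizing_def by blast+

lemma localizing_coproduct:
  assumes N: "localizing N" and I: "|I| <o \<kappa>" and M: "\<And>i. i \<in> I \<Longrightarrow> M i \<in> N"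
    and cp: "is_coproduct D I M S \<iota>"
  shows "S \<in> N"
proof -
  obtain I' :: "'u set" and e where I': "|I'| <o \<kappa>" and e: "bij_betw e I' I"
    by (rule small_reindex[OF I])
  have "\<forall>i \<in> I'. (M \<circ> e) i \<in> N" using M e by (auto simp: bij_betw_def)
  with coproduct_reindex[OF cp e] I' N show ?thesis unfolding localizing_def by blast
qed

lemma rcompact_Obj: "rcompact N Q \<Longrightarrow> Q \<in> Obj D"
  by (simp add: rcompact_def)

lemma rcompactD:
  assumes Q: "rcompact N Q" and I: "|I| <o \<kappa>" and M: "\<And>i. i \<in> I \<Longrightarrow> M i \<in> N"
    and cp: "is_coproduct D I M S \<iota>" and u: "u \<in> homs D Q S"
  obtains J where "J \<subseteq> I" "finite J" "cpart I M S \<iota> J \<cdot> u = u"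
proof -
  obtain I' :: "'u set" and e where I': "|I'| <o \<kappa>" and e: "bij_betw e I' I"
    by (rule small_reindex[OF I])
  have M': "\<forall>i \<in> I'. (M \<circ> e) i \<in> N" using M e by (auto simp: bij_betw_def)
  note cp' = coproduct_reindex[OF cp e]
  obtain J where J: "J \<subseteq> I'" "finite J" "cpart I' (M \<circ> e) S (\<iota> \<circ> e) J \<cdot> u = u"
    using Q I' M' cp' u unfolding rcompact_def by blast
  have "cpart I M S \<iota> (e ` J) = cpart I' (M \<circ> e) S (\<iota> \<circ> e) J"
  proof (rule coproduct_ext[OF cp'])
    note [simp] = coproductD[OF cp] cpart[OF cp] cpart[OF cp']
    show "cpart I M S \<iota> (e ` J) \<in> homs D S S" "cpart I' (M \<circ> e) S (\<iota> \<circ> e) J \<in> homs D S S" by auto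
    fix i assume i: "i \<in> I'"
    then have "e i \<in> I" "e i \<in> e ` J \<longleftrightarrow> i \<in> J"
      using e J(1) by (auto simp: bij_betw_def inj_on_def)
    then show "cpart I M S \<iota> (e ` J) \<cdot> (\<iota> \<circ> e) i = cpart I' (M \<circ> e) S (\<iota> \<circ> e) J \<cdot> (\<iota> \<circ> e) i"
      unfolding cpart(4)[OF cp' i] using cpart(4)[OF cp, of "e i" "e ` J"] by simp
  qed
  then show ?thesis using that[of "e ` J"] J e by (auto simp: bij_betw_def)
qed

lemma rcompact_shift:
  assumes N: "shift_stable N" and Q: "Q \<in> Obj D"
  shows "rcompact N (ShO D Q) \<longleftrightarrow> rcompact N Q"
proof
  assume r: "rcompact N (ShO D Q)"
  show "rcompact N Q"
    unfolding rcompact_def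
  proof (intro conjI Q allI impI)
    fix I :: "'u set" and M S \<iota> u
    assume I: "|I| <o \<kappa>" and M: "\<forall>i \<in> I. M i \<in> N" and cp: "is_coproduct D I M S \<iota>"
      and u: "u \<in> homs D Q S"
    have M': "(ShO D \<circ> M) i \<in> N" if "i \<in> I" for i using M that shift_stableD(2)[OF N, of "M i"] by simp
    have u': "ShA D u \<in> homs D (ShO D Q) (ShO D S)" using u by auto
    obtain J where J: "J \<subseteq> I" "finite J"
        "cpart I (ShO D \<circ> M) (ShO D S) (ShA D \<circ> \<iota>) J \<cdot> ShA D u = ShA D u"
      by (rule rcompactD[OF r I M' coproduct_shift[OF cp] u'])
    then have "ShA D (cpart I M S \<iota> J \<cdot> u) = ShA D u"
      using u ShA_cpart[OF cp] cpart[OF cp] by simp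
    then have "cpart I M S \<iota> J \<cdot> u = u"
      using u cpart[OF cp] by (subst (asm) ShA_eq_iff) auto
    then show "\<exists>J \<subseteq> I. finite J \<and> cpart I M S \<iota> J \<cdot> u = u" using J by blast
  qed
next
  assume r: "rcompact N Q"
  show "rcompact N (ShO D Q)"
    unfolding rcompact_def
  proof (intro conjI ShO_Obj Q allI impI)
    fix I :: "'u set" and M S \<iota> u
    assume I: "|I| <o \<kappa>" and M: "\<forall>i \<in> I. M i \<in> N" and cp: "is_coproduct D I M S \<iota>"
      and u: "u \<in> homs D (ShO D Q) S"
    note cpD = coproductD[OF cp]
    obtain S' where S': "S' \<in> Obj D" "ShO D S' = S" by (rule unshift_Obj[OF cpD(1)])
    have "\<forall>i \<in> I. \<exists>m. m \<in> Obj D \<and> ShO D m = M i" using cpD(5) unshift_Obj by metis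
    then obtain M' where M': "\<And>i. i \<in> I \<Longrightarrow> M' i \<in> Obj D" "\<And>i. i \<in> I \<Longrightarrow> ShO D (M' i) = M i"
      by metis
    have "\<exists>m. m \<in> homs D (M' i) S' \<and> ShA D m = \<iota> i" if i: "i \<in> I" for i
      using unshift_homs[of "\<iota> i" "M' i" S'] cpD(2-4)[OF i] M'[OF i] S' by auto
    then obtain \<iota>' where \<iota>': "\<And>i. i \<in> I \<Longrightarrow> \<iota>' i \<in> homs D (M' i) S'" "\<And>i. i \<in> I \<Longrightarrow> ShA D (\<iota>' i) = \<iota> i"
      by metis
    have "is_coproduct D I (ShO D \<circ> M') (ShO D S') (ShA D \<circ> \<iota>')"
      using is_coproduct_cong[OF cp] M' \<iota>' S' by simp
    from coproduct_unshift[OF this S'(1) \<iota>'(1)] have cp': "is_coproduct D I M' S' \<iota>'" .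
    have N': "M' i \<in> N" if i: "i \<in> I" for i
      using M'[OF i] M i shift_stableD(3)[OF N, of "M' i"] by auto
    have "u \<in> homs D (ShO D Q) (ShO D S')" using u S' by simp
    then obtain u' where u': "u' \<in> homs D Q S'" "ShA D u' = u" using unshift_homs Q S' by blast
    obtain J where J: "J \<subseteq> I" "finite J" "cpart I M' S' \<iota>' J \<cdot> u' = u'"
      by (rule rcompactD[OF r I N' cp' u'(1)])
    have "cpart I M S \<iota> J = cpart I (ShO D \<circ> M') (ShO D S') (ShA D \<circ> \<iota>') J"
      using cpart_cong[of I M "ShO D \<circ> M'" \<iota> "ShA D \<circ> \<iota>'"] M' \<iota>' S' by simp
    also have "\<dots> = ShA D (cpart I M' S' \<iota>' J)" using ShA_cpart[OF cp'] by simp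
    also have "\<dots> \<cdot> u = ShA D (cpart I M' S' \<iota>' J \<cdot> u')"
      using u' cpart[OF cp'] by auto
    finally have "cpart I M S \<iota> J \<cdot> u = u" using J u' by simp
    then show "\<exists>J \<subseteq> I. finite J \<and> cpart I M S \<iota> J \<cdot> u = u" using J by blast
  qed
qed

text \<open>An argument of five-lemma type: the restriction of \<open>u\<close> to \<open>B\<close>
  lives on a finite \<open>J\<close>. What \<open>u\<close> has outside \<open>J\<close> vanishes on
  \<open>B\<close>, so it comes from \<open>A[1]\<close> and lives on a finite
  \<open>K\<close>.\<close>

lemma rcompact_cone:
  assumes N: "shift_stable N" and t: "tri A B B' f g h" and A: "rcompact N A" and B: "rcompact N B"
  shows "rcompact N B'"
  unfolding rcompact_def
proof (intro conjI allI impI)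
  note [simp] = triD[OF t]
  show "B' \<in> Obj D" by simp
  fix I :: "'u set" and M S \<iota> u
  assume I: "|I| <o \<kappa>" and M: "\<forall>i \<in> I. M i \<in> N" and cp: "is_coproduct D I M S \<iota>"
    and u: "u \<in> homs D B' S"
  note [simp] = coproductD(1)[OF cp] cpart(1-3)[OF cp]
  have A1: "rcompact N (ShO D A)" using rcompact_shift[OF N] A by simp
  have "u \<cdot> g \<in> homs D B S" using u by simp
  then obtain J where J: "J \<subseteq> I" "finite J" "cpart I M S \<iota> J \<cdot> (u \<cdot> g) = u \<cdot> g"
    using rcompactD[OF B I _ cp, of "u \<cdot> g"] M by blast
  define w where "w = u \<^bold>- cpart I M S \<iota> J \<cdot> u"
  have w: "w \<in> homs D B' S" using u by (simp add: w_def)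
  have "w \<cdot> g = Zer D B S" using u J by (simp add: w_def)
  then obtain v where v: "v \<in> homs D (ShO D A) S" "v \<cdot> h = w" using weak_cokernel2[OF t w] by blast
  obtain K where K: "K \<subseteq> I" "finite K" "cpart I M S \<iota> K \<cdot> v = v"
    using rcompactD[OF A1 I _ cp v(1)] M by blast
  have "cpart I M S \<iota> (J \<union> K) \<cdot> v = v" using cpart_mono_fix[OF cp _ v(1) K(3)] by blast
  then have wL: "cpart I M S \<iota> (J \<union> K) \<cdot> w = w"
    using v assoc[of h v "cpart I M S \<iota> (J \<union> K)"] by auto
  have "cpart I M S \<iota> (J \<union> K) \<cdot> (cpart I M S \<iota> J \<cdot> u) = (cpart I M S \<iota> (J \<union> K) \<cdot> cpart I M S \<iota> J) \<cdot> u"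
    using u by simp
  also have "\<dots> = cpart I M S \<iota> J \<cdot> u" using cpart_mono[OF cp, of J "J \<union> K"] by simp
  finally have "cpart I M S \<iota> (J \<union> K) \<cdot> w = cpart I M S \<iota> (J \<union> K) \<cdot> u \<^bold>- cpart I M S \<iota> J \<cdot> u"
    using u by (simp add: w_def)
  then have "cpart I M S \<iota> (J \<union> K) \<cdot> u \<^bold>- cpart I M S \<iota> J \<cdot> u = u \<^bold>- cpart I M S \<iota> J \<cdot> u"
    using wL by (simp add: w_def)
  then have "cpart I M S \<iota> (J \<union> K) \<cdot> u = u"
    using sub_eq_sub_right[of "cpart I M S \<iota> (J \<union> K) \<cdot> u" B' S u "cpart I M S \<iota> J \<cdot> u"] u by simp
  then show "\<exists>J \<subseteq> I. finite J \<and> cpart I M S \<iota> J \<cdot> u = u"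
    using J K by (intro exI[of _ "J \<union> K"]) auto
qed

lemma rcompact_zero: "is_zero_object D Z \<Longrightarrow> rcompact N Z"
  unfolding rcompact_def
proof (intro conjI allI impI)
  assume Z: "is_zero_object D Z"
  then show "Z \<in> Obj D" by (simp add: is_zero_object_def)
  fix I :: "'u set" and M S \<iota> u
  assume cp: "is_coproduct D I M S \<iota>" and u: "u \<in> homs D Z S"
  have "cpart I M S \<iota> {} \<cdot> u = u"
    using zero_object_Arr_out[OF Z, of u S] zero_object_Arr_out[OF Z, of "cpart I M S \<iota> {} \<cdot> u" S]
      cpart[OF cp] u by simp
  then show "\<exists>J \<subseteq> I. finite J \<and> cpart I M S \<iota> J \<cdot> u = u" by blast
qed

lemma rcompact_biproduct:
  assumes bp: "is_biproduct D A B P i j p q" and A: "rcompact N A" and B: "rcompact N B"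
  shows "rcompact N P"
  unfolding rcompact_def
proof (intro conjI allI impI)
  have [simp]: "P \<in> Obj D" "i \<in> Arr D" "Dom D i = A" "Cod D i = P" "j \<in> Arr D" "Dom D j = B" "Cod D j = P"
    using bp by (auto simp: is_biproduct_def)
  show "P \<in> Obj D" by simp
  fix I :: "'u set" and M S \<iota> u
  assume I: "|I| <o \<kappa>" and M: "\<forall>i \<in> I. M i \<in> N" and cp: "is_coproduct D I M S \<iota>"
    and u: "u \<in> homs D P S"
  note [simp] = cpart(1-3)[OF cp]
  have uij: "u \<cdot> i \<in> homs D A S" "u \<cdot> j \<in> homs D B S" using u by auto
  obtain J where J: "J \<subseteq> I" "finite J" "cpart I M S \<iota> J \<cdot> (u \<cdot> i) = u \<cdot> i"
    using rcompactD[OF A I _ cp uij(1)] M by blast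
  obtain K where K: "K \<subseteq> I" "finite K" "cpart I M S \<iota> K \<cdot> (u \<cdot> j) = u \<cdot> j"
    using rcompactD[OF B I _ cp uij(2)] M by blast
  have "cpart I M S \<iota> (J \<union> K) \<cdot> u = u"
  proof (rule biproduct_ext[OF bp])
    show "cpart I M S \<iota> (J \<union> K) \<cdot> u \<in> homs D P S" "u \<in> homs D P S" using u by auto
    show "cpart I M S \<iota> (J \<union> K) \<cdot> u \<cdot> i = u \<cdot> i" "cpart I M S \<iota> (J \<union> K) \<cdot> u \<cdot> j = u \<cdot> j"
      using cpart_mono_fix[OF cp _ uij(1) J(3)] cpart_mono_fix[OF cp _ uij(2) K(3)] u by auto
  qed
  then show "\<exists>J \<subseteq> I. finite J \<and> cpart I M S \<iota> J \<cdot> u = u"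
    using J K by (intro exI[of _ "J \<union> K"]) auto
qed

lemma gfinprod_support:
  assumes cp: "is_coproduct D I M S \<iota>" and P: "P \<in> Obj D"
    and x: "x \<in> carrier (sum_group I (\<lambda>i. hom_group D P (M i)))"
  defines "J \<equiv> {i \<in> I. x i \<noteq> Zer D P (M i)}"
  shows "finite J" "J \<subseteq> I" "\<And>i. i \<in> I \<Longrightarrow> x i \<in> homs D P (M i)"
    "gfinprod (hom_group D P S) (\<lambda>i. \<iota> i \<cdot> x i) I = gfinprod (hom_group D P S) (\<lambda>i. \<iota> i \<cdot> x i) J"
proof -
  note [simp] = coproductD[OF cp]
  interpret G: comm_group "hom_group D P S" by (rule comm_group_hom_group[OF P coproductD(1)[OF cp]])
  have gr: "group (hom_group D P (M i))" if "i \<in> I" for i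
    using comm_group_hom_group[OF P, of "M i"] that by (simp add: comm_group_def)
  have x': "x \<in> (\<Pi>\<^sub>E i\<in>I. homs D P (M i))"
      "finite {i \<in> I. x i \<noteq> Zer D P (M i)}"
    using carrier_sum_group[of I "\<lambda>i. hom_group D P (M i)"] gr x by (simp_all del: mem_homs)
  then show "finite J" "J \<subseteq> I" by (auto simp: J_def)
  show xi: "x i \<in> homs D P (M i)" if "i \<in> I" for i using x'(1) that by blast
  show "gfinprod (hom_group D P S) (\<lambda>i. \<iota> i \<cdot> x i) I = gfinprod (hom_group D P S) (\<lambda>i. \<iota> i \<cdot> x i) J"
  proof (rule G.gfinprod_mono_neutral_cong_right)
    show "J \<subseteq> I" by (auto simp: J_def)
    show "(\<lambda>i. \<iota> i \<cdot> x i) \<in> I \<rightarrow> carrier (hom_group D P S)" using xi by auto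
    show "\<iota> i \<cdot> x i = \<one>\<^bsub>hom_group D P S\<^esub>" if "i \<in> I - J" for i
      using that P by (auto simp: J_def)
  qed simp
qed

text \<open>Projections recover the summands from a sum, so the canonical map is injective for every
  \<open>P\<close>. The content is surjectivity, which says that each \<open>u\<close> lives on a
  finite part.\<close>

lemma compact_iff: "compact_object \<kappa> D P \<longleftrightarrow> rcompact (Obj D) P"
proof
  assume c: "compact_object \<kappa> D P"
  show "rcompact (Obj D) P"
    unfolding rcompact_def
  proof (intro conjI allI impI)
    show P: "P \<in> Obj D" using c by (simp add: compact_object_def)
    fix I :: "'u set" and M S \<iota> u
    assume I: "|I| <o \<kappa>" and M: "\<forall>i \<in> I. M i \<in> Obj D" and cp: "is_coproduct D I M S \<iota>"
      and u: "u \<in> homs D P S"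
    have "(\<lambda>x. gfinprod (hom_group D P S) (\<lambda>i. \<iota> i \<cdot> x i) I)
         \<in> iso (sum_group I (\<lambda>i. hom_group D P (M i))) (hom_group D P S)"
      using c I M cp unfolding compact_object_def by blast
    then have "u \<in> (\<lambda>x. gfinprod (hom_group D P S) (\<lambda>i. \<iota> i \<cdot> x i) I) `
        carrier (sum_group I (\<lambda>i. hom_group D P (M i)))"
      using u unfolding iso_def bij_betw_def by simp
    then obtain x where x: "x \<in> carrier (sum_group I (\<lambda>i. hom_group D P (M i)))"
        "u = gfinprod (hom_group D P S) (\<lambda>i. \<iota> i \<cdot> x i) I"
      by blast
    note sp = gfinprod_support[OF cp P x(1)]
    from coproduct_finite_sum[OF cp sp(1,2) P sp(3)] sp x(2)
    show "\<exists>J \<subseteq> I. finite J \<and> cpart I M S \<iota> J \<cdot> u = u" by metis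
  qed
next
  assume r: "rcompact (Obj D) P"
  show "compact_object \<kappa> D P"
    unfolding compact_object_def
  proof (intro conjI allI impI)
    show P: "P \<in> Obj D" using r by (rule rcompact_Obj)
    fix I :: "'u set" and M S \<iota>
    assume I: "|I| <o \<kappa>" and M: "\<forall>i \<in> I. M i \<in> Obj D" and cp: "is_coproduct D I M S \<iota>"
    note cpD [simp] = coproductD[OF cp]
    interpret G: comm_group "hom_group D P S" by (rule comm_group_hom_group[OF P cpD(1)])
    have gr: "group (hom_group D P (M i))" if "i \<in> I" for i
      using comm_group_hom_group[OF P, of "M i"] that by (simp add: comm_group_def)
    have csg: "carrier (sum_group I (\<lambda>i. hom_group D P (M i))) =
        {x \<in> \<Pi>\<^sub>E i\<in>I. homs D P (M i). finite {i \<in> I. x i \<noteq> Zer D P (M i)}}"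
      using carrier_sum_group[of I "\<lambda>i. hom_group D P (M i)"] gr by simp
    let ?F = "\<lambda>x. gfinprod (hom_group D P S) (\<lambda>i. \<iota> i \<cdot> x i) I"
    let ?SG = "sum_group I (\<lambda>i. hom_group D P (M i))"
    have F: "?F x \<in> homs D P S" "\<And>k. k \<in> I \<Longrightarrow> cproj I M S \<iota> k \<cdot> ?F x = x k"
      if x: "x \<in> carrier ?SG" for x
    proof -
      note sp = gfinprod_support[OF cp P x]
      from coproduct_finite_sum[OF cp sp(1,2) P sp(3)] sp(4)
      show "?F x \<in> homs D P S" "\<And>k. k \<in> I \<Longrightarrow> cproj I M S \<iota> k \<cdot> ?F x = x k"
        by (auto simp del: mem_homs)
    qed
    show "?F \<in> iso ?SG (hom_group D P S)"
    proof (rule isoI)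
      show "?F \<in> hom ?SG (hom_group D P S)"
      proof (rule homI)
        show "?F x \<in> carrier (hom_group D P S)" if "x \<in> carrier ?SG" for x using F(1)[OF that] by simp
        fix x y assume x: "x \<in> carrier ?SG" and y: "y \<in> carrier ?SG"
        note spx = gfinprod_support[OF cp P x] and spy = gfinprod_support[OF cp P y]
        have fin: "finite {i \<in> I. \<iota> i \<cdot> z i \<noteq> \<one>\<^bsub>hom_group D P S\<^esub>}" if z: "z \<in> carrier ?SG" for z
        proof (rule finite_subset[OF _ gfinprod_support(1)[OF cp P z]])
          show "{i \<in> I. \<iota> i \<cdot> z i \<noteq> \<one>\<^bsub>hom_group D P S\<^esub>} \<subseteq> {i \<in> I. z i \<noteq> Zer D P (M i)}"
            using P by auto
        qed
        have "?F (x \<otimes>\<^bsub>?SG\<^esub> y) = gfinprod (hom_group D P S) (\<lambda>i. (\<iota> i \<cdot> x i) \<otimes>\<^bsub>hom_group D P S\<^esub> (\<iota> i \<cdot> y i)) I"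
        proof (rule G.gfinprod_cong, unfold simp_implies_def)
          show "(\<lambda>i. \<iota> i \<cdot> (x \<otimes>\<^bsub>?SG\<^esub> y) i) \<in> I \<rightarrow> carrier (hom_group D P S)"
            using spx(3) spy(3) by auto
          show "\<iota> i \<cdot> (x \<otimes>\<^bsub>?SG\<^esub> y) i = (\<iota> i \<cdot> x i) \<otimes>\<^bsub>hom_group D P S\<^esub> (\<iota> i \<cdot> y i)"
            if "i \<in> I" for i
            using spx(3)[of i] spy(3)[of i] that by simp
        qed simp
        also have "\<dots> = ?F x \<otimes>\<^bsub>hom_group D P S\<^esub> ?F y"
          by (rule G.gfinprod_distrib[OF fin[OF x] fin[OF y]]) (use spx(3) spy(3) in auto)
        finally show "?F (x \<otimes>\<^bsub>?SG\<^esub> y) = ?F x \<otimes>\<^bsub>hom_group D P S\<^esub> ?F y" .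
      qed
      show "bij_betw ?F (carrier ?SG) (carrier (hom_group D P S))"
        unfolding bij_betw_def
      proof (intro conjI equalityI subsetI)
        show "inj_on ?F (carrier ?SG)"
        proof (rule inj_onI)
          fix x y assume x: "x \<in> carrier ?SG" and y: "y \<in> carrier ?SG" and eq: "?F x = ?F y"
          have xy: "x \<in> (\<Pi>\<^sub>E i\<in>I. homs D P (M i))" "y \<in> (\<Pi>\<^sub>E i\<in>I. homs D P (M i))"
            using x y csg by (simp_all del: mem_homs)
          show "x = y"
            by (rule PiE_ext[OF xy]) (use F(2)[OF x] F(2)[OF y] eq in metis)
        qed
        show "u \<in> carrier (hom_group D P S)" if "u \<in> ?F ` carrier ?SG" for u
          using that F(1) by auto
        fix u assume "u \<in> carrier (hom_group D P S)"
        then have u: "u \<in> homs D P S" by simp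
        obtain J where J: "J \<subseteq> I" "finite J" "cpart I M S \<iota> J \<cdot> u = u"
          using rcompactD[OF r I _ cp u] M by blast
        \<comment> \<open>Candidate preimage: the family of components of \<open>u\<close>. They
          vanish outside \<open>J\<close> because \<open>u\<close> is fixed by
          \<open>cpart J\<close>, so the family has finite support.\<close>
        define x where "x = (\<lambda>i\<in>I. cproj I M S \<iota> i \<cdot> u)"
        have sub: "{i \<in> I. x i \<noteq> Zer D P (M i)} \<subseteq> J"
        proof (rule ccontr)
          assume "\<not> {i \<in> I. x i \<noteq> Zer D P (M i)} \<subseteq> J"
          then obtain i where i: "i \<in> I" "i \<notin> J" "x i \<noteq> Zer D P (M i)" by blast
          then have i: "i \<in> I" "i \<notin> J" "cproj I M S \<iota> i \<cdot> u \<noteq> Zer D P (M i)"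
            by (simp_all add: x_def)
          have "cproj I M S \<iota> i \<cdot> (cpart I M S \<iota> J \<cdot> u) = (cproj I M S \<iota> i \<cdot> cpart I M S \<iota> J) \<cdot> u"
            using u i cproj(1-3)[OF cp i(1)] cpart(1-3)[OF cp] by simp
          then show False using i u J(3) cproj_cpart[OF cp i(1), of J] by auto
        qed
        have xSG: "x \<in> carrier ?SG"
          unfolding csg using finite_subset[OF sub J(2)] u cproj(1-3)[OF cp] by (auto simp: x_def)
        note sp = gfinprod_support[OF cp P xSG]
        have Fx: "?F x \<in> homs D P S" "cpart I M S \<iota> J \<cdot> ?F x = ?F x"
          using coproduct_finite_sum[OF cp sp(1,2) P sp(3)] sp(4) cpart_mono_fix[OF cp sub, of "?F x" P]
          by (auto simp del: mem_homs)
        \<comment> \<open>Both maps live on \<open>J\<close> and have the same projections, which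
          suffices on a finite part.\<close>
        have "u \<^bold>- ?F x = Zer D P S"
        proof (rule finite_part_eq_Zer[OF cp _ _ J(2,1)])
          show "u \<^bold>- ?F x \<in> homs D P S" using u Fx by simp
          show "cpart I M S \<iota> J \<cdot> (u \<^bold>- ?F x) = u \<^bold>- ?F x"
            using u Fx J(3) cpart(1-3)[OF cp] by simp
          show "cproj I M S \<iota> k \<cdot> (u \<^bold>- ?F x) = Zer D P (M k)" if k: "k \<in> I" for k
            using u Fx(1) cproj(1-3)[OF cp k] F(2)[OF xSG k] k by (simp add: x_def)
        qed
        then have "u = ?F x" using sub_eq_Zer_iff[OF u Fx(1)] by blast
        then show "u \<in> ?F ` carrier ?SG" using xSG by blast
      qed
    qed
  qed
qed

text \<open>Maps from a cone or a coproduct into \<open>W\<close> are controlled by maps from the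
  pieces; shift stability takes care of the piece \<open>A[1]\<close>.\<close>

lemma left_perp_localizing:
  assumes W: "shift_stable W" shows "localizing (left_perp D W)"
  unfolding localizing_def
proof (intro conjI allI impI)
  have WO: "W \<subseteq> Obj D" using W by (simp add: shift_stable_def)
  show st: "shift_stable (left_perp D W)"
    unfolding shift_stable_def
  proof (intro conjI ballI iffI)
    show "left_perp D W \<subseteq> Obj D" by (auto simp: left_perp_def)
    fix X assume X: "X \<in> Obj D"
    show "X \<in> left_perp D W" if S: "ShO D X \<in> left_perp D W"
    proof (rule left_perpI[OF X WO])
      fix Y f assume Y: "Y \<in> W" and f: "f \<in> homs D X Y"
      have "ShA D f = Zer D (ShO D X) (ShO D Y)"
        using left_perpD[OF S shift_stableD(2)[OF W Y], of "ShA D f"] f by simp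
      then have "ShA D f = ShA D (Zer D X Y)" using f by auto
      then show "f = Zer D X Y" using f by (subst (asm) ShA_eq_iff) auto
    qed
    show "ShO D X \<in> left_perp D W" if S: "X \<in> left_perp D W"
    proof (rule left_perpI[OF ShO_Obj[OF X] WO])
      fix Y f assume Y: "Y \<in> W" and f: "f \<in> homs D (ShO D X) Y"
      obtain Y' where Y': "Y' \<in> Obj D" "ShO D Y' = Y" using unshift_Obj Y WO by blast
      have "f \<in> homs D (ShO D X) (ShO D Y')" using f Y' by simp
      then obtain f' where f': "f' \<in> homs D X Y'" "ShA D f' = f" using unshift_homs X Y' by blast
      have "f' = Zer D X Y'" using left_perpD[OF S _ f'(1)] shift_stableD(3)[OF W Y'(1)] Y Y' by simp
      then show "f = Zer D (ShO D X) Y" using f' Y' X by auto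
    qed
  qed
  show "Z \<in> left_perp D W" if "is_zero_object D Z" for Z
    using that zero_object_Arr_out[OF that] by (intro left_perpI WO) (auto simp: is_zero_object_def)
  show "B' \<in> left_perp D W" if t: "tri A B B' f g h" and A: "A \<in> left_perp D W" and B: "B \<in> left_perp D W"
    for A B B' f g h
  proof (rule left_perpI[OF triD(12)[OF t] WO])
    fix Y u assume Y: "Y \<in> W" and u: "u \<in> homs D B' Y"
    have "u \<cdot> g = Zer D B Y" using left_perpD[OF B Y, of "u \<cdot> g"] u triD[OF t] by simp
    then obtain v where v: "v \<in> homs D (ShO D A) Y" "v \<cdot> h = u" using weak_cokernel2[OF t u] by blast
    have "v = Zer D (ShO D A) Y" using left_perpD[OF shift_stableD(2)[OF st A] Y v(1)] .
    then show "u = Zer D B' Y" using v Y WO triD[OF t] by auto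
  qed
  show "S \<in> left_perp D W" if M: "\<forall>i \<in> I. M i \<in> left_perp D W" and cp: "is_coproduct D I M S \<iota>"
    for I :: "'u set" and M S \<iota>
  proof (rule left_perpI[OF coproductD(1)[OF cp] WO])
    fix Y u assume Y: "Y \<in> W" and u: "u \<in> homs D S Y"
    show "u = Zer D S Y"
    proof (rule coproduct_ext[OF cp u])
      note [simp] = coproductD[OF cp]
      show "Zer D S Y \<in> homs D S Y" using Y WO by auto
      show "u \<cdot> \<iota> i = Zer D S Y \<cdot> \<iota> i" if i: "i \<in> I" for i
        using left_perpD[of "M i" D W Y "u \<cdot> \<iota> i"] M i Y u WO by auto
    qed
  qed
qed

end

section \<open>Sequential homotopy colimits\<close>

context cocomplete_triangulated_category
begin

text \<open>The Milnor telescope: \<open>\<phi>\<close> is \<open>1 - shift\<close> on the coproduct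
  and \<open>H\<close> is its cone. Cones are unique only up to non-canonical isomorphism, so this
  is a relation and not a function.\<close>

definition hocolim :: "(nat \<Rightarrow> 'o) \<Rightarrow> (nat \<Rightarrow> 'm) \<Rightarrow> 'o \<Rightarrow> (nat \<Rightarrow> 'm) \<Rightarrow> bool" where
  "hocolim B b H j \<longleftrightarrow> (\<forall>n. b n \<in> homs D (B n) (B (Suc n))) \<and>
     (\<exists>S \<iota> \<phi> g h. is_coproduct D UNIV B S \<iota> \<and> tri S S H \<phi> g h \<and>
        (\<forall>n. \<phi> \<cdot> \<iota> n = \<iota> n \<^bold>- \<iota> (Suc n) \<cdot> b n) \<and> (\<forall>n. j n = g \<cdot> \<iota> n))"

text \<open>Indexed by the start \<open>k\<close> and the length \<open>d\<close>, which suits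
  recursion; the target is \<open>B (k + d)\<close>.\<close>

primrec transition :: "(nat \<Rightarrow> 'o) \<Rightarrow> (nat \<Rightarrow> 'm) \<Rightarrow> nat \<Rightarrow> nat \<Rightarrow> 'm" where
  "transition B b k 0 = Ident D (B k)"
| "transition B b k (Suc d) = b (k + d) \<cdot> transition B b k d"

lemma small_nat: "|UNIV :: nat set| <o \<kappa>"
  using small_countable[OF inaccessible, of "UNIV :: nat set"] by simp

lemma hocolim_exists:
  assumes N: "localizing N" and B: "\<And>n. B n \<in> N" and b: "\<And>n. b n \<in> homs D (B n) (B (Suc n))"
  obtains H j where "hocolim B b H j" "H \<in> N"
proof -
  have "B n \<in> Obj D" for n using B shift_stableD(1)[OF localizingD(1)[OF N]] by blast
  then obtain S \<iota> where cp: "is_coproduct D UNIV B S \<iota>" using coproduct_exists[OF small_nat] by metis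
  note [simp] = coproductD[OF cp]
  note [simp] = homsD[OF b]
  have "\<iota> n \<^bold>- \<iota> (Suc n) \<cdot> b n \<in> homs D (B n) S" for n by simp
  note c = cotuple[OF cp coproductD(1)[OF cp] this]
  obtain H g h where t: "tri S S H (cotuple UNIV S \<iota> S (\<lambda>n. \<iota> n \<^bold>- \<iota> (Suc n) \<cdot> b n)) g h"
    by (rule cone_exists[OF c(1)])
  have "S \<in> N" using localizing_coproduct[OF N small_nat B cp] .
  then have "H \<in> N" using localizingD(3)[OF N t] by blast
  moreover have "hocolim B b H (\<lambda>n. g \<cdot> \<iota> n)"
    unfolding hocolim_def using b cp t c(2) by blast
  ultimately show ?thesis using that by blast
qed

lemma hocolim_legs:
  assumes hc: "hocolim B b H j"
  shows "j n \<in> homs D (B n) H" "j (Suc n) \<cdot> b n = j n" "b n \<in> homs D (B n) (B (Suc n))"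
proof -
  obtain S \<iota> \<phi> g h where b: "\<And>n. b n \<in> homs D (B n) (B (Suc n))" and cp: "is_coproduct D UNIV B S \<iota>"
    and t: "tri S S H \<phi> g h" and \<phi>: "\<And>n. \<phi> \<cdot> \<iota> n = \<iota> n \<^bold>- \<iota> (Suc n) \<cdot> b n" and j: "\<And>n. j n = g \<cdot> \<iota> n"
    using assms unfolding hocolim_def by blast
  note [simp] = coproductD[OF cp] triD[OF t]
  note [simp] = homsD[OF b]
  show j': "j n \<in> homs D (B n) H" for n using j by simp
  show "b n \<in> homs D (B n) (B (Suc n))" by (rule b)
  have "g \<cdot> (\<phi> \<cdot> \<iota> n) = (g \<cdot> \<phi>) \<cdot> \<iota> n" by simp
  then have "g \<cdot> (\<iota> n \<^bold>- \<iota> (Suc n) \<cdot> b n) = Zer D (B n) H"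
    unfolding \<phi> tri_comp1[OF t] by simp
  then have "j n \<^bold>- j (Suc n) \<cdot> b n = Zer D (B n) H" using j by simp
  then show "j (Suc n) \<cdot> b n = j n"
    using sub_eq_Zer_iff[of "j n" "B n" H "j (Suc n) \<cdot> b n"] j' b by simp
qed

lemma hocolim_Obj: "hocolim B b H j \<Longrightarrow> H \<in> Obj D" "hocolim B b H j \<Longrightarrow> B n \<in> Obj D"
  using homs_Obj[OF hocolim_legs(1)] by blast+

text \<open>Compatible maps form a map on the coproduct that kills \<open>1 - shift\<close>, hence
  extend over the cone; the extension need not be unique.\<close>

lemma hocolim_desc:
  assumes hc: "hocolim B b H j" and u: "\<And>n. u n \<in> homs D (B n) X" and ub: "\<And>n. u (Suc n) \<cdot> b n = u n"
  obtains v where "v \<in> homs D H X" "\<And>n. v \<cdot> j n = u n"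
proof -
  obtain S \<iota> \<phi> g h where b: "\<And>n. b n \<in> homs D (B n) (B (Suc n))" and cp: "is_coproduct D UNIV B S \<iota>"
    and t: "tri S S H \<phi> g h" and \<phi>: "\<And>n. \<phi> \<cdot> \<iota> n = \<iota> n \<^bold>- \<iota> (Suc n) \<cdot> b n" and j: "\<And>n. j n = g \<cdot> \<iota> n"
    using hc unfolding hocolim_def by blast
  note [simp] = coproductD[OF cp] triD[OF t]
  note [simp] = homsD[OF b]
  note [simp] = homsD[OF u]
  have X: "X \<in> Obj D" using homs_Obj(2)[OF u] .
  note c = cotuple[OF cp X, of u, OF u]
  have [simp]: "cotuple UNIV S \<iota> X u \<in> Arr D" "Dom D (cotuple UNIV S \<iota> X u) = S"
    "Cod D (cotuple UNIV S \<iota> X u) = X" using c(1) by auto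
  have "cotuple UNIV S \<iota> X u \<cdot> \<phi> = Zer D S X"
  proof (rule coproduct_ext[OF cp])
    show "cotuple UNIV S \<iota> X u \<cdot> \<phi> \<in> homs D S X" "Zer D S X \<in> homs D S X" using X by auto
    fix n
    have "(cotuple UNIV S \<iota> X u \<cdot> \<phi>) \<cdot> \<iota> n = cotuple UNIV S \<iota> X u \<cdot> (\<iota> n \<^bold>- \<iota> (Suc n) \<cdot> b n)"
      unfolding \<phi>[symmetric] by simp
    also have "\<dots> = cotuple UNIV S \<iota> X u \<cdot> \<iota> n \<^bold>- (cotuple UNIV S \<iota> X u \<cdot> \<iota> (Suc n)) \<cdot> b n"
      by simp
    also have "\<dots> = Zer D S X \<cdot> \<iota> n" unfolding c(2)[OF UNIV_I] ub using X by simp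
    finally show "cotuple UNIV S \<iota> X u \<cdot> \<phi> \<cdot> \<iota> n = Zer D S X \<cdot> \<iota> n" .
  qed
  then obtain v where v: "v \<in> homs D H X" "v \<cdot> g = cotuple UNIV S \<iota> X u"
    using weak_cokernel[OF t c(1)] by blast
  have "v \<cdot> j n = u n" for n
  proof -
    have "v \<cdot> j n = (v \<cdot> g) \<cdot> \<iota> n" using v(1) j by simp
    then show ?thesis using v c(2) by simp
  qed
  then show ?thesis using that v by blast
qed

lemma trans_homs:
  assumes "\<And>n. b n \<in> homs D (B n) (B (Suc n))" "\<And>n. B n \<in> Obj D"
  shows "transition B b k d \<in> homs D (B k) (B (k + d))"
proof (induction d)
  case 0 then show ?case using assms by simp
next
  case (Suc d) then show ?case using assms(1)[of "k + d"] by simp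
qed

lemma trans_Suc_left:
  assumes b: "\<And>n. b n \<in> homs D (B n) (B (Suc n))" and B: "\<And>n. B n \<in> Obj D"
  shows "transition B b k (Suc d) = transition B b (Suc k) d \<cdot> b k"
proof (induction d)
  case 0 then show ?case using b[of k] by simp
next
  case (Suc d)
  have "transition B b k (Suc (Suc d)) = b (k + Suc d) \<cdot> (transition B b (Suc k) d \<cdot> b k)"
    using Suc by simp
  then show ?case using b[of k] b[of "Suc k + d"] trans_homs[of b B, OF b B, of "Suc k" d] by simp
qed

lemma leg_trans:
  assumes hc: "hocolim B b H j" shows "j (k + d) \<cdot> transition B b k d = j k"
proof (induction d)
  case 0 then show ?case using hocolim_legs[OF hc, of k] by simp
next
  case (Suc d)
  have "j (k + Suc d) \<cdot> transition B b k (Suc d) = (j (Suc (k + d)) \<cdot> b (k + d)) \<cdot> transition B b k d"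
    using hocolim_legs(1,3)[OF hc] trans_homs[of b B, OF hocolim_legs(3)[OF hc] hocolim_Obj(2)[OF hc], of k d] by simp
  then show ?case using Suc hocolim_legs(2)[OF hc] by simp
qed

text \<open>The map \<open>\<rho>\<close> that sends the \<open>k\<close>-th summand to \<open>B n\<close> by the transition map if \<open>k \<le> n\<close> and to zero
  otherwise telescopes: composed with \<open>1 - shift\<close> it is the projection to \<open>B n\<close>.\<close>

lemma telescope:
  assumes cp: "is_coproduct D UNIV B S \<iota>" and b: "\<And>n. b n \<in> homs D (B n) (B (Suc n))"
    and \<phi>: "\<phi> \<in> homs D S S" "\<And>n. \<phi> \<cdot> \<iota> n = \<iota> n \<^bold>- \<iota> (Suc n) \<cdot> b n"
  obtains \<rho> where "\<rho> \<in> homs D S (B n)" "\<rho> \<cdot> \<phi> = cproj UNIV B S \<iota> n"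
    "\<And>k. k \<le> n \<Longrightarrow> \<rho> \<cdot> \<iota> k = transition B b k (n - k)"
proof -
  note [simp] = coproductD[OF cp] cproj[OF cp]
  note [simp] = homsD[OF b]
  have B [simp]: "B n \<in> Obj D" for n using homs_Obj(1)[OF b] .
  define g where "g k = (if k \<le> n then transition B b k (n - k) else Zer D (B k) (B n))" for k
  have g: "g k \<in> homs D (B k) (B n)" for k
    using trans_homs[of b B, OF b B, of k "n - k"] by (auto simp: g_def)
  note c = cotuple[OF cp B[of n], of g, OF g]
  show ?thesis
  proof (rule that[OF c(1)])
    show "cotuple UNIV S \<iota> (B n) g \<cdot> \<iota> k = transition B b k (n - k)" if "k \<le> n" for k
      using c(2) that by (simp add: g_def)
    show "cotuple UNIV S \<iota> (B n) g \<cdot> \<phi> = cproj UNIV B S \<iota> n"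
    proof (rule coproduct_ext[OF cp])
      show "cotuple UNIV S \<iota> (B n) g \<cdot> \<phi> \<in> homs D S (B n)" "cproj UNIV B S \<iota> n \<in> homs D S (B n)"
        using c(1) \<phi>(1) by auto
      fix k
      have gk: "g k \<in> Arr D" "Dom D (g k) = B k" "Cod D (g k) = B n" for k using g[of k] by auto
      have "cotuple UNIV S \<iota> (B n) g \<cdot> \<phi> \<cdot> \<iota> k = cotuple UNIV S \<iota> (B n) g \<cdot> (\<iota> k \<^bold>- \<iota> (Suc k) \<cdot> b k)"
        unfolding \<phi>(2)[symmetric] using c(1) \<phi>(1) by simp
      also have "\<dots> = cotuple UNIV S \<iota> (B n) g \<cdot> \<iota> k \<^bold>- (cotuple UNIV S \<iota> (B n) g \<cdot> \<iota> (Suc k)) \<cdot> b k"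
        using c(1) by simp
      also have "\<dots> = g k \<^bold>- g (Suc k) \<cdot> b k" unfolding c(2)[OF UNIV_I] ..
      also have "\<dots> = cproj UNIV B S \<iota> n \<cdot> \<iota> k"
      proof (cases k n rule: linorder_cases)
        case less
        then have "n - k = Suc (n - Suc k)" by simp
        then have "g k = g (Suc k) \<cdot> b k"
          using less trans_Suc_left[of b B, OF b B, of k "n - Suc k"] by (simp add: g_def)
        then show ?thesis using less gk(1)[of k] gk(2)[of k] gk(3)[of k] by simp
      qed (simp_all add: g_def)
      finally show "cotuple UNIV S \<iota> (B n) g \<cdot> \<phi> \<cdot> \<iota> k = cproj UNIV B S \<iota> n \<cdot> \<iota> k" .
    qed
  qed
qed

text \<open>On a finite part \<open>1 - shift\<close> is injective, since the telescope maps recover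
  all projections from it. Hence the boundary \<open>h u\<close> vanishes and \<open>u\<close> lifts
  to the coproduct; the lift lives on finitely many \<open>B k\<close>, which all map to the last
  one.\<close>

lemma hocolim_factor:
  assumes hc: "hocolim B b H j" and N: "shift_stable N" and B: "\<And>n. B n \<in> N"
    and Q: "rcompact N Q" and u: "u \<in> homs D Q H"
  obtains n v where "v \<in> homs D Q (B n)" "j n \<cdot> v = u"
proof -
  obtain S \<iota> \<phi> g h where b: "\<And>n. b n \<in> homs D (B n) (B (Suc n))" and cp: "is_coproduct D UNIV B S \<iota>"
    and t: "tri S S H \<phi> g h" and \<phi>: "\<And>n. \<phi> \<cdot> \<iota> n = \<iota> n \<^bold>- \<iota> (Suc n) \<cdot> b n" and j: "\<And>n. j n = g \<cdot> \<iota> n"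
    using hc unfolding hocolim_def by blast
  note [simp] = coproductD[OF cp] triD[OF t] cpart[OF cp]
  note cp1 = coproduct_shift[OF cp]
  have QO: "Q \<in> Obj D" using homs_Obj(1)[OF u] .
  have \<phi>': "\<phi> \<in> homs D S S" by simp
  have hu: "h \<cdot> u \<in> homs D Q (ShO D S)" using u by auto
  have BN: "(ShO D \<circ> B) n \<in> N" for n using shift_stableD(2)[OF N B[of n]] by simp
  obtain J where "J \<subseteq> UNIV" and J: "finite J" "cpart UNIV (ShO D \<circ> B) (ShO D S) (ShA D \<circ> \<iota>) J \<cdot> (h \<cdot> u) = h \<cdot> u"
    by (rule rcompactD[OF Q small_nat BN cp1 hu])
  have "h \<cdot> u = Zer D Q (ShO D S)"
  proof (rule finite_part_eq_Zer[OF cp1 hu J(2,1)])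
    fix n :: nat
    obtain \<rho> where \<rho>: "\<rho> \<in> homs D S (B n)" "\<rho> \<cdot> \<phi> = cproj UNIV B S \<iota> n"
      by (rule telescope[OF cp b \<phi>' \<phi>])
    \<comment> \<open>The projection is \<open>(\<rho> \<phi>)[1]\<close>, and
      \<open>\<phi>[1] h\<close> is zero as a composite in the triangle.\<close>
    have "cproj UNIV (ShO D \<circ> B) (ShO D S) (ShA D \<circ> \<iota>) n = ShA D (\<rho> \<cdot> \<phi>)"
      using ShA_cproj[OF cp, of n] \<rho>(2) by simp
    then have "cproj UNIV (ShO D \<circ> B) (ShO D S) (ShA D \<circ> \<iota>) n \<cdot> (h \<cdot> u) = ShA D \<rho> \<cdot> ((ShA D \<phi> \<cdot> h) \<cdot> u)"
      using \<rho>(1) u by simp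
    then show "cproj UNIV (ShO D \<circ> B) (ShO D S) (ShA D \<circ> \<iota>) n \<cdot> (h \<cdot> u) = Zer D Q ((ShO D \<circ> B) n)"
      using \<rho>(1) u QO by (simp add: tri_comp3[OF t])
  qed simp
  then obtain v where v: "v \<in> homs D Q S" "g \<cdot> v = u" using weak_kernel2[OF t u] by blast
  obtain K where "K \<subseteq> UNIV" and K: "finite K" "cpart UNIV B S \<iota> K \<cdot> v = v"
    by (rule rcompactD[OF Q small_nat B cp v(1)])
  \<comment> \<open>Inserting \<open>0\<close> makes the maximum meaningful for empty
    \<open>K\<close> as well.\<close>
  define n where "n = Max (insert 0 K)"
  have n: "k \<le> n" if "k \<in> K" for k using K(1) that unfolding n_def by (intro Max_ge) auto
  define s where "s k = (if k \<in> K then transition B b k (n - k) else Zer D (B k) (B n))" for k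
  have Bn: "B n \<in> Obj D" for n by simp
  have s: "s k \<in> homs D (B k) (B n)" for k
    using trans_homs[of b B, OF b Bn, of k "n - k"] n[of k] by (auto simp: s_def)
  note c = cotuple[OF cp Bn[of n], of s, OF s]
  have eq: "g \<cdot> cpart UNIV B S \<iota> K = j n \<cdot> cotuple UNIV S \<iota> (B n) s"
  proof (rule coproduct_ext[OF cp])
    show "g \<cdot> cpart UNIV B S \<iota> K \<in> homs D S H" "j n \<cdot> cotuple UNIV S \<iota> (B n) s \<in> homs D S H"
      using c(1) hocolim_legs(1)[OF hc, of n] by auto
    fix k
    have "(j n \<cdot> cotuple UNIV S \<iota> (B n) s) \<cdot> \<iota> k = j n \<cdot> s k"
      using c hocolim_legs(1)[OF hc, of n] by simp
    also have "\<dots> = (if k \<in> K then j k else Zer D (B k) H)"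
      using leg_trans[OF hc, of k "n - k"] n[of k] hocolim_legs(1)[OF hc, of n] by (auto simp: s_def)
    also have "\<dots> = (g \<cdot> cpart UNIV B S \<iota> K) \<cdot> \<iota> k" using j by auto
    finally show "(g \<cdot> cpart UNIV B S \<iota> K) \<cdot> \<iota> k = (j n \<cdot> cotuple UNIV S \<iota> (B n) s) \<cdot> \<iota> k" by simp
  qed
  have "u = g \<cdot> (cpart UNIV B S \<iota> K \<cdot> v)" using v K by simp
  also have "\<dots> = (g \<cdot> cpart UNIV B S \<iota> K) \<cdot> v" using v(1) by simp
  also have "\<dots> = j n \<cdot> (cotuple UNIV S \<iota> (B n) s \<cdot> v)"
    unfolding eq using c(1) v(1) hocolim_legs(1)[OF hc, of n] by simp
  finally show ?thesis using that[of "cotuple UNIV S \<iota> (B n) s \<cdot> v" n] c(1) v(1) by simp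
qed

text \<open>Write \<open>\<iota> n v = \<phi> w\<close> with \<open>w\<close> living on a finite
  \<open>J\<close>. The telescope map to an index \<open>l\<close> beyond \<open>J\<close> turns the
  right side into the \<open>l\<close>-th projection of \<open>w\<close>, which is zero, and the
  left side into the transition of \<open>v\<close> to \<open>B l\<close>.\<close>

lemma hocolim_kill:
  assumes hc: "hocolim B b H j" and N: "shift_stable N" and B: "\<And>n. B n \<in> N"
    and Q: "rcompact N Q" and v: "v \<in> homs D Q (B n)" "j n \<cdot> v = Zer D Q H"
  obtains d where "transition B b n d \<cdot> v = Zer D Q (B (n + d))"
proof -
  obtain S \<iota> \<phi> g h where b: "\<And>n. b n \<in> homs D (B n) (B (Suc n))" and cp: "is_coproduct D UNIV B S \<iota>"
    and t: "tri S S H \<phi> g h" and \<phi>: "\<And>n. \<phi> \<cdot> \<iota> n = \<iota> n \<^bold>- \<iota> (Suc n) \<cdot> b n" and j: "\<And>n. j n = g \<cdot> \<iota> n"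
    using hc unfolding hocolim_def by blast
  note [simp] = coproductD[OF cp] triD[OF t] cpart[OF cp] cproj[OF cp]
  have QO: "Q \<in> Obj D" using homs_Obj(1)[OF v(1)] .
  have \<phi>': "\<phi> \<in> homs D S S" by simp
  have "g \<cdot> (\<iota> n \<cdot> v) = Zer D Q H" using v j by simp
  then obtain w where w: "w \<in> homs D Q S" "\<phi> \<cdot> w = \<iota> n \<cdot> v"
    using weak_kernel[OF t, of "\<iota> n \<cdot> v" Q] v(1) by auto
  obtain J where "J \<subseteq> UNIV" and J: "finite J" "cpart UNIV B S \<iota> J \<cdot> w = w"
    by (rule rcompactD[OF Q small_nat B cp w(1)])
  define m where "m = Max (insert 0 J)"
  have m: "k \<le> m" if "k \<in> J" for k using J(1) that unfolding m_def by (intro Max_ge) auto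
  \<comment> \<open>This index exceeds every element of \<open>J\<close> and is not below
    \<open>n\<close>, so \<open>\<rho>\<close> restricts to a transition map on
    \<open>B n\<close>.\<close>
  define l where "l = n + Suc m"
  have l: "l \<notin> J" using m[of l] by (auto simp: l_def)
  obtain \<rho> where \<rho>: "\<rho> \<in> homs D S (B l)" "\<rho> \<cdot> \<phi> = cproj UNIV B S \<iota> l"
      "\<And>k. k \<le> l \<Longrightarrow> \<rho> \<cdot> \<iota> k = transition B b k (l - k)"
    using telescope[OF cp b \<phi>' \<phi>, of l] by metis
  have "transition B b n (Suc m) \<cdot> v = (\<rho> \<cdot> \<iota> n) \<cdot> v" using \<rho>(3)[of n] by (simp add: l_def)
  also have "\<dots> = \<rho> \<cdot> (\<phi> \<cdot> w)" using \<rho>(1) v(1) w(2) by simp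
  also have "\<dots> = (\<rho> \<cdot> \<phi>) \<cdot> w" using \<rho>(1) w(1) by simp
  also have "\<dots> = cproj UNIV B S \<iota> l \<cdot> (cpart UNIV B S \<iota> J \<cdot> w)" using \<rho>(2) J(2) by simp
  also have "\<dots> = (cproj UNIV B S \<iota> l \<cdot> cpart UNIV B S \<iota> J) \<cdot> w" using w(1) by simp
  also have "\<dots> = Zer D Q (B l)" using cproj_cpart[OF cp, of l J] l w(1) by auto
  finally show ?thesis using that[of "Suc m"] by (simp add: l_def)
qed

text \<open>If the transition maps induce zero on all maps into \<open>Y\<close>, then \<open>1 - shift\<close> induces the identity.\<close>

lemma hocolim_left_perp:
  assumes hc: "hocolim B b H j" and Y: "shift_stable Y" and k: "\<And>n y. y \<in> Y \<Longrightarrow> kills D (b n) y"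
  shows "H \<in> left_perp D Y"
proof (rule left_perpI)
  show "H \<in> Obj D" using hocolim_Obj[OF hc] by blast
  show YO: "Y \<subseteq> Obj D" using Y by (simp add: shift_stable_def)
  obtain S \<iota> \<phi> g h where b: "\<And>n. b n \<in> homs D (B n) (B (Suc n))" and cp: "is_coproduct D UNIV B S \<iota>"
    and t: "tri S S H \<phi> g h" and \<phi>: "\<And>n. \<phi> \<cdot> \<iota> n = \<iota> n \<^bold>- \<iota> (Suc n) \<cdot> b n" and j: "\<And>n. j n = g \<cdot> \<iota> n"
    using hc unfolding hocolim_def by blast
  note [simp] = coproductD[OF cp] triD[OF t]
  note [simp] = homsD[OF b]
  have \<phi>_id: "v \<cdot> \<phi> = v" if v: "v \<in> homs D S y" and y: "y \<in> Y" for v y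
  proof (rule coproduct_ext[OF cp _ v])
    show "v \<cdot> \<phi> \<in> homs D S y" using v by simp
    fix n
    have z: "(v \<cdot> \<iota> (Suc n)) \<cdot> b n = Zer D (B n) y"
      using k[OF y, of n] v unfolding kills_def by simp
    have "(v \<cdot> \<phi>) \<cdot> \<iota> n = v \<cdot> (\<iota> n \<^bold>- \<iota> (Suc n) \<cdot> b n)" unfolding \<phi>[symmetric] using v by simp
    also have "\<dots> = v \<cdot> \<iota> n \<^bold>- (v \<cdot> \<iota> (Suc n)) \<cdot> b n" using v by simp
    also have "\<dots> = v \<cdot> \<iota> n" unfolding z using v by simp
    finally show "(v \<cdot> \<phi>) \<cdot> \<iota> n = v \<cdot> \<iota> n" .
  qed
  fix y u assume y: "y \<in> Y" and u: "u \<in> homs D H y"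
  have yO: "y \<in> Obj D" using y YO by auto
  have "u \<cdot> g = (u \<cdot> g) \<cdot> \<phi>" using \<phi>_id[OF _ y, of "u \<cdot> g"] u by simp
  also have "\<dots> = u \<cdot> (g \<cdot> \<phi>)" using u by simp
  also have "\<dots> = Zer D S y" unfolding tri_comp1[OF t] using u yO by simp
  finally obtain v where v: "v \<in> homs D (ShO D S) y" "v \<cdot> h = u" using weak_cokernel2[OF t u] by blast
  \<comment> \<open>The identity \<open>v' \<phi> = v'\<close> holds for maps on \<open>S\<close>,
    so \<open>v\<close> is desuspended first; then \<open>v h\<close> contains
    \<open>\<phi>[1] h\<close>, which is zero.\<close>
  obtain y' where y': "y' \<in> Obj D" "ShO D y' = y" by (rule unshift_Obj[OF yO])
  have "v \<in> homs D (ShO D S) (ShO D y')" using v y' by simp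
  then obtain v' where v': "v' \<in> homs D S y'" "ShA D v' = v" using unshift_homs y'(1) coproductD(1)[OF cp] by blast
  have "y' \<in> Y" using shift_stableD(3)[OF Y y'(1)] y y' by simp
  then have "v = ShA D (v' \<cdot> \<phi>)" using \<phi>_id[OF v'(1)] v' by simp
  then have "u = ShA D (v' \<cdot> \<phi>) \<cdot> h" using v(2) by simp
  also have "\<dots> = ShA D v' \<cdot> (ShA D \<phi> \<cdot> h)" using v'(1) by simp
  finally have "u = ShA D v' \<cdot> (ShA D \<phi> \<cdot> h)" .
  then show "u = Zer D H y" unfolding tri_comp3[OF t] using v' y' by auto
qed

end

section \<open>Brown towers\<close>

context cocomplete_triangulated_category
begin

text \<open>Cells with domain in \<open>\<G>\<close> are attached so as to kill the kernel of
  \<open>\<beta>\<close> on maps from \<open>\<G>\<close>. They are indexed by such maps, hence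
  \<open>'m set\<close>; stages are pairs so that dependent choice can act on them.\<close>

definition tower_step :: "'o set \<Rightarrow> 'o \<Rightarrow> 'o \<times> 'm \<Rightarrow> 'o \<times> 'm \<Rightarrow> 'm \<Rightarrow> bool" where
  "tower_step \<G> M = (\<lambda>(B, \<beta>) (B', \<beta>') b.
     b \<in> homs D B B' \<and> \<beta>' \<in> homs D B' M \<and> \<beta>' \<cdot> b = \<beta> \<and>
     (\<exists>(I :: 'm set) K S \<iota> c k. |I| <o \<kappa> \<and> (\<forall>i \<in> I. K i \<in> \<G>) \<and> is_coproduct D I K S \<iota> \<and>
        tri S B B' c b k) \<and>
     (\<forall>G \<in> \<G>. \<forall>x \<in> homs D G B. \<beta> \<cdot> x = Zer D G M \<longrightarrow> b \<cdot> x = Zer D G B'))"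

text \<open>Starting from a zero object, and not from a coproduct of members of \<open>\<G>\<close>,
  makes every later stage a cone of the same kind and the base case of inductions over the tower
  trivial.\<close>

definition tower :: "'o set \<Rightarrow> 'o \<Rightarrow> (nat \<Rightarrow> 'o) \<Rightarrow> (nat \<Rightarrow> 'm) \<Rightarrow> (nat \<Rightarrow> 'm) \<Rightarrow> bool" where
  "tower \<G> M B b \<beta> \<longleftrightarrow> is_zero_object D (B 0) \<and> \<beta> 0 \<in> homs D (B 0) M \<and>
     (\<forall>n. tower_step \<G> M (B n, \<beta> n) (B (Suc n), \<beta> (Suc n)) (b n)) \<and>
     (\<forall>G \<in> \<G>. \<forall>x \<in> homs D G M. \<exists>y \<in> homs D G (B 1). \<beta> 1 \<cdot> y = x)"

lemma small_homs_into:
  assumes "|\<G>| <o \<kappa>" "\<G> \<subseteq> Obj D" "M \<in> Obj D"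
  shows "|\<Union>G\<in>\<G>. homs D G M| <o \<kappa>"
  using locally_small assms by (intro small_UN[OF inaccessible]) (auto simp: locally_small_def)

lemma tower_step_exists:
  assumes small: "|\<G>| <o \<kappa>" and G: "\<G> \<subseteq> Obj D" and \<beta>: "\<beta> \<in> homs D B M"
  obtains B' \<beta>' b where "tower_step \<G> M (B, \<beta>) (B', \<beta>') b"
proof -
  have O: "B \<in> Obj D" "M \<in> Obj D" using homs_Obj[OF \<beta>] by auto
  note [simp] = O
  have \<beta>' [simp]: "\<beta> \<in> Arr D" "Dom D \<beta> = B" "Cod D \<beta> = M" using \<beta> by auto
  \<comment> \<open>All maps from \<open>\<G>\<close> to \<open>B\<close> that die in
    \<open>M\<close>. Each serves as its own index and as its own component; local smallness keeps
    the set small.\<close>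
  define I where "I = {x \<in> \<Union>G\<in>\<G>. homs D G B. \<beta> \<cdot> x = Zer D (Dom D x) M}"
  have I: "|I| <o \<kappa>"
    by (rule small_subset[OF small_homs_into[OF small G O(1)]]) (auto simp: I_def)
  have ID: "x \<in> Arr D" "Dom D x \<in> \<G>" "Cod D x = B" "\<beta> \<cdot> x = Zer D (Dom D x) M" if "x \<in> I" for x
    using that by (auto simp: I_def)
  obtain S \<iota> where cp: "is_coproduct D I (Dom D) S \<iota>"
    using coproduct_exists[OF I, of "Dom D"] ID(1) by auto
  note [simp] = coproductD[OF cp]
  have "x \<in> homs D (Dom D x) B" if "x \<in> I" for x using ID[OF that] by simp
  note c = cotuple[OF cp O(1), of "\<lambda>x. x", OF this]
  obtain B' b k where t: "tri S B B' (cotuple I S \<iota> B (\<lambda>x. x)) b k" by (rule cone_exists[OF c(1)])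
  note [simp] = triD[OF t]
  have "\<beta> \<cdot> cotuple I S \<iota> B (\<lambda>x. x) = Zer D S M"
  proof (rule coproduct_ext[OF cp])
    show "\<beta> \<cdot> cotuple I S \<iota> B (\<lambda>x. x) \<in> homs D S M" "Zer D S M \<in> homs D S M" by auto
    show "\<beta> \<cdot> cotuple I S \<iota> B (\<lambda>x. x) \<cdot> \<iota> x = Zer D S M \<cdot> \<iota> x" if "x \<in> I" for x
      using that c(2)[OF _ that] ID[OF that] by simp
  qed
  then obtain \<beta>' where \<beta>': "\<beta>' \<in> homs D B' M" "\<beta>' \<cdot> b = \<beta>" using weak_cokernel[OF t \<beta>] by blast
  have "b \<cdot> x = Zer D G B'" if x: "G \<in> \<G>" "x \<in> homs D G B" "\<beta> \<cdot> x = Zer D G M" for G x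
  proof -
    have xI: "x \<in> I" using x by (auto simp: I_def)
    have "b \<cdot> x = b \<cdot> (cotuple I S \<iota> B (\<lambda>x. x) \<cdot> \<iota> x)" using c(2)[OF _ xI] xI ID[OF xI] by simp
    also have "\<dots> = (b \<cdot> cotuple I S \<iota> B (\<lambda>x. x)) \<cdot> \<iota> x" using xI by simp
    also have "\<dots> = Zer D G B'" unfolding tri_comp1[OF t] using xI x by simp
    finally show ?thesis .
  qed
  moreover have "b \<in> homs D B B'" by simp
  moreover have "\<forall>i \<in> I. Dom D i \<in> \<G>" using ID by blast
  ultimately have "tower_step \<G> M (B, \<beta>) (B', \<beta>') b"
    unfolding tower_step_def prod.case using \<beta>' I cp t by blast
  then show ?thesis by (rule that)
qed

text \<open>The cone of a map from \<open>S\<close> to zero is \<open>S[1]\<close>. To make it the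
  coproduct of the domains of all maps from \<open>\<G>\<close> to \<open>M\<close>,
  \<open>S\<close> is built from desuspended domains, which stay in \<open>\<G>\<close> by shift
  stability.\<close>

lemma tower_base:
  assumes small: "|\<G>| <o \<kappa>" and G: "shift_stable \<G>" and M: "M \<in> Obj D" and Z: "is_zero_object D Z"
  obtains B' \<beta>' b where "tower_step \<G> M (Z, Zer D Z M) (B', \<beta>') b"
    "\<forall>G \<in> \<G>. \<forall>x \<in> homs D G M. \<exists>y \<in> homs D G B'. \<beta>' \<cdot> y = x"
proof -
  note [simp] = M
  have [simp]: "Z \<in> Obj D" using Z by (simp add: is_zero_object_def)
  have GO: "\<G> \<subseteq> Obj D" using G by (simp add: shift_stable_def)
  define I where "I = (\<Union>G\<in>\<G>. homs D G M)"
  have I: "|I| <o \<kappa>" unfolding I_def by (rule small_homs_into[OF small GO M])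
  have ID: "x \<in> Arr D" "Dom D x \<in> \<G>" "Cod D x = M" if "x \<in> I" for x
    using that by (auto simp: I_def)
  have "\<exists>X. X \<in> Obj D \<and> ShO D X = Dom D x" if "x \<in> I" for x
    using unshift_Obj[of "Dom D x"] ID[OF that] by auto
  then obtain K where K: "\<And>x. x \<in> I \<Longrightarrow> K x \<in> Obj D" "\<And>x. x \<in> I \<Longrightarrow> ShO D (K x) = Dom D x" by metis
  have KG: "\<forall>x \<in> I. K x \<in> \<G>" using shift_stableD(3)[OF G K(1)] K(2) ID(2) by simp
  obtain S \<iota> where cp: "is_coproduct D I K S \<iota>" by (rule coproduct_exists[OF I K(1)])
  note [simp] = coproductD[OF cp]
  note cp1 = coproduct_shift[OF cp]
  have "x \<in> homs D ((ShO D \<circ> K) x) M" if "x \<in> I" for x using ID[OF that] K(2)[OF that] by simp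
  note c = cotuple[OF cp1 M, of "\<lambda>x. x", OF this]
  let ?\<beta> = "cotuple I (ShO D S) (ShA D \<circ> \<iota>) M (\<lambda>x. x)"
  have t: "tri S Z (ShO D S) (Zer D S Z) (Zer D Z (ShO D S)) (neg_mor D (ShA D (Ident D S)))"
    using tri_rotate[OF tri_Ident[OF coproductD(1)[OF cp] Z]] .
  have ex: "\<exists>y \<in> homs D G (ShO D S). ?\<beta> \<cdot> y = x" if x: "G \<in> \<G>" "x \<in> homs D G M" for G x
  proof
    have xI: "x \<in> I" using x by (auto simp: I_def)
    show "?\<beta> \<cdot> ShA D (\<iota> x) = x" using c(2)[OF _ xI] xI by simp
    show "ShA D (\<iota> x) \<in> homs D G (ShO D S)" using xI K(2)[OF xI] x by simp
  qed
  have "Zer D Z (ShO D S) \<cdot> x = Zer D G (ShO D S)" if "x \<in> homs D G Z" for x G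
    using that by auto
  moreover have "?\<beta> \<cdot> Zer D Z (ShO D S) = Zer D Z M" using c(1) by simp
  moreover have "Zer D Z (ShO D S) \<in> homs D Z (ShO D S)" by simp
  ultimately have "tower_step \<G> M (Z, Zer D Z M) (ShO D S, ?\<beta>) (Zer D Z (ShO D S))"
    unfolding tower_step_def prod.case using c(1) I KG cp t by blast
  then show ?thesis using that ex by blast
qed

lemma tower_exists:
  assumes small: "|\<G>| <o \<kappa>" and G: "shift_stable \<G>" and M: "M \<in> Obj D"
  obtains B b \<beta> where "tower \<G> M B b \<beta>"
proof -
  obtain Z where Z: "is_zero_object D Z" "Z \<in> Obj D" by (rule zero_obtain)
  have GO: "\<G> \<subseteq> Obj D" using G by (simp add: shift_stable_def)
  \<comment> \<open>Index \<open>0\<close> is singled out because only the first step has to reach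
    all maps from \<open>\<G>\<close> to \<open>M\<close>.\<close>
  define P where "P n X \<longleftrightarrow> snd X \<in> homs D (fst X) M \<and> (n = 0 \<longrightarrow> X = (Z, Zer D Z M))"
    for n :: nat and X
  define R where "R n X X' \<longleftrightarrow> (\<exists>b. tower_step \<G> M X X' b) \<and>
      (n = 0 \<longrightarrow> (\<forall>G \<in> \<G>. \<forall>x \<in> homs D G M. \<exists>y \<in> homs D G (fst X'). snd X' \<cdot> y = x))"
    for n :: nat and X X'
  have "\<exists>X. P 0 X" using Z M by (intro exI[of _ "(Z, Zer D Z M)"]) (auto simp: P_def)
  moreover have "\<exists>X'. P (Suc n) X' \<and> R n X X'" if X: "P n X" for n X
  proof (cases "n = 0")
    case True
    then have X': "X = (Z, Zer D Z M)" using X by (simp add: P_def)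
    obtain B' \<beta>' b where ts: "tower_step \<G> M (Z, Zer D Z M) (B', \<beta>') b"
      and "\<forall>G \<in> \<G>. \<forall>x \<in> homs D G M. \<exists>y \<in> homs D G B'. \<beta>' \<cdot> y = x"
      by (rule tower_base[OF small G M Z(1)])
    moreover have "\<beta>' \<in> homs D B' M" using ts by (simp add: tower_step_def)
    ultimately show ?thesis using True unfolding X' P_def R_def
      by (intro exI[of _ "(B', \<beta>')"]) auto
  next
    case False
    obtain B \<beta> where X': "X = (B, \<beta>)" by fastforce
    then have \<beta>: "\<beta> \<in> homs D B M" using X by (simp add: P_def)
    obtain B' \<beta>' b where ts: "tower_step \<G> M (B, \<beta>) (B', \<beta>') b"
      by (rule tower_step_exists[OF small GO \<beta>])
    moreover have "\<beta>' \<in> homs D B' M" using ts by (simp add: tower_step_def)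
    ultimately show ?thesis using False unfolding X' P_def R_def
      by (intro exI[of _ "(B', \<beta>')"]) auto
  qed
  ultimately obtain f where f: "\<And>n. P n (f n)" "\<And>n. R n (f n) (f (Suc n))"
    using dependent_nat_choice[of P R] by metis
  from f(2) have "\<forall>n. \<exists>b. tower_step \<G> M (f n) (f (Suc n)) b" by (simp add: R_def)
  then obtain b where b: "\<And>n. tower_step \<G> M (f n) (f (Suc n)) (b n)" by metis
  have "tower \<G> M (\<lambda>n. fst (f n)) b (\<lambda>n. snd (f n))"
    unfolding tower_def
  proof (intro conjI allI)
    show "is_zero_object D (fst (f 0))" "snd (f 0) \<in> homs D (fst (f 0)) M"
      using f(1)[of 0] Z M by (auto simp: P_def)
    show "tower_step \<G> M (fst (f n), snd (f n)) (fst (f (Suc n)), snd (f (Suc n))) (b n)" for n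
      using b by simp
    show "\<forall>G \<in> \<G>. \<forall>x \<in> homs D G M. \<exists>y \<in> homs D G (fst (f 1)). snd (f 1) \<cdot> y = x"
      using f(2)[of 0] by (simp add: R_def)
  qed
  then show ?thesis by (rule that)
qed

lemma towerD:
  assumes "tower \<G> M B b \<beta>"
  shows "is_zero_object D (B 0)" "b n \<in> homs D (B n) (B (Suc n))" "\<beta> n \<in> homs D (B n) M"
    "\<beta> (Suc n) \<cdot> b n = \<beta> n"
    "\<exists>(I :: 'm set) K S \<iota> c k. |I| <o \<kappa> \<and> (\<forall>i \<in> I. K i \<in> \<G>) \<and> is_coproduct D I K S \<iota> \<and>
        tri S (B n) (B (Suc n)) c (b n) k"
    "G \<in> \<G> \<Longrightarrow> x \<in> homs D G (B n) \<Longrightarrow> \<beta> n \<cdot> x = Zer D G M \<Longrightarrow> b n \<cdot> x = Zer D G (B (Suc n))"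
    "G \<in> \<G> \<Longrightarrow> x \<in> homs D G M \<Longrightarrow> \<exists>y \<in> homs D G (B 1). \<beta> 1 \<cdot> y = x"
proof -
  note t = assms[unfolded tower_def tower_step_def prod.case]
  show "is_zero_object D (B 0)" "b n \<in> homs D (B n) (B (Suc n))"
    "\<beta> (Suc n) \<cdot> b n = \<beta> n"
    "\<exists>(I :: 'm set) K S \<iota> c k. |I| <o \<kappa> \<and> (\<forall>i \<in> I. K i \<in> \<G>) \<and> is_coproduct D I K S \<iota> \<and>
        tri S (B n) (B (Suc n)) c (b n) k"
    "G \<in> \<G> \<Longrightarrow> x \<in> homs D G (B n) \<Longrightarrow> \<beta> n \<cdot> x = Zer D G M \<Longrightarrow> b n \<cdot> x = Zer D G (B (Suc n))"
    "G \<in> \<G> \<Longrightarrow> x \<in> homs D G M \<Longrightarrow> \<exists>y \<in> homs D G (B 1). \<beta> 1 \<cdot> y = x"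
    using t by blast+
  show "\<beta> n \<in> homs D (B n) M" using t by (cases n) blast+
qed

lemma tower_localizing:
  assumes N: "localizing N" and G: "\<G> \<subseteq> N" and tw: "tower \<G> M B b \<beta>"
  shows "B n \<in> N"
proof (induction n)
  case 0 then show ?case using localizingD(2)[OF N towerD(1)[OF tw]] .
next
  case (Suc n)
  obtain I :: "'m set" and K S \<iota> c k where I: "|I| <o \<kappa>" "\<And>i. i \<in> I \<Longrightarrow> K i \<in> \<G>"
      and cp: "is_coproduct D I K S \<iota>" and t: "tri S (B n) (B (Suc n)) c (b n) k"
    using towerD(5)[OF tw, of n] by blast
  have "S \<in> N" using localizing_coproduct[OF N I(1) _ cp] I(2) G by blast
  then show ?case using localizingD(3)[OF N t] Suc by blast
qed

lemma tower_hocolim: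
  assumes N: "localizing N" and G: "\<G> \<subseteq> N" and tw: "tower \<G> M B b \<beta>"
  obtains H j \<alpha> where "hocolim B b H j" "H \<in> N" "\<alpha> \<in> homs D H M" "\<And>n. \<alpha> \<cdot> j n = \<beta> n"
proof -
  obtain H j where hc: "hocolim B b H j" "H \<in> N"
    by (rule hocolim_exists[of N B b, OF N tower_localizing[OF N G tw] towerD(2)[OF tw]])
  obtain \<alpha> where "\<alpha> \<in> homs D H M" "\<And>n. \<alpha> \<cdot> j n = \<beta> n"
    using hocolim_desc[of B b H j \<beta> M, OF hc(1) towerD(3,4)[OF tw]] by metis
  then show ?thesis using that hc by blast
qed

text \<open>A map \<open>w\<close> from \<open>Q\<close> to the cone of \<open>hocolim B \<rightarrow> M\<close> becomes, after the boundary map, a map into some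
  \<open>B n\<close> that vanishes in \<open>M\<close>. Precomposed with \<open>r\<close> it therefore dies in \<open>B (n + 1)\<close>, so \<open>w \<cdot> r\<close> comes
  from a map \<open>T \<rightarrow> M\<close>, and those factor through \<open>B 1\<close>.\<close>

lemma tower_cone_zero:
  assumes N: "shift_stable N" and G: "shift_stable \<G>" and tw: "tower \<G> M B b \<beta>"
    and BN: "\<And>n. B n \<in> N" and hc: "hocolim B b H j" and \<alpha>: "\<alpha> \<in> homs D H M" "\<And>n. \<alpha> \<cdot> j n = \<beta> n"
    and t: "tri H M W \<alpha> \<gamma> \<delta>" and Q: "rcompact N Q" and T: "T \<in> \<G>"
    and r: "r \<in> homs D T Q" and w: "w \<in> homs D Q W"
  shows "w \<cdot> r = Zer D T W"
proof -
  note [simp] = triD[OF t]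
  have O [simp]: "Q \<in> Obj D" "T \<in> Obj D" using homs_Obj[OF r] by auto
  \<comment> \<open>Everything is desuspended once, so that the boundary of \<open>w\<close> becomes
    a map into \<open>H\<close> itself and not into \<open>H[1]\<close>.\<close>
  obtain Q' where Q': "Q' \<in> Obj D" "ShO D Q' = Q" by (rule unshift_Obj[OF O(1)])
  obtain T' where T': "T' \<in> Obj D" "ShO D T' = T" by (rule unshift_Obj[OF O(2)])
  have "r \<in> homs D (ShO D T') (ShO D Q')" using r Q' T' by simp
  then obtain r' where r': "r' \<in> homs D T' Q'" "ShA D r' = r" using unshift_homs T' Q' by blast
  have "\<delta> \<cdot> w \<in> homs D (ShO D Q') (ShO D H)" using w Q' by simp
  then obtain u where u: "u \<in> homs D Q' H" "ShA D u = \<delta> \<cdot> w"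
    using unshift_homs Q'(1) triD(10)[OF t] by blast
  have TG: "T' \<in> \<G>" using shift_stableD(3)[OF G T'(1)] T' T by simp
  have rQ: "rcompact N Q'" using rcompact_shift[OF N Q'(1)] Q Q' by simp
  obtain n v where v: "v \<in> homs D Q' (B n)" "j n \<cdot> v = u" by (rule hocolim_factor[OF hc N BN rQ u(1)])
  note jn = hocolim_legs[OF hc]
  have "ShA D (\<alpha> \<cdot> u) = (ShA D \<alpha> \<cdot> \<delta>) \<cdot> w" using u w by simp
  also have "\<dots> = ShA D (Zer D Q' M)" unfolding tri_comp3[OF t] using w Q' by auto
  finally have "\<alpha> \<cdot> u = Zer D Q' M" using u(1) Q'(1) by (subst (asm) ShA_eq_iff) auto
  then have "\<beta> n \<cdot> v = Zer D Q' M"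
    using v \<alpha>(1) jn(1)[of n] assoc[of v "j n" \<alpha>] \<alpha>(2)[of n] by simp
  then have "\<beta> n \<cdot> (v \<cdot> r') = Zer D T' M"
    using v r' towerD(3)[OF tw, of n] assoc[of r' v "\<beta> n"] by simp
  then have b0: "b n \<cdot> (v \<cdot> r') = Zer D T' (B (Suc n))"
    using towerD(6)[OF tw TG, of "v \<cdot> r'" n] v r' by simp
  have "u \<cdot> r' = (j (Suc n) \<cdot> b n) \<cdot> (v \<cdot> r')"
    unfolding jn(2) v(2)[symmetric] using v(1) r' jn(1)[of n] by simp
  also have "\<dots> = j (Suc n) \<cdot> (b n \<cdot> (v \<cdot> r'))"
    using v(1) r' jn(1)[of "Suc n"] jn(3)[of n] by simp
  also have "\<dots> = Zer D T' H" unfolding b0 using jn(1)[of "Suc n"] T' by simp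
  finally have "ShA D (u \<cdot> r') = Zer D T (ShO D H)" using T' by simp
  then have "\<delta> \<cdot> (w \<cdot> r) = Zer D T (ShO D H)"
    using u r' w r by simp
  then obtain y where y: "y \<in> homs D T M" "\<gamma> \<cdot> y = w \<cdot> r"
    using weak_kernel2[OF t, of "w \<cdot> r" T] w r by auto
  obtain y' where y': "y' \<in> homs D T (B 1)" "\<beta> 1 \<cdot> y' = y" using towerD(7)[OF tw T y(1)] by blast
  have "y = (\<alpha> \<cdot> j 1) \<cdot> y'" unfolding \<alpha>(2) y'(2) ..
  also have "\<dots> = \<alpha> \<cdot> (j 1 \<cdot> y')" using y'(1) jn(1)[of 1] by simp
  finally have "y = \<alpha> \<cdot> (j 1 \<cdot> y')" .
  then have "w \<cdot> r = (\<gamma> \<cdot> \<alpha>) \<cdot> (j 1 \<cdot> y')" using y(2) y' jn(1)[of 1] by simp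
  then show ?thesis unfolding tri_comp1[OF t] using y' jn(1)[of 1] by simp
qed

text \<open>\<open>N'\<close> varies because the two conclusions are needed for different classes.
  For ideals \<open>H\<close> must lie in a left orthogonal while \<open>Q\<close> is compact in all
  of \<open>D\<close>; for the coreflection \<open>H\<close> must lie in two classes and
  \<open>Q\<close> is compact relative to \<open>Y\<close>.\<close>

lemma brown_triangle:
  assumes small: "|\<G>| <o \<kappa>" and G: "shift_stable \<G>" and N: "localizing N" and GN: "\<G> \<subseteq> N"
    and M: "M \<in> Obj D"
  obtains H W \<alpha> \<gamma> \<delta> where "tri H M W \<alpha> \<gamma> \<delta>" "H \<in> N"
    "\<forall>N'. localizing N' \<longrightarrow> \<G> \<subseteq> N' \<longrightarrow> H \<in> N'"
    "\<forall>N' Q T. localizing N' \<longrightarrow> \<G> \<subseteq> N' \<longrightarrow> rcompact N' Q \<longrightarrow> T \<in> \<G> \<longrightarrow>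
       (\<forall>r \<in> homs D T Q. \<forall>w \<in> homs D Q W. w \<cdot> r = Zer D T W)"
proof -
  obtain B b \<beta> where tw: "tower \<G> M B b \<beta>" by (rule tower_exists[OF small G M])
  obtain H j \<alpha> where hc: "hocolim B b H j" "H \<in> N" and \<alpha>: "\<alpha> \<in> homs D H M" "\<And>n. \<alpha> \<cdot> j n = \<beta> n"
    by (rule tower_hocolim[OF N GN tw]) blast
  obtain W \<gamma> \<delta> where t: "tri H M W \<alpha> \<gamma> \<delta>" by (rule cone_exists[OF \<alpha>(1)])
  have "H \<in> N'" if N': "localizing N'" and GN': "\<G> \<subseteq> N'" for N'
  proof -
    obtain S \<iota> \<phi> g h where cp: "is_coproduct D UNIV B S \<iota>" and tS: "tri S S H \<phi> g h"
      using hc(1) unfolding hocolim_def by blast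
    have "S \<in> N'"
      by (rule localizing_coproduct[OF N' small_nat tower_localizing[OF N' GN' tw] cp])
    then show ?thesis using localizingD(3)[OF N' tS] by blast
  qed
  moreover have "w \<cdot> r = Zer D T W"
    if "localizing N'" "\<G> \<subseteq> N'" "rcompact N' Q" "T \<in> \<G>" "r \<in> homs D T Q" "w \<in> homs D Q W" for N' Q T r w
    using tower_cone_zero[OF localizingD(1)[OF that(1)] G tw tower_localizing[OF that(1,2) tw] hc(1) \<alpha> t that(3-6)] .
  ultimately show ?thesis using that[OF t hc(2)] by blast
qed

end

section \<open>Maps from compact objects that are killed by a reflective localizing class\<close>

context cocomplete_triangulated_category
begin

definition generating :: "'o set \<Rightarrow> bool" where
  "generating \<G> \<longleftrightarrow> |\<G>| <o \<kappa> \<and> shift_stable \<G> \<and> (\<forall>G \<in> \<G>. compact_object \<kappa> D G) \<and>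
     (\<forall>M \<in> Obj D. (\<forall>G \<in> \<G>. homs D G M = {Zer D G M}) \<longrightarrow> is_zero_object D M)"

lemma shift_stable_Obj: "shift_stable (Obj D)"
  by (auto simp: shift_stable_def)

lemma localizing_Obj: "localizing (Obj D)"
  using shift_stable_Obj coproductD(1) by (auto simp: localizing_def is_zero_object_def dest: triD(12))

text \<open>\<open>\<Q>\<close> need not be closed under isomorphism, so that it can be a small set.\<close>

definition thick_over :: "'o set \<Rightarrow> 'o set \<Rightarrow> bool" where
  "thick_over \<G> \<Q> \<longleftrightarrow> \<G> \<subseteq> \<Q> \<and> (\<forall>Q \<in> \<Q>. compact_object \<kappa> D Q) \<and> (\<exists>Z \<in> \<Q>. is_zero_object D Z) \<and>
     (\<forall>A \<in> \<Q>. \<forall>B \<in> \<Q>. \<forall>f \<in> homs D A B. \<exists>B' g h. tri A B B' f g h \<and> B' \<in> \<Q>) \<and>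
     (\<forall>A \<in> \<Q>. \<forall>B \<in> \<Q>. \<exists>S i j p q. is_biproduct D A B S i j p q \<and> S \<in> \<Q>)"

lemma thick_overD:
  assumes "thick_over \<G> \<Q>"
  shows "G \<in> \<G> \<Longrightarrow> G \<in> \<Q>" "Q \<in> \<Q> \<Longrightarrow> rcompact (Obj D) Q" "\<exists>Z \<in> \<Q>. is_zero_object D Z"
    "A \<in> \<Q> \<Longrightarrow> B \<in> \<Q> \<Longrightarrow> f \<in> homs D A B \<Longrightarrow> \<exists>B' g h. tri A B B' f g h \<and> B' \<in> \<Q>"
    "A \<in> \<Q> \<Longrightarrow> B \<in> \<Q> \<Longrightarrow> \<exists>S i j p q. is_biproduct D A B S i j p q \<and> S \<in> \<Q>"
  using assms unfolding thick_over_def compact_iff by blast+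

text \<open>The object \<open>R\<close> is an iterated biproduct that starts from a zero object; the
  factorization of the idempotent \<open>cpart J\<close> through it is all that later arguments use.
  The map \<open>\<kappa>'\<close> is unrelated to the cardinal \<open>\<kappa>\<close>.\<close>

lemma finite_subcoproduct:
  assumes Q: "thick_over \<G> \<Q>" and cp: "is_coproduct D I K S \<iota>" and K: "\<And>i. i \<in> I \<Longrightarrow> K i \<in> \<G>"
    and J: "finite J" "J \<subseteq> I"
  shows "\<exists>R \<in> \<Q>. \<exists>\<kappa>' \<in> homs D R S. \<exists>\<pi> \<in> homs D S R. \<kappa>' \<cdot> \<pi> = cpart I K S \<iota> J"
  using J
proof (induction J)
  case empty
  note [simp] = coproductD[OF cp]
  obtain Z where Z: "Z \<in> \<Q>" "is_zero_object D Z" using thick_overD(3)[OF Q] by blast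
  have [simp]: "Z \<in> Obj D" using Z(2) by (simp add: is_zero_object_def)
  show ?case
  proof (intro bexI)
    show "Zer D Z S \<cdot> Zer D S Z = cpart I K S \<iota> {}" by (simp add: cpart_empty[OF cp])
  qed (use Z(1) in simp_all)
next
  case (insert a J)
  note [simp] = coproductD[OF cp]
  have aI: "a \<in> I" using insert by simp
  note [simp] = cproj(1-3)[OF cp aI] aI
  obtain R \<kappa>' \<pi> where R: "R \<in> \<Q>" and \<kappa>': "\<kappa>' \<in> homs D R S" and \<pi>: "\<pi> \<in> homs D S R"
    and eq: "\<kappa>' \<cdot> \<pi> = cpart I K S \<iota> J" using insert by blast
  have "K a \<in> \<Q>" using K[OF aI] thick_overD(1)[OF Q] by blast
  then obtain R2 i j p q where bp: "is_biproduct D R (K a) R2 i j p q" and R2: "R2 \<in> \<Q>"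
    using thick_overD(5)[OF Q R] by blast
  have ij [simp]: "i \<in> Arr D" "Dom D i = R" "Cod D i = R2" "j \<in> Arr D" "Dom D j = K a" "Cod D j = R2"
    using bp by (auto simp: is_biproduct_def)
  obtain u where u: "u \<in> homs D R2 S" "u \<cdot> i = \<kappa>'" "u \<cdot> j = \<iota> a"
    using biproduct_copair[OF bp \<kappa>', of "\<iota> a"] by auto
  have "u \<cdot> (i \<cdot> \<pi> \<^bold>+ j \<cdot> cproj I K S \<iota> a) = (u \<cdot> i) \<cdot> \<pi> \<^bold>+ (u \<cdot> j) \<cdot> cproj I K S \<iota> a"
    using u(1) \<pi> by simp
  also have "\<dots> = cpart I K S \<iota> (insert a J)"
    unfolding u(2,3) eq cpart_insert[OF cp aI insert.hyps(2)] ..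
  finally have "u \<cdot> (i \<cdot> \<pi> \<^bold>+ j \<cdot> cproj I K S \<iota> a) = cpart I K S \<iota> (insert a J)" .
  moreover have "i \<cdot> \<pi> \<^bold>+ j \<cdot> cproj I K S \<iota> a \<in> homs D S R2" using \<pi> by simp
  ultimately show ?case using u(1) R2 by blast
qed

end

text \<open>Only universal arrows are given; \<open>L\<close> becomes a functor through
  \<open>LA\<close>. As a localizing class, \<open>Y\<close> is closed under small coproducts of
  \<open>D\<close>, which makes the localization smashing.\<close>

locale reflective_localizing = cocomplete_triangulated_category D \<kappa>
  for D :: "('o, 'm, 'z) tricat_scheme" (structure) and \<kappa> :: "'u rel" +
  fixes Y :: "'o set" and L :: "'o \<Rightarrow> 'o" and \<eta> :: "'o \<Rightarrow> 'm"
  assumes Y: "localizing Y"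
    and unit: "A \<in> Obj D \<Longrightarrow> \<eta> A \<in> homs D A (L A)"
    and L_Y: "A \<in> Obj D \<Longrightarrow> L A \<in> Y"
    and unit_ex1: "A \<in> Obj D \<Longrightarrow> X \<in> Y \<Longrightarrow> u \<in> homs D A X \<Longrightarrow> \<exists>!v. v \<in> homs D (L A) X \<and> v \<cdot> \<eta> A = u"
begin

notation sub (infixl \<open>\<^bold>-\<close> 65)
notation add (infixl \<open>\<^bold>+\<close> 65)

definition LA :: "'m \<Rightarrow> 'm" where
  "LA f = (THE v. v \<in> homs D (L (Dom D f)) (L (Cod D f)) \<and> v \<cdot> \<eta> (Dom D f) = \<eta> (Cod D f) \<cdot> f)"

lemma unit_simps [simp]:
  assumes "A \<in> Obj D"
  shows "\<eta> A \<in> Arr D" "Dom D (\<eta> A) = A" "Cod D (\<eta> A) = L A" "L A \<in> Obj D"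
  using unit[OF assms] homs_Obj(2)[OF unit[OF assms]] by auto

lemma unit_factor:
  assumes "X \<in> Y" "u \<in> homs D A X"
  obtains v where "v \<in> homs D (L A) X" "v \<cdot> \<eta> A = u"
  using unit_ex1[OF homs_Obj(1)[OF assms(2)] assms] by blast

lemma unit_ext:
  assumes "A \<in> Obj D" "X \<in> Y" "v \<in> homs D (L A) X" "v' \<in> homs D (L A) X" "v \<cdot> \<eta> A = v' \<cdot> \<eta> A"
  shows "v = v'"
proof -
  have "v' \<cdot> \<eta> A \<in> homs D A X" using assms by simp
  from unit_ex1[OF assms(1,2) this] show ?thesis using assms by blast
qed

lemma LA_props:
  assumes f: "f \<in> Arr D"
  shows "LA f \<in> homs D (L (Dom D f)) (L (Cod D f)) \<and> LA f \<cdot> \<eta> (Dom D f) = \<eta> (Cod D f) \<cdot> f"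
proof -
  have "\<eta> (Cod D f) \<cdot> f \<in> homs D (Dom D f) (L (Cod D f))" using f by simp
  from unit_ex1[OF Dom_Obj[OF f] L_Y[OF Cod_Obj[OF f]] this] show ?thesis
    unfolding LA_def by (rule theI')
qed

lemma LA_simps [simp]:
  assumes "f \<in> Arr D"
  shows "LA f \<in> Arr D" "Dom D (LA f) = L (Dom D f)" "Cod D (LA f) = L (Cod D f)"
  using LA_props[OF assms] by auto

lemma LA_unit: "f \<in> homs D A B \<Longrightarrow> LA f \<cdot> \<eta> A = \<eta> B \<cdot> f"
  using LA_props[of f] by auto

lemma LA_eqI:
  assumes f: "f \<in> homs D A B" and v: "v \<in> homs D (L A) (L B)" "v \<cdot> \<eta> A = \<eta> B \<cdot> f"
  shows "LA f = v"
  using unit_ext[OF homs_Obj(1)[OF f] L_Y[OF homs_Obj(2)[OF f]] _ v(1), of "LA f"] f v(2) LA_unit[OF f]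
  by simp

lemma LA_Comp:
  assumes f: "f \<in> homs D A B" and g: "g \<in> homs D B B'"
  shows "LA (g \<cdot> f) = LA g \<cdot> LA f"
proof (rule LA_eqI)
  note [simp] = homs_Obj[OF f] homs_Obj[OF g]
  show "g \<cdot> f \<in> homs D A B'" "LA g \<cdot> LA f \<in> homs D (L A) (L B')" using f g by auto
  have "LA g \<cdot> LA f \<cdot> \<eta> A = LA g \<cdot> (LA f \<cdot> \<eta> A)" using f g by simp
  also have "\<dots> = (LA g \<cdot> \<eta> B) \<cdot> f" unfolding LA_unit[OF f] using f g by simp
  also have "\<dots> = \<eta> B' \<cdot> (g \<cdot> f)" unfolding LA_unit[OF g] using f g by simp
  finally show "LA g \<cdot> LA f \<cdot> \<eta> A = \<eta> B' \<cdot> (g \<cdot> f)" .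
qed

lemma LA_Zer: "A \<in> Obj D \<Longrightarrow> B \<in> Obj D \<Longrightarrow> LA (Zer D A B) = Zer D (L A) (L B)"
  by (rule LA_eqI) auto

text \<open>The cone \<open>W\<close> of \<open>LA f\<close> lies in \<open>Y\<close>, so the
  comparison map from \<open>B'\<close> to \<open>W\<close> factors over the unit of
  \<open>B'\<close>. Hence whatever \<open>LA g\<close> kills dies in \<open>W\<close>; it is not
  necessary to identify \<open>W\<close> with \<open>L B'\<close>.\<close>

lemma LA_exact:
  assumes t: "tri A B B' f g h" and x: "x \<in> homs D P (L B)" "LA g \<cdot> x = Zer D P (L B')"
  obtains y where "y \<in> homs D P (L A)" "LA f \<cdot> y = x"
proof -
  note [simp] = triD[OF t]
  have Lf: "LA f \<in> homs D (L A) (L B)" by simp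
  have PO: "P \<in> Obj D" using homs_Obj[OF x(1)] by simp
  obtain W g1 h1 where tW: "tri (L A) (L B) W (LA f) g1 h1" by (rule cone_exists[OF Lf])
  note [simp] = triD[OF tW]
  have WY: "W \<in> Y" using localizingD(3)[OF Y tW] L_Y by simp
  have "\<eta> B \<cdot> f = LA f \<cdot> \<eta> A" using LA_unit[of f A B] by simp
  then obtain c where c: "c \<in> homs D B' W" "c \<cdot> g = g1 \<cdot> \<eta> B"
    using tri_map[OF t tW unit[OF triD(10)[OF t]] unit[OF triD(11)[OF t]]] by metis
  obtain c' where c': "c' \<in> homs D (L B') W" "c' \<cdot> \<eta> B' = c" by (rule unit_factor[OF WY c(1)])
  have "c' \<cdot> LA g = g1"
  proof (rule unit_ext[of B, OF _ WY])
    show "c' \<cdot> LA g \<in> homs D (L B) W" "g1 \<in> homs D (L B) W" using c' by auto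
    have "c' \<cdot> LA g \<cdot> \<eta> B = c' \<cdot> (\<eta> B' \<cdot> g)" using LA_unit[of g B B'] c' by simp
    also have "\<dots> = (c' \<cdot> \<eta> B') \<cdot> g" using c'(1) by simp
    finally show "c' \<cdot> LA g \<cdot> \<eta> B = g1 \<cdot> \<eta> B" unfolding c'(2) c(2) .
  qed simp
  then have "g1 \<cdot> x = c' \<cdot> (LA g \<cdot> x)" using c'(1) x(1) by auto
  then have "g1 \<cdot> x = Zer D P W" unfolding x(2) using c'(1) PO by simp
  then show ?thesis using weak_kernel[OF tW x(1)] that by blast
qed

text \<open>The coproduct \<open>T\<close> of the \<open>L (K i)\<close> lies in \<open>Y\<close>,
  and \<open>L S\<close> is a retract of it by \<open>l\<close> and \<open>\<theta>'\<close>, where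
  \<open>l\<close> respects finite parts. A map from a compact \<open>P\<close> to
  \<open>L S\<close> therefore inherits a finite support from \<open>T\<close>.\<close>

lemma LA_finite_part:
  assumes P: "compact_object \<kappa> D P" and I: "|I| <o \<kappa>" and cp: "is_coproduct D I K S \<iota>"
    and y: "y \<in> homs D P (L S)"
  obtains J where "finite J" "J \<subseteq> I" "LA (cpart I K S \<iota> J) \<cdot> y = y"
proof -
  note [simp] = coproductD[OF cp] cpart(1-3)[OF cp]
  have LK: "L (K i) \<in> Obj D" if "i \<in> I" for i using that by simp
  obtain T \<iota>' where cpT: "is_coproduct D I (L \<circ> K) T \<iota>'"
    using coproduct_exists[OF I, of "L \<circ> K"] LK by auto
  note [simp] = coproductD[OF cpT] cpart(1-3)[OF cpT]
  have TY: "T \<in> Y" using localizing_coproduct[OF Y I _ cpT] L_Y by simp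
  have "\<iota>' i \<cdot> \<eta> (K i) \<in> homs D (K i) T" if "i \<in> I" for i using that by simp
  note th = cotuple[OF cp coproductD(1)[OF cpT], of "\<lambda>i. \<iota>' i \<cdot> \<eta> (K i)", OF this]
  define \<theta> where "\<theta> = cotuple I S \<iota> T (\<lambda>i. \<iota>' i \<cdot> \<eta> (K i))"
  have \<theta>: "\<theta> \<in> homs D S T" "\<And>i. i \<in> I \<Longrightarrow> \<theta> \<cdot> \<iota> i = \<iota>' i \<cdot> \<eta> (K i)"
    using th unfolding \<theta>_def by blast+
  obtain \<theta>' where \<theta>': "\<theta>' \<in> homs D (L S) T" "\<theta>' \<cdot> \<eta> S = \<theta>" by (rule unit_factor[OF TY \<theta>(1)])
  have "LA (\<iota> i) \<in> homs D ((L \<circ> K) i) (L S)" if "i \<in> I" for i using that by simp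
  moreover have "L S \<in> Obj D" by simp
  ultimately obtain l where l: "l \<in> homs D T (L S)" "\<And>i. i \<in> I \<Longrightarrow> l \<cdot> \<iota>' i = LA (\<iota> i)"
    using cotuple[OF cpT, of "L S" "\<lambda>i. LA (\<iota> i)"] by blast
  have "l \<cdot> \<theta> = \<eta> S"
  proof (rule coproduct_ext[OF cp])
    show "l \<cdot> \<theta> \<in> homs D S (L S)" "\<eta> S \<in> homs D S (L S)" using l \<theta> by auto
    fix i assume i: "i \<in> I"
    have "l \<cdot> \<theta> \<cdot> \<iota> i = (l \<cdot> \<iota>' i) \<cdot> \<eta> (K i)" using l(1) \<theta>(1) \<theta>(2)[OF i] i by simp
    then show "l \<cdot> \<theta> \<cdot> \<iota> i = \<eta> S \<cdot> \<iota> i"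
      unfolding l(2)[OF i] using LA_unit[of "\<iota> i" "K i" S] i by simp
  qed
  then have "l \<cdot> \<theta>' \<cdot> \<eta> S = Ident D (L S) \<cdot> \<eta> S" using \<theta>' l(1) by simp
  then have id: "l \<cdot> \<theta>' = Ident D (L S)"
    using unit_ext[of S "L S" "l \<cdot> \<theta>'" "Ident D (L S)"] L_Y \<theta>'(1) l(1) by simp
  have comm: "l \<cdot> cpart I (L \<circ> K) T \<iota>' J = LA (cpart I K S \<iota> J) \<cdot> l" for J
  proof (rule coproduct_ext[OF cpT])
    show "l \<cdot> cpart I (L \<circ> K) T \<iota>' J \<in> homs D T (L S)" "LA (cpart I K S \<iota> J) \<cdot> l \<in> homs D T (L S)"
      using l(1) by auto
    fix i assume i: "i \<in> I"
    have "LA (cpart I K S \<iota> J) \<cdot> l \<cdot> \<iota>' i = LA (cpart I K S \<iota> J) \<cdot> LA (\<iota> i)"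
      using l(1) l(2)[OF i] i by simp
    also have "\<dots> = LA (cpart I K S \<iota> J \<cdot> \<iota> i)" using i LA_Comp[of "\<iota> i" "K i" S] by simp
    also have "\<dots> = l \<cdot> (cpart I (L \<circ> K) T \<iota>' J \<cdot> \<iota>' i)"
      unfolding cpart(4)[OF cp i] cpart(4)[OF cpT i] using i l by (simp add: LA_Zer)
    finally show "l \<cdot> cpart I (L \<circ> K) T \<iota>' J \<cdot> \<iota>' i = LA (cpart I K S \<iota> J) \<cdot> l \<cdot> \<iota>' i"
      using l(1) i by simp
  qed
  have \<theta>y: "\<theta>' \<cdot> y \<in> homs D P T" using \<theta>'(1) y by simp
  have rP: "rcompact (Obj D) P" using P compact_iff by simp
  obtain J where J: "J \<subseteq> I" "finite J" "cpart I (L \<circ> K) T \<iota>' J \<cdot> (\<theta>' \<cdot> y) = \<theta>' \<cdot> y"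
    by (rule rcompactD[OF rP I _ cpT \<theta>y]) (use LK in auto)
  have ly: "l \<cdot> (\<theta>' \<cdot> y) = y"
  proof -
    have "l \<cdot> (\<theta>' \<cdot> y) = (l \<cdot> \<theta>') \<cdot> y" using l(1) \<theta>'(1) y by simp
    then show ?thesis unfolding id using y by simp
  qed
  have "y = l \<cdot> (cpart I (L \<circ> K) T \<iota>' J \<cdot> (\<theta>' \<cdot> y))" unfolding J(3) ly ..
  also have "\<dots> = (l \<cdot> cpart I (L \<circ> K) T \<iota>' J) \<cdot> (\<theta>' \<cdot> y)" using l(1) \<theta>'(1) y by simp
  also have "\<dots> = LA (cpart I K S \<iota> J) \<cdot> (l \<cdot> (\<theta>' \<cdot> y))" unfolding comm using l(1) \<theta>'(1) y by simp
  finally show ?thesis using that J ly by simp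
qed

text \<open>Elements \<open>x\<close> of the homological functor \<open>A \<mapsto> D(P, L A)\<close> behave as if it were the filtered
  colimit of its values on compact objects over \<open>B n\<close>. Passing from \<open>B n\<close> to the cone \<open>B (n + 1)\<close> of
  \<open>C \<rightarrow> B n\<close>: with \<open>R'[1]\<close> a finite part of \<open>C[1]\<close> through which \<open>Q \<rightarrow> C[1]\<close> factors and \<open>F\<close> the fibre of
  \<open>Q \<rightarrow> R'[1]\<close>, the element \<open>x\<close> lifts to \<open>t\<close> on \<open>F\<close>, whose image on \<open>B n\<close> comes from an element \<open>s\<close> on a
  finite part \<open>R\<close> of \<open>C\<close>. The induction hypothesis for \<open>F \<oplus> R\<close> gives \<open>S\<close>; the object sought is the
  homotopy pushout of \<open>Q \<leftarrow> F \<rightarrow> W\<close> where \<open>W\<close> is the cone of \<open>R \<rightarrow> S\<close>.\<close>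

lemma tower_compact_factor:
  assumes P: "compact_object \<kappa> D P" and \<Q>: "thick_over \<G> \<Q>" and tw: "tower \<G> M B b \<beta>"
    and Q: "compact_object \<kappa> D Q" and q: "q \<in> homs D Q (B n)"
    and x: "x \<in> homs D P (L Q)" "LA q \<cdot> x = Zer D P (L (B n))"
  shows "\<exists>Q' \<in> \<Q>. \<exists>r \<in> homs D Q Q'. \<exists>q' \<in> homs D Q' (B n). q' \<cdot> r = q \<and> LA r \<cdot> x = Zer D P (L Q')"
  using Q q x
proof (induction n arbitrary: Q q x)
  case 0
  obtain Z where Z: "Z \<in> \<Q>" "is_zero_object D Z" using thick_overD(3)[OF \<Q>] by blast
  have [simp]: "Z \<in> Obj D" "Q \<in> Obj D" "P \<in> Obj D" "B 0 \<in> Obj D"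
    using Z(2) 0(1) P homs_Obj[OF 0(2)] by (auto simp: is_zero_object_def compact_object_def)
  have "q = Zer D Q (B 0)" using zero_object_Arr_in[OF towerD(1)[OF tw] 0(2)] .
  \<comment> \<open>\<open>B 0\<close> is zero, so \<open>q\<close> factors through a zero object of
    \<open>\<Q>\<close>, where the image of \<open>x\<close> dies.\<close>
  then show ?case using Z(1) 0(3)
    by (intro bexI[of _ Z] bexI[of _ "Zer D Q Z"] bexI[of _ "Zer D Z (B 0)"]) (auto simp: LA_Zer)
next
  case (Suc n)
  note q = Suc.prems(2) and x = Suc.prems(3,4)
  obtain I :: "'m set" and K C \<iota> c k where I: "|I| <o \<kappa>" and K: "\<And>i. i \<in> I \<Longrightarrow> K i \<in> \<G>"
      and cp: "is_coproduct D I K C \<iota>" and tE: "tri C (B n) (B (Suc n)) c (b n) k"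
    using towerD(5)[OF tw, of n] by blast
  note [simp] = triD[OF tE] coproductD[OF cp] cpart(1-3)[OF cp]
  have KO: "K i \<in> Obj D" if "i \<in> I" for i using that by simp
  have rQ: "rcompact (Obj D) Q" using Suc.prems(1) compact_iff by simp
  note st = shift_stable_Obj
  have PO [simp]: "P \<in> Obj D" and QO [simp]: "Q \<in> Obj D" using P rcompact_Obj[OF rQ] by (auto simp: compact_object_def)
  have kq: "k \<cdot> q \<in> homs D Q (ShO D C)" using q by simp
  obtain J' where J': "J' \<subseteq> I" "finite J'"
      "cpart I (ShO D \<circ> K) (ShO D C) (ShA D \<circ> \<iota>) J' \<cdot> (k \<cdot> q) = k \<cdot> q"
    by (rule rcompactD[OF rQ I _ coproduct_shift[OF cp] kq]) (use KO in auto)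
  obtain R' \<kappa>' \<pi>' where R': "R' \<in> \<Q>" and \<kappa>': "\<kappa>' \<in> homs D R' C" and \<pi>': "\<pi>' \<in> homs D C R'"
      and \<kappa>\<pi>': "\<kappa>' \<cdot> \<pi>' = cpart I K C \<iota> J'"
    using finite_subcoproduct[OF \<Q> cp K J'(2,1)] by blast
  note [simp] = homsD[OF \<kappa>'] homsD[OF \<pi>'] homsD[OF q] homsD[OF x(1)]
  have R'O [simp]: "R' \<in> Obj D" using homs_Obj[OF \<kappa>'] by simp
  \<comment> \<open>\<open>k q\<close> lives on the finite part \<open>J'\<close> of
    \<open>C[1]\<close>; \<open>r0\<close> moves it to \<open>R'[1]\<close>, and
    \<open>\<kappa>'[1]\<close> gives \<open>k q\<close> back.\<close>
  define r0 where "r0 = ShA D \<pi>' \<cdot> (k \<cdot> q)"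
  have r0: "r0 \<in> homs D Q (ShO D R')" by (simp add: r0_def)
  have \<kappa>r0: "ShA D \<kappa>' \<cdot> r0 = k \<cdot> q"
  proof -
    have "ShA D \<kappa>' \<cdot> r0 = ShA D (\<kappa>' \<cdot> \<pi>') \<cdot> (k \<cdot> q)" by (simp add: r0_def)
    then show ?thesis unfolding \<kappa>\<pi>' ShA_cpart[OF cp] J'(3) .
  qed
  obtain F f h0 where t1: "tri F Q (ShO D R') f r0 h0" by (rule fibre_exists[OF r0])
  obtain X d where t2: "tri X F Q d f r0" "ShO D X = ShO D R'" by (rule tri_rotate_back[OF t1])
  have "X = R'" using t2 triD(10)[OF t2(1)] by (simp add: ShO_eq_iff)
  with t2 have t2: "tri R' F Q d f r0" by simp
  note [simp] = triD[OF t2]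
  have rR': "rcompact (Obj D) (ShO D R')" using rcompact_shift[OF st R'O] thick_overD(2)[OF \<Q> R'] by simp
  have rF: "rcompact (Obj D) F"
    using rcompact_cone[OF st tri_rotate[OF t1] rQ rR'] rcompact_shift[OF st triD(11)[OF t2]] by simp
  have "k \<cdot> (q \<cdot> f) = (k \<cdot> q) \<cdot> f" by simp
  also have "\<dots> = ShA D \<kappa>' \<cdot> (r0 \<cdot> f)" unfolding \<kappa>r0[symmetric] by simp
  also have "\<dots> = Zer D F (ShO D C)" unfolding tri_comp2[OF t2] by simp
  \<comment> \<open>On the fibre \<open>F\<close> the boundary of \<open>q\<close> vanishes, so
    \<open>q f\<close> comes from \<open>B n\<close>.\<close>
  finally obtain fn where fn: "fn \<in> homs D F (B n)" "b n \<cdot> fn = q \<cdot> f"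
    using weak_kernel2[OF tE, of "q \<cdot> f" F] by auto
  note [simp] = homsD[OF fn(1)]

  \<comment> \<open>\<open>r0\<close> factors through \<open>q\<close>, so it kills
    \<open>x\<close>, and \<open>x\<close> lifts to \<open>L F\<close>.\<close>
  have "LA r0 = LA (ShA D \<pi>' \<cdot> k) \<cdot> LA q"
    using LA_Comp[of q Q "B (Suc n)" "ShA D \<pi>' \<cdot> k" "ShO D R'"] by (simp add: r0_def)
  then have "LA r0 \<cdot> x = LA (ShA D \<pi>' \<cdot> k) \<cdot> (LA q \<cdot> x)" by simp
  then have "LA r0 \<cdot> x = Zer D P (L (ShO D R'))" unfolding x(2) by simp
  then obtain t where t: "t \<in> homs D P (L F)" "LA f \<cdot> t = x" using LA_exact[OF t1 x(1)] by blast
  note [simp] = homsD[OF t(1)]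
  \<comment> \<open>The image of \<open>t\<close> in \<open>L (B n)\<close> dies in
    \<open>L (B (Suc n))\<close>, so it comes from \<open>L C\<close>, and by compactness of
    \<open>P\<close> from a finite part of \<open>C\<close>.\<close>
  have "LA (b n) \<cdot> (LA fn \<cdot> t) = LA (b n \<cdot> fn) \<cdot> t"
    using LA_Comp[OF fn(1), of "b n" "B (Suc n)"] by simp
  also have "\<dots> = LA q \<cdot> (LA f \<cdot> t)" unfolding fn(2) using LA_Comp[of f F Q q "B (Suc n)"] by simp
  also have "\<dots> = Zer D P (L (B (Suc n)))" unfolding t(2) x(2) ..
  finally obtain y where y: "y \<in> homs D P (L C)" "LA c \<cdot> y = LA fn \<cdot> t"
    using LA_exact[OF tE, of "LA fn \<cdot> t" P] by auto
  obtain J where J: "finite J" "J \<subseteq> I" "LA (cpart I K C \<iota> J) \<cdot> y = y"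
    by (rule LA_finite_part[OF P I cp y(1)])
  obtain R \<kappa>1 \<pi> where R: "R \<in> \<Q>" and \<kappa>1: "\<kappa>1 \<in> homs D R C" and \<pi>: "\<pi> \<in> homs D C R"
      and \<kappa>\<pi>: "\<kappa>1 \<cdot> \<pi> = cpart I K C \<iota> J"
    using finite_subcoproduct[OF \<Q> cp K J(1,2)] by blast
  note [simp] = homsD[OF \<kappa>1] homsD[OF \<pi>] homsD[OF y(1)]
  have RO [simp]: "R \<in> Obj D" using homs_Obj[OF \<kappa>1] by simp
  define s where "s = LA \<pi> \<cdot> y"
  have [simp]: "s \<in> Arr D" "Dom D s = P" "Cod D s = L R" by (simp_all add: s_def)
  have "LA \<kappa>1 \<cdot> s = y"
    using J(3) LA_Comp[OF \<pi> \<kappa>1] unfolding \<kappa>\<pi>[symmetric] by (simp add: s_def)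
  then have s: "LA (c \<cdot> \<kappa>1) \<cdot> s = LA fn \<cdot> t"
    using y(2) LA_Comp[OF \<kappa>1, of c "B n"] by simp
  obtain P2 i j p2 q2 where bp: "is_biproduct D F R P2 i j p2 q2"
    using biproduct[OF triD(11)[OF t2] RO] by blast
  have ij [simp]: "i \<in> Arr D" "Dom D i = F" "Cod D i = P2" "j \<in> Arr D" "Dom D j = R" "Cod D j = P2" "P2 \<in> Obj D"
    using bp by (auto simp: is_biproduct_def)
  have cP2: "compact_object \<kappa> D P2"
    using rcompact_biproduct[OF bp rF thick_overD(2)[OF \<Q> R]] compact_iff by simp
  obtain m where m: "m \<in> homs D P2 (B n)" "m \<cdot> i = fn" "m \<cdot> j = c \<cdot> \<kappa>1"
    using biproduct_copair[OF bp fn(1), of "c \<cdot> \<kappa>1"] by auto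
  note [simp] = homsD[OF m(1)]
  \<comment> \<open>\<open>LA fn t\<close> and \<open>LA (c \<kappa>1) s\<close> agree, so this
    difference on the biproduct of \<open>F\<close> and \<open>R\<close> vanishes in
    \<open>L (B n)\<close> and the induction hypothesis applies.\<close>
  define x' where "x' = LA i \<cdot> t \<^bold>- LA j \<cdot> s"
  have x': "x' \<in> homs D P (L P2)" by (simp add: x'_def)
  have "LA m \<cdot> x' = LA (m \<cdot> i) \<cdot> t \<^bold>- LA (m \<cdot> j) \<cdot> s"
    using LA_Comp[of i F P2 m "B n"] LA_Comp[of j R P2 m "B n"] by (simp add: x'_def)
  also have "\<dots> = Zer D P (L (B n))" unfolding m s by simp
  finally have "LA m \<cdot> x' = Zer D P (L (B n))" .
  from Suc.IH[OF cP2 m(1) x' this]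
  obtain S \<rho> \<sigma> where S: "S \<in> \<Q>" and \<rho>: "\<rho> \<in> homs D P2 S" and \<sigma>: "\<sigma> \<in> homs D S (B n)"
      and \<sigma>\<rho>: "\<sigma> \<cdot> \<rho> = m" and \<rho>x: "LA \<rho> \<cdot> x' = Zer D P (L S)"
    by blast
  note [simp] = homsD[OF \<rho>] homsD[OF \<sigma>]
  have SO [simp]: "S \<in> Obj D" using homs_Obj[OF \<rho>] by simp
  have "LA \<rho> \<cdot> x' = LA (\<rho> \<cdot> i) \<cdot> t \<^bold>- LA (\<rho> \<cdot> j) \<cdot> s"
    using LA_Comp[of i F P2 \<rho> S] LA_Comp[of j R P2 \<rho> S] by (simp add: x'_def)
  then have ts: "LA (\<rho> \<cdot> i) \<cdot> t = LA (\<rho> \<cdot> j) \<cdot> s"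
    using \<rho>x sub_eq_Zer_iff[of "LA (\<rho> \<cdot> i) \<cdot> t" P "L S" "LA (\<rho> \<cdot> j) \<cdot> s"] by simp
  \<comment> \<open>Passing to the cone \<open>W\<close> kills the contribution of \<open>R\<close>.
    The map \<open>b n\<close> after \<open>\<sigma>\<close> extends over it because
    \<open>b n\<close> after \<open>c\<close> is zero.\<close>
  obtain W a1 a2 where tW: "tri R S W (\<rho> \<cdot> j) a1 a2" and W: "W \<in> \<Q>"
    using thick_overD(4)[OF \<Q> R S, of "\<rho> \<cdot> j"] by auto
  note [simp] = triD[OF tW]
  have "(b n \<cdot> \<sigma>) \<cdot> (\<rho> \<cdot> j) = b n \<cdot> ((\<sigma> \<cdot> \<rho>) \<cdot> j)" by simp
  also have "\<dots> = (b n \<cdot> c) \<cdot> \<kappa>1" unfolding \<sigma>\<rho> m(3) by simp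
  also have "\<dots> = Zer D R (B (Suc n))" unfolding tri_comp1[OF tE] by simp
  finally obtain w' where w': "w' \<in> homs D W (B (Suc n))" "w' \<cdot> a1 = b n \<cdot> \<sigma>"
    using weak_cokernel[OF tW, of "b n \<cdot> \<sigma>" "B (Suc n)"] by auto
  note [simp] = homsD[OF w'(1)]
  define w where "w = a1 \<cdot> (\<rho> \<cdot> i)"
  have w: "w \<in> homs D F W" by (simp add: w_def)
  note [simp] = homsD[OF w]
  obtain Q' a e where tQ: "tri R' W Q' (w \<cdot> d) a e" and Q': "Q' \<in> \<Q>"
    using thick_overD(4)[OF \<Q> R' W, of "w \<cdot> d"] by auto
  note [simp] = triD[OF tQ]
  obtain u where u: "u \<in> homs D Q Q'" "u \<cdot> f = a \<cdot> w"
    and push: "\<And>X q w'. q \<in> homs D Q X \<Longrightarrow> w' \<in> homs D W X \<Longrightarrow> q \<cdot> f = w' \<cdot> w \<Longrightarrow>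
       \<exists>v \<in> homs D Q' X. v \<cdot> u = q \<and> v \<cdot> a = w'"
    by (rule weak_pushout[OF t2 w tQ]) blast
  note [simp] = homsD[OF u(1)]
  have "w' \<cdot> w = (w' \<cdot> a1) \<cdot> (\<rho> \<cdot> i)" by (simp add: w_def)
  also have "\<dots> = b n \<cdot> ((\<sigma> \<cdot> \<rho>) \<cdot> i)" unfolding w'(2) by simp
  also have "\<dots> = q \<cdot> f" unfolding \<sigma>\<rho> m(2) fn(2) ..
  finally obtain q' where q': "q' \<in> homs D Q' (B (Suc n))" "q' \<cdot> u = q"
    using push[OF q w'(1)] by auto
  \<comment> \<open>In \<open>L S\<close> the image of \<open>t\<close> along
    \<open>\<rho> i\<close> equals that of \<open>s\<close> along \<open>\<rho> j\<close>, and the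
    latter dies in \<open>L W\<close>.\<close>
  have "LA u \<cdot> x = LA (u \<cdot> f) \<cdot> t" unfolding t(2)[symmetric] using LA_Comp[of f F Q u Q'] by simp
  also have "\<dots> = LA (a \<cdot> a1) \<cdot> (LA (\<rho> \<cdot> i) \<cdot> t)"
    unfolding u(2) w_def using LA_Comp[of "\<rho> \<cdot> i" F S "a \<cdot> a1" Q'] by simp
  also have "\<dots> = LA a \<cdot> (LA (a1 \<cdot> (\<rho> \<cdot> j)) \<cdot> s)"
    unfolding ts using LA_Comp[of "\<rho> \<cdot> j" R S a1 W] LA_Comp[of a1 S W a Q'] by simp
  also have "\<dots> = Zer D P (L Q')" unfolding tri_comp1[OF tW] by (simp add: LA_Zer)
  finally show ?case using Q' u(1) q' by blast
qed

text \<open>The unit is the universal map from \<open>B\<close> to an object of \<open>Y\<close>, so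
  it alone tests vanishing against all of \<open>Y\<close>.\<close>

lemma kills_iff_unit:
  assumes f: "f \<in> homs D A B"
  shows "(\<forall>X \<in> Y. kills D f X) \<longleftrightarrow> \<eta> B \<cdot> f = Zer D A (L B)"
proof
  note O [simp] = homs_Obj[OF f]
  assume "\<forall>X \<in> Y. kills D f X"
  then show "\<eta> B \<cdot> f = Zer D A (L B)" using L_Y[OF O(2)] f by (simp add: kills_def)
next
  note O [simp] = homs_Obj[OF f]
  assume z: "\<eta> B \<cdot> f = Zer D A (L B)"
  show "\<forall>X \<in> Y. kills D f X"
    unfolding kills_def
  proof (intro ballI)
    fix X g assume X: "X \<in> Y" and g: "g \<in> homs D (Cod D f) X"
    have XO: "X \<in> Obj D" using homs_Obj[OF g] by simp
    have "g \<in> homs D B X" using f g by simp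
    then obtain v where v: "v \<in> homs D (L B) X" "v \<cdot> \<eta> B = g" by (rule unit_factor[OF X])
    have "g \<cdot> f = v \<cdot> (\<eta> B \<cdot> f)" using v f by auto
    then show "g \<cdot> f = Zer D (Dom D f) X" unfolding z using v(1) f XO by simp
  qed
qed

lemma trans_unit:
  assumes b: "\<And>n. b n \<in> homs D (B n) (B (Suc n))"
  shows "transition (\<lambda>n. L (B n)) (\<lambda>n. LA (b n)) n d \<cdot> \<eta> (B n) = \<eta> (B (n + d)) \<cdot> transition B b n d"
proof (induction d)
  case 0
  then show ?case using homs_Obj(1)[OF b[of n]] by simp
next
  case (Suc d)
  have BO [simp]: "B n \<in> Obj D" for n using homs_Obj(1)[OF b] .
  note [simp] = homsD[OF b]
  have tr [simp]: "transition B b n d \<in> Arr D" "Dom D (transition B b n d) = B n" "Cod D (transition B b n d) = B (n + d)"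
    using trans_homs[of b B n d, OF b BO] by auto
  have LB: "LA (b n) \<in> homs D (L (B n)) (L (B (Suc n)))" "L (B n) \<in> Obj D" for n by simp_all
  have [simp]: "transition (\<lambda>n. L (B n)) (\<lambda>n. LA (b n)) n d \<in> Arr D"
    "Dom D (transition (\<lambda>n. L (B n)) (\<lambda>n. LA (b n)) n d) = L (B n)"
    "Cod D (transition (\<lambda>n. L (B n)) (\<lambda>n. LA (b n)) n d) = L (B (n + d))"
    using trans_homs[of "\<lambda>n. LA (b n)" "\<lambda>n. L (B n)" n d, OF LB] by auto
  have "transition (\<lambda>n. L (B n)) (\<lambda>n. LA (b n)) n (Suc d) \<cdot> \<eta> (B n) =
      LA (b (n + d)) \<cdot> (transition (\<lambda>n. L (B n)) (\<lambda>n. LA (b n)) n d \<cdot> \<eta> (B n))" by simp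
  also have "\<dots> = (LA (b (n + d)) \<cdot> \<eta> (B (n + d))) \<cdot> transition B b n d" unfolding Suc by simp
  also have "\<dots> = \<eta> (B (n + Suc d)) \<cdot> transition B b n (Suc d)" unfolding LA_unit[OF b] by simp
  finally show ?case .
qed

text \<open>Compare \<open>M\<close>, the homotopy colimit of a Brown tower of compact generators, with the homotopy
  colimit of the reflections: \<open>a\<close> becomes zero there, hence already in some \<open>L (B m)\<close>.\<close>

theorem compact_factorization:
  assumes gen: "generating \<G>" and \<Q>: "thick_over \<G> \<Q>" and P: "compact_object \<kappa> D P"
    and a: "a \<in> homs D P M" and kill: "\<forall>X \<in> Y. kills D a X"
  obtains Q r q where "Q \<in> \<Q>" "r \<in> homs D P Q" "q \<in> homs D Q M" "q \<cdot> r = a" "\<forall>X \<in> Y. kills D r X"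
proof -
  have O [simp]: "P \<in> Obj D" "M \<in> Obj D" using homs_Obj[OF a] by auto
  note [simp] = homsD[OF a]
  have rP: "rcompact (Obj D) P" using P compact_iff by simp
  note st = shift_stable_Obj and locO = localizing_Obj
  have G: "|\<G>| <o \<kappa>" "shift_stable \<G>" "\<G> \<subseteq> Obj D"
    using gen by (auto simp: generating_def shift_stable_def)
  obtain B b \<beta> where tw: "tower \<G> M B b \<beta>" by (rule tower_exists[OF G(1,2) O(2)])
  obtain H j \<alpha> where hc: "hocolim B b H j" and \<alpha>: "\<alpha> \<in> homs D H M" "\<And>n. \<alpha> \<cdot> j n = \<beta> n"
    by (rule tower_hocolim[OF locO G(3) tw]) blast
  obtain W \<gamma> \<delta> where t: "tri H M W \<alpha> \<gamma> \<delta>" by (rule cone_exists[OF \<alpha>(1)])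
  note [simp] = triD[OF t]
  note bH = hocolim_legs[OF hc]
  have BO [simp]: "B n \<in> Obj D" for n using homs_Obj(1)[OF bH(1)] .
  note [simp] = homsD[OF bH(1)] homsD[OF bH(3)]
  \<comment> \<open>The generators are compact, so \<open>tower_cone_zero\<close> applies with
    \<open>r\<close> an identity. Hence \<open>W\<close> receives no non-zero maps from them, and
    \<open>\<alpha>\<close> is invertible.\<close>
  have "is_zero_object D W"
  proof -
    have "homs D G W = {Zer D G W}" if GG: "G \<in> \<G>" for G
    proof (rule homs_eq_ZerI)
      show GO: "G \<in> Obj D" "W \<in> Obj D" using GG G(3) by auto
      have rG: "rcompact (Obj D) G" using GG gen compact_iff by (simp add: generating_def)
      fix w assume w: "w \<in> homs D G W"
      have "w \<cdot> Ident D G = Zer D G W"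
        by (rule tower_cone_zero[OF st G(2) tw BO hc \<alpha> t rG GG Ident_homs[OF GO(1)] w])
      then show "w = Zer D G W" using w by simp
    qed
    then show ?thesis using gen by (simp add: generating_def)
  qed
  then obtain s where s: "s \<in> homs D M H" "\<alpha> \<cdot> s = Ident D M" by (rule zero_cone_iso[OF t])
  note [simp] = homsD[OF s(1)]
  have sa: "s \<cdot> a \<in> homs D P H" by simp
  obtain n v where v: "v \<in> homs D P (B n)" "j n \<cdot> v = s \<cdot> a"
    by (rule hocolim_factor[OF hc st BO rP sa])
  note [simp] = homsD[OF v(1)]
  have LBY: "L (B n) \<in> Y" for n using L_Y by simp
  have LBO: "L (B n) \<in> Obj D" for n by simp
  have Lb: "LA (b n) \<in> homs D (L (B n)) (L (B (Suc n)))" for n by simp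
  obtain H' j' where hc': "hocolim (\<lambda>n. L (B n)) (\<lambda>n. LA (b n)) H' j'" and H'Y: "H' \<in> Y"
    by (rule hocolim_exists[of Y "\<lambda>n. L (B n)" "\<lambda>n. LA (b n)", OF Y LBY Lb])
  have j' [simp]: "j' n \<in> Arr D" "Dom D (j' n) = L (B n)" "Cod D (j' n) = H'" for n
    using hocolim_legs(1)[OF hc', of n] by auto
  have u: "j' n \<cdot> \<eta> (B n) \<in> homs D (B n) H'" for n by simp
  have ub: "j' (Suc n) \<cdot> \<eta> (B (Suc n)) \<cdot> b n = j' n \<cdot> \<eta> (B n)" for n
  proof -
    have "j' (Suc n) \<cdot> \<eta> (B (Suc n)) \<cdot> b n = (j' (Suc n) \<cdot> LA (b n)) \<cdot> \<eta> (B n)"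
      using LA_unit[OF bH(3), of n] by simp
    then show ?thesis unfolding hocolim_legs(2)[OF hc'] .
  qed
  obtain \<chi> where \<chi>: "\<chi> \<in> homs D H H'" "\<And>n. \<chi> \<cdot> j n = j' n \<cdot> \<eta> (B n)"
    by (rule hocolim_desc[of B b H j "\<lambda>n. j' n \<cdot> \<eta> (B n)", OF hc u ub]) blast
  note [simp] = homsD[OF \<chi>(1)]
  \<comment> \<open>\<open>H'\<close> lies in \<open>Y\<close> as a homotopy colimit of objects of
    \<open>Y\<close>, so \<open>kill\<close> applies to the map \<open>\<chi> s\<close>.\<close>
  have "j' n \<cdot> (\<eta> (B n) \<cdot> v) = (\<chi> \<cdot> j n) \<cdot> v" unfolding \<chi>(2) by simp
  also have "\<dots> = \<chi> \<cdot> (s \<cdot> a)" using v(2) by simp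
  also have "\<dots> = (\<chi> \<cdot> s) \<cdot> a" by simp
  also have "\<dots> = Zer D P H'" using kill H'Y unfolding kills_def by simp
  finally have "j' n \<cdot> (\<eta> (B n) \<cdot> v) = Zer D P H'" .
  moreover have "\<eta> (B n) \<cdot> v \<in> homs D P (L (B n))" by simp
  ultimately obtain d where d: "transition (\<lambda>n. L (B n)) (\<lambda>n. LA (b n)) n d \<cdot> (\<eta> (B n) \<cdot> v) = Zer D P (L (B (n + d)))"
    using hocolim_kill[OF hc' st LBO rP] by blast
  define q where "q = transition B b n d \<cdot> v"
  have tr [simp]: "transition B b n d \<in> Arr D" "Dom D (transition B b n d) = B n" "Cod D (transition B b n d) = B (n + d)"
    using trans_homs[of b B n d, OF bH(3) BO] by auto
  have [simp]: "transition (\<lambda>n. L (B n)) (\<lambda>n. LA (b n)) n d \<in> Arr D"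
    "Dom D (transition (\<lambda>n. L (B n)) (\<lambda>n. LA (b n)) n d) = L (B n)"
    "Cod D (transition (\<lambda>n. L (B n)) (\<lambda>n. LA (b n)) n d) = L (B (n + d))"
    using trans_homs[of "\<lambda>n. LA (b n)" "\<lambda>n. L (B n)" n d, OF Lb LBO] by auto
  have q: "q \<in> homs D P (B (n + d))" by (simp add: q_def)
  \<comment> \<open>The unit of \<open>P\<close> serves as the element \<open>x\<close> of
    \<open>D(P, L P)\<close>: \<open>LA q\<close> kills it because the unit of
    \<open>B (n + d)\<close> kills \<open>q\<close>.\<close>
  have "LA q \<cdot> \<eta> P = \<eta> (B (n + d)) \<cdot> q" by (rule LA_unit[OF q])
  also have "\<dots> = (\<eta> (B (n + d)) \<cdot> transition B b n d) \<cdot> v" by (simp add: q_def)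
  also have "\<dots> = Zer D P (L (B (n + d)))" unfolding trans_unit[of b B, OF bH(3), symmetric] using d by simp
  finally obtain Q r q' where Q: "Q \<in> \<Q>" and r: "r \<in> homs D P Q" and q': "q' \<in> homs D Q (B (n + d))"
      "q' \<cdot> r = q" and Lr: "LA r \<cdot> \<eta> P = Zer D P (L Q)"
    using tower_compact_factor[OF P \<Q> tw P q unit[OF O(1)]] by blast
  note [simp] = homsD[OF r] homsD[OF q'(1)]
  have "a = (\<alpha> \<cdot> s) \<cdot> a" unfolding s(2) by simp
  also have "\<dots> = \<alpha> \<cdot> (j n \<cdot> v)" unfolding v(2) by simp
  also have "\<dots> = \<alpha> \<cdot> ((j (n + d) \<cdot> transition B b n d) \<cdot> v)" unfolding leg_trans[OF hc] ..
  also have "\<dots> = (\<alpha> \<cdot> j (n + d)) \<cdot> q" by (simp add: q_def)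
  also have "\<dots> = (\<alpha> \<cdot> j (n + d) \<cdot> q') \<cdot> r" unfolding q'(2)[symmetric] by simp
  finally have "\<alpha> \<cdot> j (n + d) \<cdot> q' \<cdot> r = a" ..
  moreover have "\<forall>X \<in> Y. kills D r X" using kills_iff_unit[OF r] Lr LA_unit[OF r] by simp
  moreover have "\<alpha> \<cdot> j (n + d) \<cdot> q' \<in> homs D Q M" by simp
  ultimately show ?thesis using that Q r by blast
qed

end

section \<open>Small generating sets\<close>

context cocomplete_triangulated_category
begin

lemma obj_shift_minus_1:
  assumes "X \<in> Obj D" shows "obj_shift D (- 1) X \<in> Obj D" "ShO D (obj_shift D (- 1) X) = X"
proof -
  have "X \<in> ShO D ` Obj D" using assms ShO_bij by (simp add: bij_betw_def)
  then show "obj_shift D (- 1) X \<in> Obj D" "ShO D (obj_shift D (- 1) X) = X"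
    by (simp_all add: obj_shift_def inv_into_into f_inv_into_f)
qed

lemma obj_shift_Suc:
  assumes X: "X \<in> Obj D"
  shows "obj_shift D n X \<in> Obj D \<and> ShO D (obj_shift D n X) = obj_shift D (n + 1) X"
proof -
  let ?U = "inv_into (Obj D) (ShO D)"
  have U: "?U A \<in> Obj D" "ShO D (?U A) = A" if "A \<in> Obj D" for A
    using obj_shift_minus_1[OF that] by (simp_all add: obj_shift_def)
  have UO: "(?U ^^ k) X \<in> Obj D" for k by (induction k) (use X U in auto)
  have SO: "(ShO D ^^ k) X \<in> Obj D" for k by (induction k) (use X in auto)
  show ?thesis
  proof (cases "0 \<le> n")
    case True
    then have "nat (n + 1) = Suc (nat n)" by simp
    then show ?thesis using True SO by (simp add: obj_shift_def)
  next
    case False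
    define k where "k = nat (- n) - 1"
    have k: "nat (- n) = Suc k" "nat (- (n + 1)) = k" using False by (auto simp: k_def)
    have "obj_shift D (n + 1) X = (?U ^^ k) X"
    proof (cases "n + 1 = 0")
      case True then show ?thesis using k by (simp add: obj_shift_def)
    next
      case False': False
      then have "\<not> 0 \<le> n + 1" using False by simp
      then show ?thesis unfolding obj_shift_def using k by (simp del: minus_add_distrib)
    qed
    then show ?thesis using False k UO U(2)[OF UO] UO[of "Suc k"] by (simp add: obj_shift_def)
  qed
qed

definition shift_closure :: "'o set \<Rightarrow> 'o set" where
  "shift_closure \<P> = (\<Union>P \<in> \<P>. range (\<lambda>n. obj_shift D n P))"

lemma shift_closure_superset: "\<P> \<subseteq> shift_closure \<P>"
proof
  fix P assume "P \<in> \<P>"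
  moreover have "P = obj_shift D 0 P" by (simp add: obj_shift_def)
  ultimately show "P \<in> shift_closure \<P>" unfolding shift_closure_def by blast
qed

lemma shift_closure_stable:
  assumes P: "\<P> \<subseteq> Obj D" shows "shift_stable (shift_closure \<P>)"
  unfolding shift_stable_def
proof (intro conjI ballI iffI subsetI)
  show "X \<in> Obj D" if "X \<in> shift_closure \<P>" for X
    using that P obj_shift_Suc unfolding shift_closure_def by blast
  fix X assume X: "X \<in> Obj D"
  show "ShO D X \<in> shift_closure \<P>" if "X \<in> shift_closure \<P>"
  proof -
    obtain Q n where "Q \<in> \<P>" "X = obj_shift D n Q" using \<open>X \<in> shift_closure \<P>\<close> by (auto simp: shift_closure_def)
    then have "ShO D X = obj_shift D (n + 1) Q" using obj_shift_Suc P by auto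
    then show ?thesis using \<open>Q \<in> \<P>\<close> unfolding shift_closure_def by blast
  qed
  show "X \<in> shift_closure \<P>" if "ShO D X \<in> shift_closure \<P>"
  proof -
    obtain Q n where Q: "Q \<in> \<P>" "ShO D X = obj_shift D n Q"
      using \<open>ShO D X \<in> shift_closure \<P>\<close> by (auto simp: shift_closure_def)
    then have "ShO D X = ShO D (obj_shift D (n - 1) Q)" using obj_shift_Suc[of Q "n - 1"] P by auto
    then have "X = obj_shift D (n - 1) Q" using ShO_eq_iff X obj_shift_Suc[of Q "n - 1"] P Q(1) by blast
    then show ?thesis using Q(1) unfolding shift_closure_def by blast
  qed
qed

lemma shift_closure_small:
  assumes "|\<P>| <o \<kappa>" shows "|shift_closure \<P>| <o \<kappa>"
  unfolding shift_closure_def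
  by (rule small_UN[OF inaccessible assms]) (rule small_countable[OF inaccessible], simp)

lemma shift_closure_induct:
  assumes X: "X \<in> shift_closure \<P>" and P: "\<P> \<subseteq> Obj D" and base: "\<And>X. X \<in> \<P> \<Longrightarrow> R X"
    and step: "\<And>X. X \<in> Obj D \<Longrightarrow> R (ShO D X) \<longleftrightarrow> R X"
  shows "R X"
proof -
  obtain Q n where Q: "Q \<in> \<P>" "X = obj_shift D n Q" using X by (auto simp: shift_closure_def)
  have QO: "Q \<in> Obj D" using Q P by blast
  have "R (obj_shift D n Q)"
  proof (induction n rule: int_induct[where k = 0])
    case base then show ?case using assms(3)[OF Q(1)] by (simp add: obj_shift_def)
  next
    case (step1 i)
    then show ?case using assms(4)[of "obj_shift D i Q"] obj_shift_Suc[OF QO, of i] by simp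
  next
    case (step2 i)
    then show ?case using assms(4)[of "obj_shift D (i - 1) Q"] obj_shift_Suc[OF QO, of "i - 1"] by simp
  qed
  then show ?thesis using Q by simp
qed

lemma generating_exists:
  assumes "compactly_generated \<kappa> D" obtains \<G> where "generating \<G>"
proof -
  obtain \<P> where P: "|\<P>| <o \<kappa>" "\<And>P. P \<in> \<P> \<Longrightarrow> compact_object \<kappa> D P"
    and gen: "\<And>M. M \<in> Obj D \<Longrightarrow> \<forall>P \<in> \<P>. \<forall>n. homs D (obj_shift D n P) M = {Zer D (obj_shift D n P) M} \<Longrightarrow>
      is_zero_object D M"
    using assms unfolding compactly_generated_def by metis
  have PO: "\<P> \<subseteq> Obj D" using P(2) by (auto simp: compact_object_def)
  have "generating (shift_closure \<P>)"
    unfolding generating_def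
  proof (intro conjI ballI impI)
    show "|shift_closure \<P>| <o \<kappa>" by (rule shift_closure_small[OF P(1)])
    show "shift_stable (shift_closure \<P>)" by (rule shift_closure_stable[OF PO])
    show "compact_object \<kappa> D G" if "G \<in> shift_closure \<P>" for G
      by (rule shift_closure_induct[OF that PO, of "compact_object \<kappa> D"])
        (simp_all add: P(2), simp add: compact_iff rcompact_shift[OF shift_stable_Obj])
    show "is_zero_object D M" if "M \<in> Obj D" "\<forall>G \<in> shift_closure \<P>. homs D G M = {Zer D G M}" for M
      using gen that unfolding shift_closure_def by blast
  qed
  then show ?thesis by (rule that)
qed

text \<open>One cone per map and one biproduct per pair are adjoined, countably often; single chosen
  representatives and local smallness keep each stage small. Any two objects of the union share a
  stage, so the union is closed.\<close>

lemma small_thick_over: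
  assumes G: "|\<G>| <o \<kappa>" "\<And>G. G \<in> \<G> \<Longrightarrow> compact_object \<kappa> D G"
  obtains \<Q> where "thick_over \<G> \<Q>" "|\<Q>| <o \<kappa>"
proof -
  obtain Z where Z: "is_zero_object D Z" "Z \<in> Obj D" by (rule zero_obtain)
  have "\<exists>B'. \<exists>g h. tri (Dom D f) (Cod D f) B' f g h" if "f \<in> Arr D" for f
    using cone_exists[of f "Dom D f" "Cod D f"] that by (metis mem_homs)
  then obtain cn where cn: "\<And>f. f \<in> Arr D \<Longrightarrow> \<exists>g h. tri (Dom D f) (Cod D f) (cn f) f g h" by metis
  obtain bp where bp: "\<And>A B. A \<in> Obj D \<Longrightarrow> B \<in> Obj D \<Longrightarrow> \<exists>i j p q. is_biproduct D A B (bp A B) i j p q"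
    using biproduct by metis
  define F where "F \<X> = \<X> \<union> cn ` (\<Union>A\<in>\<X>. \<Union>B\<in>\<X>. homs D A B) \<union> (\<lambda>(A, B). bp A B) ` (\<X> \<times> \<X>)" for \<X>
  define St where "St n = (F ^^ n) (insert Z \<G>)" for n
  have St: "St 0 = insert Z \<G>" "\<And>n. St (Suc n) = F (St n)" by (simp_all add: St_def)
  have St_c: "Q \<in> St n \<Longrightarrow> compact_object \<kappa> D Q" for n Q
  proof (induction n arbitrary: Q)
    case 0 then show ?case using G(2) rcompact_zero[OF Z(1)] by (auto simp: St compact_iff)
  next
    case (Suc n)
    consider "Q \<in> St n" | f where "f \<in> Arr D" "Dom D f \<in> St n" "Cod D f \<in> St n" "Q = cn f"
      | A B where "A \<in> St n" "B \<in> St n" "Q = bp A B"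
      using Suc.prems unfolding St F_def by auto
    then show ?case
    proof cases
      case 1 then show ?thesis by (rule Suc.IH)
    next
      case 2
      obtain g h where "tri (Dom D f) (Cod D f) (cn f) f g h" using cn[OF 2(1)] by blast
      then show ?thesis
        using rcompact_cone[OF shift_stable_Obj] Suc.IH[OF 2(2)] Suc.IH[OF 2(3)] 2(4)
        unfolding compact_iff by blast
    next
      case 3
      have "A \<in> Obj D" "B \<in> Obj D" using Suc.IH 3(1,2) by (auto simp: compact_object_def)
      then obtain i j p q where "is_biproduct D A B (bp A B) i j p q" using bp by blast
      then show ?thesis using rcompact_biproduct Suc.IH[OF 3(1)] Suc.IH[OF 3(2)] 3(3)
        unfolding compact_iff by blast
    qed
  qed
  have St_O: "St n \<subseteq> Obj D" for n using St_c by (auto simp: compact_object_def)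
  have St_small: "|St n| <o \<kappa>" for n
  proof (induction n)
    case 0
    have "|insert Z \<G>| <o \<kappa>"
      using small_Un[OF inaccessible small_countable[OF inaccessible, of "{Z}"] G(1)] by simp
    then show ?case by (simp add: St)
  next
    case (Suc n)
    have "|\<Union>A\<in>St n. \<Union>B\<in>St n. homs D A B| <o \<kappa>"
      using locally_small St_O[of n] unfolding locally_small_def
      by (intro small_UN[OF inaccessible Suc]) blast
    from small_image[OF this] have 1: "|cn ` (\<Union>A\<in>St n. \<Union>B\<in>St n. homs D A B)| <o \<kappa>" .
    have 2: "|(\<lambda>(A, B). bp A B) ` (St n \<times> St n)| <o \<kappa>"
      by (rule small_image[OF small_Times[OF inaccessible Suc Suc]])
    show ?case unfolding St F_def
      by (rule small_Un[OF inaccessible small_Un[OF inaccessible Suc 1] 2])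
  qed
  have "St n \<subseteq> St (Suc n)" for n by (auto simp: St F_def)
  then have mono: "m \<le> n \<Longrightarrow> St m \<subseteq> St n" for m n using lift_Suc_mono_le[of St] by blast
  have common: "\<exists>n. A \<in> St n \<and> B \<in> St n" if AB: "A \<in> (\<Union>n. St n)" "B \<in> (\<Union>n. St n)" for A B
  proof -
    obtain m n where "A \<in> St m" "B \<in> St n" using AB by blast
    then have "A \<in> St (max m n)" "B \<in> St (max m n)" using mono[of m "max m n"] mono[of n "max m n"] by auto
    then show ?thesis by blast
  qed
  have "thick_over \<G> (\<Union>n. St n)"
    unfolding thick_over_def
  proof (intro conjI ballI)
    show "\<G> \<subseteq> (\<Union>n. St n)" using St(1) by blast
    show "compact_object \<kappa> D Q" if "Q \<in> (\<Union>n. St n)" for Q using that St_c by blast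
    show "\<exists>Z \<in> (\<Union>n. St n). is_zero_object D Z" using Z St(1) by blast
    fix A B assume "A \<in> (\<Union>n. St n)" "B \<in> (\<Union>n. St n)"
    then obtain n where n: "A \<in> St n" "B \<in> St n" using common by blast
    show "\<exists>B' g h. tri A B B' f g h \<and> B' \<in> (\<Union>n. St n)" if f: "f \<in> homs D A B" for f
    proof -
      have "cn f \<in> St (Suc n)" using f n unfolding St F_def by blast
      then show ?thesis using cn[of f] f by auto
    qed
    show "\<exists>S i j p q. is_biproduct D A B S i j p q \<and> S \<in> (\<Union>n. St n)"
    proof -
      have "bp A B \<in> St (Suc n)" using n unfolding St F_def by blast
      then show ?thesis using bp[of A B] St_O n by blast
    qed
  qed
  moreover have "|\<Union>n. St n| <o \<kappa>" by (rule small_UN[OF inaccessible small_nat St_small])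
  ultimately show ?thesis by (rule that)
qed

text \<open>This is the factorization theorem for the reflection onto the zero objects.\<close>

lemma compact_retract:
  assumes gen: "generating \<G>" and \<Q>: "thick_over \<G> \<Q>" and P: "compact_object \<kappa> D P"
  obtains Q r q where "Q \<in> \<Q>" "r \<in> homs D P Q" "q \<in> homs D Q P" "q \<cdot> r = Ident D P"
proof -
  obtain Z where Z: "is_zero_object D Z" "Z \<in> Obj D" by (rule zero_obtain)
  define N where "N = {X. is_zero_object D X}"
  \<comment> \<open>Written as a left orthogonal, the class of zero objects is localizing by
    \<open>left_perp_localizing\<close>.\<close>
  have N: "N = left_perp D (Obj D)"
  proof (intro Set.set_eqI iffI)
    fix X
    show "X \<in> left_perp D (Obj D)" if "X \<in> N"
    proof (rule left_perpI)
      have X: "is_zero_object D X" using that by (simp add: N_def)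
      then show "X \<in> Obj D" by (simp add: is_zero_object_def)
      show "f = Zer D X A" if "f \<in> homs D X A" for A f by (rule zero_object_Arr_out[OF X that])
    qed simp
    show "X \<in> N" if X: "X \<in> left_perp D (Obj D)"
      using left_perpD[OF X, of X "Ident D X"] left_perp_Obj[OF X] by (simp add: N_def is_zero_object_def)
  qed
  interpret reflective_localizing D \<kappa> N "\<lambda>_. Z" "\<lambda>A. Zer D A Z"
  proof unfold_locales
    show "localizing N" unfolding N by (rule left_perp_localizing[OF shift_stable_Obj])
    show "Zer D A Z \<in> homs D A Z" if "A \<in> Obj D" for A using that Z by simp
    show "Z \<in> N" using Z by (simp add: N_def)
    fix A X u assume A: "A \<in> Obj D" and X: "X \<in> N" and u: "u \<in> homs D A X"
    have zX: "is_zero_object D X" "X \<in> Obj D" using X by (auto simp: N_def is_zero_object_def)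
    show "\<exists>!v. v \<in> homs D Z X \<and> v \<cdot> Zer D A Z = u"
      using zero_object_Arr_in[OF zX(1)] u Z A zX(2)
      by (intro ex1I[of _ "Zer D Z X"]) auto
  qed
  have PO: "P \<in> Obj D" using P by (simp add: compact_object_def)
  \<comment> \<open>Zero objects kill every map, so the factorization theorem applies to the
    identity of \<open>P\<close>.\<close>
  have "\<forall>X \<in> N. kills D (Ident D P) X"
    using PO zero_object_Arr_in[of _ _ P] by (auto simp: kills_def N_def)
  then show ?thesis
    using compact_factorization[OF gen \<Q> P Ident_homs[OF PO]] that by metis
qed

end

section \<open>Orthogonal pairs and t-structures\<close>

context cocomplete_triangulated_category
begin

lemma shift_stable_image: "shift_stable N \<Longrightarrow> ShO D ` N = N"
proof (intro equalityI subsetI)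
  assume N: "shift_stable N"
  show "X \<in> N" if "X \<in> ShO D ` N" for X using that shift_stableD(2)[OF N] by blast
  show "X \<in> ShO D ` N" if X: "X \<in> N" for X
  proof -
    obtain X' where X': "X' \<in> Obj D" "ShO D X' = X" by (rule unshift_Obj[OF shift_stableD(1)[OF N X]])
    then have "X' \<in> N" using shift_stableD(3)[OF N] X by blast
    then show ?thesis using X' by blast
  qed
qed

lemma obj_shift_minus_1_mem:
  assumes N: "shift_stable N" and X: "X \<in> N" shows "obj_shift D (- 1) X \<in> N"
  using obj_shift_minus_1[OF shift_stableD(1)[OF N X]] shift_stableD(3)[OF N] X by simp

lemma right_perp_shift_stable:
  assumes W: "shift_stable W" shows "shift_stable (right_perp D W)"
  unfolding shift_stable_def
proof (intro conjI ballI iffI)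
  have WO: "W \<subseteq> Obj D" using W by (simp add: shift_stable_def)
  show "right_perp D W \<subseteq> Obj D" by (auto simp: right_perp_def)
  fix X assume X: "X \<in> Obj D"
  show "X \<in> right_perp D W" if S: "ShO D X \<in> right_perp D W"
  proof (rule right_perpI[OF X WO])
    fix A f assume A: "A \<in> W" and f: "f \<in> homs D A X"
    have "ShA D f = Zer D (ShO D A) (ShO D X)"
      using right_perpD[OF S shift_stableD(2)[OF W A], of "ShA D f"] f by simp
    then have "ShA D f = ShA D (Zer D A X)" using f by auto
    then show "f = Zer D A X" using f by (subst (asm) ShA_eq_iff) auto
  qed
  show "ShO D X \<in> right_perp D W" if S: "X \<in> right_perp D W"
  proof (rule right_perpI[OF ShO_Obj[OF X] WO])
    fix A f assume A: "A \<in> W" and f: "f \<in> homs D A (ShO D X)"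
    obtain A' where A': "A' \<in> Obj D" "ShO D A' = A" using unshift_Obj A WO by blast
    have "f \<in> homs D (ShO D A') (ShO D X)" using f A' by simp
    then obtain f' where f': "f' \<in> homs D A' X" "ShA D f' = f" using unshift_homs X A' by blast
    have "f' = Zer D A' X" using right_perpD[OF S _ f'(1)] shift_stableD(3)[OF W A'(1)] A A' by simp
    then show "f = Zer D A (ShO D X)" using f' A' X by auto
  qed
qed

lemma is_isoE:
  assumes "is_iso D f"
  obtains g where "f \<in> Arr D" "g \<in> homs D (Cod D f) (Dom D f)" "g \<cdot> f = Ident D (Dom D f)"
    "f \<cdot> g = Ident D (Cod D f)"
  using assms unfolding is_iso_def by blast

text \<open>\<open>B\<close> is a cone of \<open>F \<rightarrow> A\<close>; after rotating back,
  \<open>A\<close> is a cone of a map from the desuspension of \<open>B\<close> to \<open>F\<close>.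
  Closure under cones thus gives both directions.\<close>

lemma localizing_iso:
  assumes N: "localizing N" and t: "tri F A B k f h" and F: "is_zero_object D F"
  shows "A \<in> N \<Longrightarrow> B \<in> N" "B \<in> N \<Longrightarrow> A \<in> N"
proof -
  have FN: "F \<in> N" by (rule localizingD(2)[OF N F])
  show "A \<in> N \<Longrightarrow> B \<in> N" using localizingD(3)[OF N t FN] by blast
  obtain X d where X: "tri X F A d k f" "ShO D X = B" by (rule tri_rotate_back[OF t])
  show "B \<in> N \<Longrightarrow> A \<in> N"
    using localizingD(3)[OF N X(1) _ FN] shift_stableD(3)[OF localizingD(1)[OF N] triD(10)[OF X(1)]] X(2)
    by blast
qed

text \<open>Cancelling the invertible \<open>f\<close> in the composites of its fibre triangle shows
  that \<open>k\<close> and \<open>h\<close> vanish. Then the identity of \<open>F[1]\<close> lifts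
  along \<open>h\<close>, hence is zero, and \<open>localizing_iso\<close> applies.\<close>

lemma localizing_strictly_full:
  assumes N: "localizing N" shows "strictly_full D N"
  unfolding strictly_full_def
proof (intro conjI allI impI)
  show "N \<subseteq> Obj D" using localizingD(1)[OF N] by (simp add: shift_stable_def)
  fix f assume iso: "is_iso D f" and A_N: "Dom D f \<in> N"
  obtain g where f [simp]: "f \<in> Arr D" and g: "g \<in> homs D (Cod D f) (Dom D f)"
      and gf: "g \<cdot> f = Ident D (Dom D f)" and fg: "f \<cdot> g = Ident D (Cod D f)"
    by (rule is_isoE[OF iso])
  define A B where "A = Dom D f" and "B = Cod D f"
  have "f \<in> homs D A B" by (simp add: A_def B_def)
  then obtain F k h where t: "tri F A B k f h" by (rule fibre_exists)
  note [simp] = triD[OF t]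
  have g': "g \<in> homs D B A" "g \<cdot> f = Ident D A" "f \<cdot> g = Ident D B" using g gf fg by simp_all
  have "k = (g \<cdot> f) \<cdot> k" unfolding g'(2) by simp
  also have "\<dots> = g \<cdot> (f \<cdot> k)" using g'(1) by simp
  finally have k0: "k = Zer D F A" unfolding tri_comp1[OF t] using g'(1) by simp
  have "h = h \<cdot> (f \<cdot> g)" unfolding g'(3) by simp
  also have "\<dots> = (h \<cdot> f) \<cdot> g" using g'(1) by simp
  finally have h0: "h = Zer D B (ShO D F)" unfolding tri_comp2[OF t] using g'(1) by simp
  have "ShA D k \<cdot> Ident D (ShO D F) = Zer D (ShO D F) (ShO D A)" using k0 by simp
  then obtain v where v: "v \<in> homs D (ShO D F) B" "h \<cdot> v = Ident D (ShO D F)"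
    using weak_kernel3[OF t, of "Ident D (ShO D F)" "ShO D F"] by auto
  have "h \<cdot> v = Zer D (ShO D F) (ShO D F)" unfolding h0 using v(1) by simp
  then have "is_zero_object D F"
    using zero_object_shift[of F] v(2) by (simp add: is_zero_object_def)
  moreover have "A \<in> N" using A_N unfolding A_def .
  ultimately show "Cod D f \<in> N" using localizing_iso(1)[OF N t] unfolding B_def by blast
qed

lemma right_perp_strictly_full:
  assumes WO: "W \<subseteq> Obj D" shows "strictly_full D (right_perp D W)"
  unfolding strictly_full_def
proof (intro conjI allI impI)
  show "right_perp D W \<subseteq> Obj D" by (auto simp: right_perp_def)
  fix f assume iso: "is_iso D f" and A: "Dom D f \<in> right_perp D W"
  obtain g where f [simp]: "f \<in> Arr D" and g: "g \<in> homs D (Cod D f) (Dom D f)"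
      and "g \<cdot> f = Ident D (Dom D f)" and fg: "f \<cdot> g = Ident D (Cod D f)"
    by (rule is_isoE[OF iso])
  show "Cod D f \<in> right_perp D W"
  proof (rule right_perpI[OF _ WO])
    show "Cod D f \<in> Obj D" by simp
    fix X u assume X: "X \<in> W" and u: "u \<in> homs D X (Cod D f)"
    have XO: "X \<in> Obj D" using X WO by blast
    have "u = (f \<cdot> g) \<cdot> u" unfolding fg using u by simp
    also have "\<dots> = f \<cdot> (g \<cdot> u)" using u g by simp
    also have "g \<cdot> u = Zer D X (Dom D f)" using right_perpD[OF A X, of "g \<cdot> u"] g u by simp
    finally show "u = Zer D X (Cod D f)" using XO by simp
  qed
qed

text \<open>For \<open>M\<close> left orthogonal to \<open>V\<close> the map
  \<open>M \<rightarrow> Y\<close> is zero, so the identity of \<open>Y\<close> factors through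
  \<open>X[1]\<close>, which lies in \<open>U\<close>; thus \<open>Y\<close> is zero and
  \<open>M\<close> is isomorphic to \<open>X\<close>. The dual argument uses that the desuspension
  of \<open>Y\<close> lies in \<open>V\<close>.\<close>

lemma orthogonal_pair:
  assumes U: "strictly_full D U" "ShO D ` U \<subseteq> U" and V: "strictly_full D V" "obj_shift D (- 1) ` V \<subseteq> V"
    and orth: "\<forall>X \<in> U. \<forall>Y \<in> V. homs D X Y = {Zer D X Y}"
    and tr: "\<forall>M \<in> Obj D. \<exists>f g h. (f, g, h) \<in> Tri D \<and> Dom D f \<in> U \<and> Cod D f = M \<and> Cod D g \<in> V"
  shows "U = left_perp D V" "V = right_perp D U"
proof -
  have UO: "U \<subseteq> Obj D" and VO: "V \<subseteq> Obj D" using U V by (auto simp: strictly_full_def)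
  have orth0: "u = Zer D X Y" if "X \<in> U" "Y \<in> V" "u \<in> homs D X Y" for X Y u
    using orth that by blast
  have tri: "\<exists>X Y f g h. tri X M Y f g h \<and> X \<in> U \<and> Y \<in> V" if M: "M \<in> Obj D" for M
  proof -
    obtain f g h where f: "(f, g, h) \<in> Tri D" "Dom D f \<in> U" "Cod D f = M" "Cod D g \<in> V"
      using tr M by blast
    have "tri (Dom D f) M (Cod D g) f g h" using triI[OF f(1)] f(3) by simp
    then show ?thesis using f by blast
  qed
  show "U = left_perp D V"
  proof (intro equalityI subsetI)
    show "X \<in> left_perp D V" if "X \<in> U" for X using that UO orth by (auto simp: left_perp_def)
    fix M assume M: "M \<in> left_perp D V"
    obtain X Y f g h where t: "tri X M Y f g h" and X: "X \<in> U" and Y: "Y \<in> V"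
      using tri left_perp_Obj[OF M] by blast
    note [simp] = triD[OF t]
    have "g = Zer D M Y" using left_perpD[OF M Y] by simp
    then have "Ident D Y \<cdot> g = Zer D M Y" by simp
    then obtain v where v: "v \<in> homs D (ShO D X) Y" "v \<cdot> h = Ident D Y"
      using weak_cokernel2[OF t, of "Ident D Y" Y] by auto
    have "v = Zer D (ShO D X) Y" using orth0[OF _ Y v(1)] U(2) X by blast
    then have "is_zero_object D Y" using v(2) by (simp add: is_zero_object_def)
    then obtain s where "s \<in> homs D M X" "f \<cdot> s = Ident D M" "s \<cdot> f = Ident D X"
      by (rule zero_cone_iso[OF t])
    then have "is_iso D f" using is_isoI[of f X M s] by simp
    then show "M \<in> U" using U(1) X unfolding strictly_full_def by fastforce
  qed
  show "V = right_perp D U"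
  proof (intro equalityI subsetI)
    show "Y \<in> right_perp D U" if "Y \<in> V" for Y using that VO orth by (auto simp: right_perp_def)
    fix M assume M: "M \<in> right_perp D U"
    obtain X Y f g h where t: "tri X M Y f g h" and X: "X \<in> U" and Y: "Y \<in> V"
      using tri right_perp_Obj[OF M] by blast
    note [simp] = triD[OF t]
    obtain F k where F: "tri F X M k f g" "ShO D F = Y" by (rule tri_rotate_back[OF t])
    note [simp] = triD[OF F(1)]
    have "ShO D (obj_shift D (- 1) Y) = ShO D F" using F(2) obj_shift_minus_1[of Y] by simp
    then have "obj_shift D (- 1) Y = F" using ShO_eq_iff obj_shift_minus_1[of Y] by simp
    then have FV: "F \<in> V" using V(2) Y by blast
    have "f = Zer D X M" using right_perpD[OF M X] by simp
    then have "f \<cdot> Ident D X = Zer D X M" by simp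
    then obtain v where v: "v \<in> homs D X F" "k \<cdot> v = Ident D X"
      using weak_kernel[OF F(1), of "Ident D X" X] by auto
    have "v = Zer D X F" using orth0[OF X FV v(1)] .
    then have "is_zero_object D X" using v(2) by (simp add: is_zero_object_def)
    then have "is_zero_object D (ShO D X)" using zero_object_shift by simp
    then obtain s where "s \<in> homs D Y M" "g \<cdot> s = Ident D Y" "s \<cdot> g = Ident D M"
      by (rule zero_cone_iso[OF tri_rotate[OF t]])
    then have "is_iso D s" "Dom D s = Y" "Cod D s = M" using is_isoI[of s Y M g] by simp_all
    then show "M \<in> V" using V(1) Y unfolding strictly_full_def by fastforce
  qed
qed

text \<open>The middle class is both \<open>V[1]\<close> for the first t-structure and the aisle of
  the second. \<open>V[-1] \<subseteq> V\<close> gives \<open>V \<subseteq> \<Y>\<close>, and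
  \<open>\<Y>[1] \<subseteq> \<Y>\<close> gives the converse; so \<open>\<Y>\<close> is shift stable
  and, being a left orthogonal of a shift stable class, localizing.\<close>

lemma TTF_triple_props:
  assumes T: "(\<X>, \<Y>, \<Z>) \<in> TTF_triples D"
  shows "\<X> = left_perp D \<Y>" "\<Z> = right_perp D \<Y>" "localizing \<Y>"
    "M \<in> Obj D \<Longrightarrow> \<exists>X Y f g h. tri X M Y f g h \<and> X \<in> left_perp D \<Y> \<and> Y \<in> \<Y>"
proof -
  have t1: "t_structure D \<X> \<Y>" and t2: "t_structure D \<Y> \<Z>" using T by (auto simp: TTF_triples_def)
  obtain V where V: "\<Y> = ShO D ` V" "strictly_full D \<X>" "strictly_full D V"
      "\<forall>X \<in> \<X>. \<forall>Y \<in> V. homs D X Y = {Zer D X Y}" "ShO D ` \<X> \<subseteq> \<X>" "obj_shift D (- 1) ` V \<subseteq> V"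
      "\<forall>M \<in> Obj D. \<exists>f g h. (f, g, h) \<in> Tri D \<and> Dom D f \<in> \<X> \<and> Cod D f = M \<and> Cod D g \<in> V"
    using t1 unfolding t_structure_def by (elim exE conjE) (rule that, assumption+)
  obtain V' where V': "\<Z> = ShO D ` V'" "strictly_full D \<Y>" "strictly_full D V'"
      "\<forall>X \<in> \<Y>. \<forall>Y \<in> V'. homs D X Y = {Zer D X Y}" "ShO D ` \<Y> \<subseteq> \<Y>" "obj_shift D (- 1) ` V' \<subseteq> V'"
      "\<forall>M \<in> Obj D. \<exists>f g h. (f, g, h) \<in> Tri D \<and> Dom D f \<in> \<Y> \<and> Cod D f = M \<and> Cod D g \<in> V'"
    using t2 unfolding t_structure_def by (elim exE conjE) (rule that, assumption+)
  have VO: "V \<subseteq> Obj D" and YO: "\<Y> \<subseteq> Obj D" using V(3) V'(2) by (auto simp: strictly_full_def)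
  have "V \<subseteq> \<Y>"
  proof
    fix v assume v: "v \<in> V"
    then have "obj_shift D (- 1) v \<in> V" "ShO D (obj_shift D (- 1) v) = v"
      using V(6) obj_shift_minus_1(2) VO by blast+
    then show "v \<in> \<Y>" using V(1) by (metis imageI)
  qed
  moreover have "\<Y> \<subseteq> V"
  proof
    fix y assume y: "y \<in> \<Y>"
    then have "ShO D y \<in> ShO D ` V" using V(1) V'(5) by blast
    then obtain v where "v \<in> V" "ShO D y = ShO D v" by blast
    then show "y \<in> V" using ShO_eq_iff[of y v] y YO VO by blast
  qed
  ultimately have VY: "V = \<Y>" by blast
  have st: "shift_stable \<Y>"
    unfolding shift_stable_def
  proof (intro conjI ballI iffI)
    show "\<Y> \<subseteq> Obj D" by (rule YO)
    fix X assume X: "X \<in> Obj D"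
    show "ShO D X \<in> \<Y>" if "X \<in> \<Y>" using that V'(5) by blast
    show "X \<in> \<Y>" if S: "ShO D X \<in> \<Y>"
    proof -
      obtain v where "v \<in> V" "ShO D X = ShO D v" using S V(1) by blast
      then show ?thesis using ShO_eq_iff[of X v] X VO VY by blast
    qed
  qed
  note p1 = orthogonal_pair[OF V(2,5,3,6,4,7)] and p2 = orthogonal_pair[OF V'(2,5,3,6,4,7)]
  show XY: "\<X> = left_perp D \<Y>" using p1(1) VY by simp
  have stV': "shift_stable V'" unfolding p2(2) by (rule right_perp_shift_stable[OF st])
  show "\<Z> = right_perp D \<Y>" using V'(1) shift_stable_image[OF stV'] p2(2) by simp
  show "localizing \<Y>" unfolding p2(1) by (rule left_perp_localizing[OF stV'])
  show "\<exists>X Y f g h. tri X M Y f g h \<and> X \<in> left_perp D \<Y> \<and> Y \<in> \<Y>" if M: "M \<in> Obj D"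
  proof -
    obtain f g h where f: "(f, g, h) \<in> Tri D" "Dom D f \<in> \<X>" "Cod D f = M" "Cod D g \<in> V"
      using V(7) M by blast
    have "tri (Dom D f) M (Cod D g) f g h" using triI[OF f(1)] f(3) by simp
    then show ?thesis using f unfolding VY XY by blast
  qed
qed

text \<open>For shift stable classes the shift in the second component of a t-structure is
  invisible.\<close>

lemma t_structureI:
  assumes U: "strictly_full D U" "shift_stable U" and V: "strictly_full D V" "shift_stable V"
    and orth: "\<And>X Y u. X \<in> U \<Longrightarrow> Y \<in> V \<Longrightarrow> u \<in> homs D X Y \<Longrightarrow> u = Zer D X Y"
    and tr: "\<And>M. M \<in> Obj D \<Longrightarrow> \<exists>X Y f g h. tri X M Y f g h \<and> X \<in> U \<and> Y \<in> V"
  shows "t_structure D U V"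
  unfolding t_structure_def
proof (intro exI[of _ V] conjI ballI)
  show "V = ShO D ` V" using shift_stable_image[OF V(2)] by simp
  show "strictly_full D U" "strictly_full D V" by fact+
  show "homs D X Y = {Zer D X Y}" if X: "X \<in> U" and Y: "Y \<in> V" for X Y
    by (rule homs_eq_ZerI[OF shift_stableD(1)[OF U(2) X] shift_stableD(1)[OF V(2) Y] orth[OF X Y]])
  show "ShO D ` U \<subseteq> U" using shift_stable_image[OF U(2)] by simp
  show "obj_shift D (- 1) ` V \<subseteq> V" using obj_shift_minus_1_mem[OF V(2)] by blast
  fix M assume "M \<in> Obj D"
  then obtain X Y f g h where t: "tri X M Y f g h" "X \<in> U" "Y \<in> V" using tr by blast
  then show "\<exists>f g h. (f, g, h) \<in> Tri D \<and> Dom D f \<in> U \<and> Cod D f = M \<and> Cod D g \<in> V"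
    using tri_Tri[OF t(1)] triD(2,3,6)[OF t(1)] by blast
qed

text \<open>The triangle of \<open>M\<close> supplies the unit. A map to an object of
  \<open>Y\<close> extends because it vanishes on \<open>X\<close>, and two extensions differ by a
  map through \<open>X[1]\<close>, which is again left orthogonal to \<open>Y\<close>.\<close>

lemma reflection_exists:
  assumes Y: "localizing Y"
    and tr: "\<And>M. M \<in> Obj D \<Longrightarrow> \<exists>X X' f g h. tri X M X' f g h \<and> X \<in> left_perp D Y \<and> X' \<in> Y"
  obtains L \<eta> where "reflective_localizing D \<kappa> Y L \<eta>"
proof -
  have "\<exists>X' g. \<exists>X f h. tri X M X' f g h \<and> X \<in> left_perp D Y \<and> X' \<in> Y" if "M \<in> Obj D" for M
    using tr[OF that] by blast
  then obtain L \<eta> where L: "\<And>M. M \<in> Obj D \<Longrightarrow> \<exists>X f h. tri X M (L M) f (\<eta> M) h \<and> X \<in> left_perp D Y \<and> L M \<in> Y"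
    by metis
  have st: "shift_stable (left_perp D Y)"
    using localizingD(1)[OF left_perp_localizing[OF localizingD(1)[OF Y]]] .
  have "reflective_localizing D \<kappa> Y L \<eta>"
  proof unfold_locales
    show "localizing Y" by (rule Y)
    fix A assume A: "A \<in> Obj D"
    obtain X f h where t: "tri X A (L A) f (\<eta> A) h" and X: "X \<in> left_perp D Y" and LY: "L A \<in> Y"
      using L[OF A] by blast
    note [simp] = triD[OF t]
    show "\<eta> A \<in> homs D A (L A)" "L A \<in> Y" using LY by simp_all
    fix B u assume B: "B \<in> Y" and u: "u \<in> homs D A B"
    have BO: "B \<in> Obj D" using homs_Obj[OF u] by simp
    have "u \<cdot> f = Zer D X B" using left_perpD[OF X B, of "u \<cdot> f"] u by simp
    then obtain v where v: "v \<in> homs D (L A) B" "v \<cdot> \<eta> A = u" using weak_cokernel[OF t u] by blast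
    show "\<exists>!v. v \<in> homs D (L A) B \<and> v \<cdot> \<eta> A = u"
    proof (rule ex1I[of _ v])
      show "v \<in> homs D (L A) B \<and> v \<cdot> \<eta> A = u" using v by simp
      fix w assume w: "w \<in> homs D (L A) B \<and> w \<cdot> \<eta> A = u"
      have "(w \<^bold>- v) \<cdot> \<eta> A = Zer D A B" using v w by auto
      then obtain s where s: "s \<in> homs D (ShO D X) B" "s \<cdot> h = w \<^bold>- v"
        using weak_cokernel2[OF t, of "w \<^bold>- v" B] v w by auto
      have "s = Zer D (ShO D X) B" using left_perpD[OF shift_stableD(2)[OF st X] B s(1)] .
      then have "w \<^bold>- v = Zer D (L A) B" using s(2) BO by simp
      then show "w = v" using sub_eq_Zer_iff[of w "L A" B v] v w by simp
    qed
  qed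
  then show ?thesis by (rule that)
qed

end

section \<open>Ideals of compact objects\<close>

lemma compacts_simps [simp]:
  "Obj (compacts \<kappa> C) = {P. compact_object \<kappa> C P}"
  "Arr (compacts \<kappa> C) = {f \<in> Arr C. compact_object \<kappa> C (Dom C f) \<and> compact_object \<kappa> C (Cod C f)}"
  "Dom (compacts \<kappa> C) = Dom C" "Cod (compacts \<kappa> C) = Cod C" "Comp (compacts \<kappa> C) = Comp C"
  "Add (compacts \<kappa> C) = Add C" "Zer (compacts \<kappa> C) = Zer C" "Ident (compacts \<kappa> C) = Ident C"
  by (auto simp: compacts_def full_subcategory_def compact_object_def)

lemma homs_compacts:
  assumes "compact_object \<kappa> C A" "compact_object \<kappa> C B"
  shows "homs (compacts \<kappa> C) A B = homs C A B" "hom_group (compacts \<kappa> C) A B = hom_group C A B"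
  using assms by (auto simp: homs_def hom_group_def)

lemma compact_annihilator_iff:
  "f \<in> compact_annihilator \<kappa> C \<Y> \<longleftrightarrow> f \<in> Arr C \<and> compact_object \<kappa> C (Dom C f) \<and>
     compact_object \<kappa> C (Cod C f) \<and> (\<forall>Y \<in> \<Y>. kills C f Y)"
  by (auto simp: compact_annihilator_def)

context preadditive_category
begin

lemma kills_Comp:
  assumes "f \<in> homs C A B" "g \<in> homs C B B'" "Y \<in> Obj C" "kills C f Y \<or> kills C g Y"
  shows "kills C (g \<cdot> f) Y"
  unfolding kills_def
proof (intro ballI)
  note [simp] = homs_Obj[OF assms(1)]
  fix u assume "u \<in> homs C (Cod C (g \<cdot> f)) Y"
  then have u: "u \<in> Arr C" "Dom C u = B'" "Cod C u = Y" using assms by auto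
  have "u \<cdot> (g \<cdot> f) = (u \<cdot> g) \<cdot> f" using assms u by simp
  also have "\<dots> = Zer C A Y"
  proof (cases "kills C g Y")
    case True
    then have "u \<cdot> g = Zer C B Y" using u assms(2) unfolding kills_def by auto
    then show ?thesis using assms by auto
  next
    case False
    then have "kills C f Y" using assms(4) by blast
    then show ?thesis using u assms(1,2) unfolding kills_def by auto
  qed
  finally show "u \<cdot> (g \<cdot> f) = Zer C (Dom C (g \<cdot> f)) Y" using assms by simp
qed

lemma kills_subgroup:
  assumes "A \<in> Obj C" "B \<in> Obj C" and YO: "\<Y> \<subseteq> Obj C"
  shows "subgroup {f \<in> homs C A B. \<forall>Y \<in> \<Y>. kills C f Y} (hom_group C A B)"
proof
  note [simp] = assms(1,2)
  have y: "Y \<in> Obj C" if "Y \<in> \<Y>" for Y using that YO by blast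
  show "{f \<in> homs C A B. \<forall>Y \<in> \<Y>. kills C f Y} \<subseteq> carrier (hom_group C A B)" by auto
  show "\<one>\<^bsub>hom_group C A B\<^esub> \<in> {f \<in> homs C A B. \<forall>Y \<in> \<Y>. kills C f Y}"
    by (auto simp: kills_def)
  show "f \<otimes>\<^bsub>hom_group C A B\<^esub> g \<in> {f \<in> homs C A B. \<forall>Y \<in> \<Y>. kills C f Y}"
    if "f \<in> {f \<in> homs C A B. \<forall>Y \<in> \<Y>. kills C f Y}" "g \<in> {f \<in> homs C A B. \<forall>Y \<in> \<Y>. kills C f Y}" for f g
    using that y by (auto simp: kills_def)
  show "inv\<^bsub>hom_group C A B\<^esub> f \<in> {f \<in> homs C A B. \<forall>Y \<in> \<Y>. kills C f Y}"
    if f: "f \<in> {f \<in> homs C A B. \<forall>Y \<in> \<Y>. kills C f Y}" for f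
  proof -
    have "inv\<^bsub>hom_group C A B\<^esub> f = neg_mor C f" using f by (auto simp: neg_mor_def)
    then show ?thesis using f y by (auto simp: kills_def neg_Comp)
  qed
qed

end

context cocomplete_triangulated_category
begin

lemma kills_shift:
  assumes "f \<in> Arr D" "Y \<in> Obj D" shows "kills D (ShA D f) (ShO D Y) \<longleftrightarrow> kills D f Y"
proof
  assume k: "kills D (ShA D f) (ShO D Y)"
  show "kills D f Y"
    unfolding kills_def
  proof (intro ballI)
    fix u assume u: "u \<in> homs D (Cod D f) Y"
    have "ShA D u \<cdot> ShA D f = Zer D (ShO D (Dom D f)) (ShO D Y)"
      using k u assms unfolding kills_def by auto
    then have "ShA D (u \<cdot> f) = ShA D (Zer D (Dom D f) Y)" using u assms by simp
    then show "u \<cdot> f = Zer D (Dom D f) Y" using u assms by (subst (asm) ShA_eq_iff) auto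
  qed
next
  assume k: "kills D f Y"
  show "kills D (ShA D f) (ShO D Y)"
    unfolding kills_def
  proof (intro ballI)
    fix u assume "u \<in> homs D (Cod D (ShA D f)) (ShO D Y)"
    then have "u \<in> homs D (ShO D (Cod D f)) (ShO D Y)" using assms by simp
    then obtain u' where u': "u' \<in> homs D (Cod D f) Y" "ShA D u' = u"
      using unshift_homs assms Cod_Obj by blast
    have "ShA D (u' \<cdot> f) = ShA D (Zer D (Dom D f) Y)" using k u'(1) unfolding kills_def by simp
    then show "u \<cdot> ShA D f = Zer D (Dom D (ShA D f)) (ShO D Y)" using u' assms by auto
  qed
qed

lemma compact_shift: "X \<in> Obj D \<Longrightarrow> compact_object \<kappa> D (ShO D X) \<longleftrightarrow> compact_object \<kappa> D X"
  using rcompact_shift[OF shift_stable_Obj] compact_iff by simp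

lemma unshift_Arr:
  assumes "f \<in> Arr D" obtains f' where "f' \<in> Arr D" "ShA D f' = f"
  using ShA_bij assms by (metis bij_betw_iff_bijections)

text \<open>Closedness is the triple identity of the Galois connection between
  \<open>compact_annihilator\<close> and \<open>mor_perp\<close>.\<close>

lemma compact_annihilator_ideal:
  assumes Y: "shift_stable Y"
  shows "two_sided_ideal (compacts \<kappa> D) (compact_annihilator \<kappa> D Y)"
    "closed_class \<kappa> D (compact_annihilator \<kappa> D Y)"
    "ShA D ` compact_annihilator \<kappa> D Y = compact_annihilator \<kappa> D Y"
proof -
  have YO: "Y \<subseteq> Obj D" using Y by (simp add: shift_stable_def)
  show "two_sided_ideal (compacts \<kappa> D) (compact_annihilator \<kappa> D Y)"
    unfolding two_sided_ideal_def
  proof (intro conjI ballI impI)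
    show "compact_annihilator \<kappa> D Y \<subseteq> Arr (compacts \<kappa> D)" by (auto simp: compact_annihilator_iff)
    show "subgroup (compact_annihilator \<kappa> D Y \<inter> homs (compacts \<kappa> D) A B) (hom_group (compacts \<kappa> D) A B)"
      if A: "A \<in> Obj (compacts \<kappa> D)" and B: "B \<in> Obj (compacts \<kappa> D)" for A B
    proof -
      have AB: "compact_object \<kappa> D A" "compact_object \<kappa> D B" using A B by auto
      have "compact_annihilator \<kappa> D Y \<inter> homs D A B = {f \<in> homs D A B. \<forall>y \<in> Y. kills D f y}"
        using AB by (auto simp: compact_annihilator_iff)
      then show ?thesis
        using kills_subgroup[OF _ _ YO, of A B] AB by (simp add: homs_compacts[OF AB] compact_object_def)
    qed
    fix f g h
    assume f: "f \<in> Arr (compacts \<kappa> D)" and g: "g \<in> compact_annihilator \<kappa> D Y" and h: "h \<in> Arr (compacts \<kappa> D)"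
      and fg: "Cod (compacts \<kappa> D) f = Dom (compacts \<kappa> D) g" and gh: "Cod (compacts \<kappa> D) g = Dom (compacts \<kappa> D) h"
    have [simp]: "f \<in> Arr D" "g \<in> Arr D" "h \<in> Arr D" "Cod D f = Dom D g" "Cod D g = Dom D h"
      using f g h fg gh by (auto simp: compact_annihilator_iff)
    have "kills D (h \<cdot> (g \<cdot> f)) y" if y: "y \<in> Y" for y
    proof (rule kills_Comp[of _ "Dom D f" "Cod D g"])
      have yO: "y \<in> Obj D" using y YO by blast
      show "kills D (g \<cdot> f) y \<or> kills D h y"
        using kills_Comp[of f "Dom D f" "Cod D f" g "Cod D g" y] g y yO by (simp add: compact_annihilator_iff)
      show "y \<in> Obj D" by (rule yO)
    qed simp_all
    then show "h \<cdot>\<^bsub>compacts \<kappa> D\<^esub> g \<cdot>\<^bsub>compacts \<kappa> D\<^esub> f \<in> compact_annihilator \<kappa> D Y"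
      using f h by (simp add: compact_annihilator_iff)
  qed
  show "closed_class \<kappa> D (compact_annihilator \<kappa> D Y)"
    unfolding closed_class_def
  proof (intro equalityI subsetI)
    fix f assume f: "f \<in> compact_annihilator \<kappa> D Y"
    then have "\<forall>y \<in> mor_perp D (compact_annihilator \<kappa> D Y). kills D f y" unfolding mor_perp_def by blast
    with f show "f \<in> compact_annihilator \<kappa> D (mor_perp D (compact_annihilator \<kappa> D Y))"
      unfolding compact_annihilator_iff by blast
  next
    fix f assume f: "f \<in> compact_annihilator \<kappa> D (mor_perp D (compact_annihilator \<kappa> D Y))"
    have "Y \<subseteq> mor_perp D (compact_annihilator \<kappa> D Y)"
      using YO by (auto simp: mor_perp_def compact_annihilator_iff)
    then show "f \<in> compact_annihilator \<kappa> D Y" using f unfolding compact_annihilator_iff by blast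
  qed
  have S: "ShA D f \<in> compact_annihilator \<kappa> D Y \<longleftrightarrow> f \<in> compact_annihilator \<kappa> D Y" if f: "f \<in> Arr D" for f
  proof -
    have "(\<forall>y \<in> ShO D ` Y. kills D (ShA D f) y) \<longleftrightarrow> (\<forall>y \<in> Y. kills D (ShA D f) (ShO D y))"
      by blast
    then have "(\<forall>y \<in> Y. kills D (ShA D f) y) \<longleftrightarrow> (\<forall>y \<in> Y. kills D (ShA D f) (ShO D y))"
      by (simp only: shift_stable_image[OF Y])
    also have "\<dots> \<longleftrightarrow> (\<forall>y \<in> Y. kills D f y)" using kills_shift[OF f] YO by blast
    finally show ?thesis using f by (simp add: compact_annihilator_iff compact_shift)
  qed
  show "ShA D ` compact_annihilator \<kappa> D Y = compact_annihilator \<kappa> D Y"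
  proof (intro equalityI subsetI)
    show "f \<in> compact_annihilator \<kappa> D Y" if fS: "f \<in> ShA D ` compact_annihilator \<kappa> D Y" for f
    proof -
      obtain f' where f': "f' \<in> compact_annihilator \<kappa> D Y" "f = ShA D f'" using fS by blast
      then have "f' \<in> Arr D" by (simp add: compact_annihilator_iff)
      then show ?thesis using S f' by simp
    qed
    fix f assume f: "f \<in> compact_annihilator \<kappa> D Y"
    then have "f \<in> Arr D" by (simp add: compact_annihilator_iff)
    then obtain f' where "f' \<in> Arr D" "ShA D f' = f" by (rule unshift_Arr)
    then show "f \<in> ShA D ` compact_annihilator \<kappa> D Y" using S f by blast
  qed
qed

text \<open>Ideals are defined by triple composites; the one-sided rules put an identity in the
  remaining place.\<close>

lemma ideal_Comp:
  assumes I: "two_sided_ideal (compacts \<kappa> D) \<I>" and g: "g \<in> \<I>"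
  shows "g \<in> Arr D" "compact_object \<kappa> D (Dom D g)" "compact_object \<kappa> D (Cod D g)"
    "h \<in> homs D (Cod D g) B \<Longrightarrow> compact_object \<kappa> D B \<Longrightarrow> h \<cdot> g \<in> \<I>"
    "h \<in> homs D A (Dom D g) \<Longrightarrow> compact_object \<kappa> D A \<Longrightarrow> g \<cdot> h \<in> \<I>"
proof -
  have comp: "\<And>f g h. f \<in> Arr (compacts \<kappa> D) \<Longrightarrow> g \<in> \<I> \<Longrightarrow> h \<in> Arr (compacts \<kappa> D) \<Longrightarrow>
      Cod D f = Dom D g \<Longrightarrow> Cod D g = Dom D h \<Longrightarrow> h \<cdot> g \<cdot> f \<in> \<I>"
    using I unfolding two_sided_ideal_def compacts_simps by blast
  have "g \<in> Arr (compacts \<kappa> D)" using I g unfolding two_sided_ideal_def by blast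
  then show g': "g \<in> Arr D" "compact_object \<kappa> D (Dom D g)" "compact_object \<kappa> D (Cod D g)" by simp_all
  have id: "Ident D (Dom D g) \<in> Arr (compacts \<kappa> D)" "Ident D (Cod D g) \<in> Arr (compacts \<kappa> D)"
    using g' by simp_all
  show "h \<cdot> g \<in> \<I>" if h: "h \<in> homs D (Cod D g) B" and B: "compact_object \<kappa> D B"
  proof -
    have "h \<in> Arr (compacts \<kappa> D)" using h B g' by simp
    from comp[OF id(1) g this] show ?thesis using h g' by simp
  qed
  show "g \<cdot> h \<in> \<I>" if h: "h \<in> homs D A (Dom D g)" and A: "compact_object \<kappa> D A"
  proof -
    have "h \<in> Arr (compacts \<kappa> D)" using h A g' by simp
    from comp[OF this g id(2)] show ?thesis using h g' by simp
  qed
qed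

lemma ideal_subgroup:
  assumes I: "two_sided_ideal (compacts \<kappa> D) \<I>" and A: "compact_object \<kappa> D A" and B: "compact_object \<kappa> D B"
  shows "subgroup (\<I> \<inter> homs D A B) (hom_group D A B)"
proof -
  have "subgroup (\<I> \<inter> homs (compacts \<kappa> D) A B) (hom_group (compacts \<kappa> D) A B)"
    using I A B unfolding two_sided_ideal_def by simp
  then show ?thesis by (simp only: homs_compacts[OF A B])
qed

lemma ideal_product_subset:
  assumes I: "two_sided_ideal (compacts \<kappa> D) \<I>" and J: "\<J> \<subseteq> Arr (compacts \<kappa> D)"
  shows "ideal_product (compacts \<kappa> D) \<I> \<J> \<subseteq> \<I>"
proof
  fix f assume "f \<in> ideal_product (compacts \<kappa> D) \<I> \<J>"
  then have fA: "f \<in> Arr D" "compact_object \<kappa> D (Dom D f)" "compact_object \<kappa> D (Cod D f)"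
    and gen: "f \<in> generate (hom_group D (Dom D f) (Cod D f))
      {h \<cdot> g | g h. g \<in> \<J> \<and> h \<in> \<I> \<and> Dom D g = Dom D f \<and> Cod D g = Dom D h \<and> Cod D h = Cod D f}"
    by (auto simp: ideal_product_def homs_compacts)
  interpret G: comm_group "hom_group D (Dom D f) (Cod D f)"
    using fA by (intro comm_group_hom_group) auto
  note sub = ideal_subgroup[OF I fA(2,3)]
  have "{h \<cdot> g | g h. g \<in> \<J> \<and> h \<in> \<I> \<and> Dom D g = Dom D f \<and> Cod D g = Dom D h \<and> Cod D h = Cod D f}
      \<subseteq> \<I> \<inter> homs D (Dom D f) (Cod D f)"
  proof
    fix k assume "k \<in> {h \<cdot> g | g h. g \<in> \<J> \<and> h \<in> \<I> \<and> Dom D g = Dom D f \<and> Cod D g = Dom D h \<and> Cod D h = Cod D f}"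
    then obtain g h where k: "k = h \<cdot> g" and g: "g \<in> \<J>" and h: "h \<in> \<I>"
      and gh: "Dom D g = Dom D f" "Cod D g = Dom D h" "Cod D h = Cod D f" by blast
    have A: "g \<in> Arr D" "compact_object \<kappa> D (Dom D g)" "h \<in> Arr D" using g J ideal_Comp(1)[OF I h] by auto
    have "h \<cdot> g \<in> \<I>" using ideal_Comp(5)[OF I h, of g "Dom D g"] A gh by simp
    then show "k \<in> \<I> \<inter> homs D (Dom D f) (Cod D f)" using k A gh by simp
  qed
  from G.generate_subgroup_incl[OF this sub] gen show "f \<in> \<I>" by blast
qed

lemma ideal_product_composite:
  assumes "g \<in> \<J>" "h \<in> \<I>" "Cod D g = Dom D h" "\<J> \<subseteq> Arr (compacts \<kappa> D)" "\<I> \<subseteq> Arr (compacts \<kappa> D)"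
  shows "h \<cdot> g \<in> ideal_product (compacts \<kappa> D) \<I> \<J>"
proof -
  have [simp]: "g \<in> Arr D" "h \<in> Arr D" "compact_object \<kappa> D (Dom D g)" "compact_object \<kappa> D (Cod D h)"
    using assms by auto
  show ?thesis
    unfolding ideal_product_def using assms(1-3)
    by (auto simp: homs_compacts intro!: generate.incl)
qed

end

section \<open>From TTF triples to ideals\<close>

context cocomplete_triangulated_category
begin

text \<open>\<open>thick_over\<close> carries no size condition, so the class of all compact objects
  qualifies when the middle object of a factorization only has to be compact.\<close>

lemma thick_over_compacts:
  assumes "\<And>G. G \<in> \<G> \<Longrightarrow> compact_object \<kappa> D G"
  shows "thick_over \<G> {P. compact_object \<kappa> D P}"
  unfolding thick_over_def
proof (intro conjI ballI)
  show "\<G> \<subseteq> {P. compact_object \<kappa> D P}" using assms by blast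
  show "\<exists>Z \<in> {P. compact_object \<kappa> D P}. is_zero_object D Z"
    using zero_object rcompact_zero compact_iff by blast
  fix A B assume "A \<in> {P. compact_object \<kappa> D P}" "B \<in> {P. compact_object \<kappa> D P}"
  then have AB: "rcompact (Obj D) A" "rcompact (Obj D) B" by (simp_all add: compact_iff)
  show "\<exists>B' g h. tri A B B' f g h \<and> B' \<in> {P. compact_object \<kappa> D P}" if f: "f \<in> homs D A B" for f
  proof -
    obtain B' g h where t: "tri A B B' f g h" by (rule cone_exists[OF f])
    from rcompact_cone[OF shift_stable_Obj t AB] t show ?thesis unfolding compact_iff by blast
  qed
  obtain S i j p q where bp: "is_biproduct D A B S i j p q"
    using biproduct[OF rcompact_Obj[OF AB(1)] rcompact_Obj[OF AB(2)]] by blast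
  from rcompact_biproduct[OF bp AB] bp
  show "\<exists>S i j p q. is_biproduct D A B S i j p q \<and> S \<in> {P. compact_object \<kappa> D P}"
    unfolding compact_iff by blast
qed simp

end

section \<open>The ideal of a reflective localizing class, and its coreflection\<close>

context reflective_localizing
begin

text \<open>Uniqueness of factorizations over the unit, for maps into \<open>y[1]\<close>, makes
  \<open>u\<close> extend along \<open>k\<close> to \<open>A\<close> up to sign; existence extends
  it further to \<open>L A\<close>, and the unit after \<open>k\<close> is zero.\<close>

lemma unit_fibre_left_perp:
  assumes t: "tri F A (L A) k (\<eta> A) h" shows "F \<in> left_perp D Y"
proof (rule left_perpI)
  note [simp] = triD[OF t]
  have st: "shift_stable Y" by (rule localizingD(1)[OF Y])
  show "F \<in> Obj D" "Y \<subseteq> Obj D" using st by (auto simp: shift_stable_def)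
  fix y u assume y: "y \<in> Y" and u: "u \<in> homs D F y"
  have yO: "y \<in> Obj D" using homs_Obj[OF u] by simp
  have y1: "ShO D y \<in> Y" using shift_stableD(2)[OF st y] .
  have AO: "A \<in> Obj D" by simp
  have "(ShA D u \<cdot> h) \<cdot> \<eta> A = ShA D u \<cdot> (h \<cdot> \<eta> A)" using u by simp
  also have "\<dots> = Zer D (L A) (ShO D y) \<cdot> \<eta> A" unfolding tri_comp2[OF t] using u yO by simp
  finally have "ShA D u \<cdot> h = Zer D (L A) (ShO D y)"
    using unit_ext[OF AO y1, of "ShA D u \<cdot> h" "Zer D (L A) (ShO D y)"] u yO by simp
  moreover have "ShA D u \<in> homs D (ShO D F) (ShO D y)" using u by simp
  ultimately obtain v where v: "v \<in> homs D (ShO D A) (ShO D y)" "v \<cdot> neg_mor D (ShA D k) = ShA D u"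
    using weak_cokernel2[OF tri_rotate[OF t]] by blast
  obtain v' where v': "v' \<in> homs D A y" "ShA D v' = v" using unshift_homs[OF v(1) AO yO] by blast
  obtain v'' where v'': "v'' \<in> homs D (L A) y" "v'' \<cdot> \<eta> A = v'" by (rule unit_factor[OF y v'(1)])
  have "v' \<cdot> k = v'' \<cdot> (\<eta> A \<cdot> k)" using v'' by auto
  then have "v' \<cdot> k = Zer D F y" unfolding tri_comp1[OF t] using v''(1) yO by simp
  then have vk: "v' \<cdot> neg_mor D k = Zer D F y" using v'(1) yO by (simp add: neg_Comp)
  have "ShA D u = ShA D (v' \<cdot> neg_mor D k)" using v(2) v' by auto
  then have "ShA D u = ShA D (Zer D F y)" unfolding vk .
  then show "u = Zer D F y" using u yO by (subst (asm) ShA_eq_iff) auto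
qed

text \<open>Every map through the fibre \<open>F\<close> is killed by \<open>Y\<close>, as
  \<open>F\<close> is left orthogonal to \<open>Y\<close>. So the lift \<open>a\<close> of
  \<open>f\<close> qualifies for the factorization theorem, which puts \<open>r\<close> into the
  ideal; \<open>k q\<close> lies in it because it passes through \<open>F\<close>.\<close>

lemma annihilator_factor:
  assumes gen: "generating \<G>" and f: "f \<in> compact_annihilator \<kappa> D Y"
  obtains g h where "g \<in> compact_annihilator \<kappa> D Y" "h \<in> compact_annihilator \<kappa> D Y"
    "Cod D g = Dom D h" "h \<cdot> g = f"
proof -
  have st: "shift_stable Y" by (rule localizingD(1)[OF Y])
  define P Q where "P = Dom D f" and "Q = Cod D f"
  have fPQ: "f \<in> homs D P Q" and P: "compact_object \<kappa> D P" and Q: "compact_object \<kappa> D Q"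
    and kill: "\<forall>y \<in> Y. kills D f y"
    using f by (auto simp: compact_annihilator_iff P_def Q_def)
  note [simp] = homsD[OF fPQ]
  note O [simp] = homs_Obj[OF fPQ]
  obtain F k h where t: "tri F Q (L Q) k (\<eta> Q) h" by (rule fibre_exists[OF unit[OF O(2)]])
  note [simp] = triD(1-3,10)[OF t]
  have Fp: "F \<in> left_perp D Y" by (rule unit_fibre_left_perp[OF t])
  have "\<eta> Q \<cdot> f = Zer D P (L Q)" using kills_iff_unit[OF fPQ] kill by blast
  then obtain a where a: "a \<in> homs D P F" "k \<cdot> a = f" using weak_kernel[OF t fPQ] by blast
  have Fkill: "kills D (m \<cdot> a') y" if y: "y \<in> Y" and a': "a' \<in> homs D X F" and m: "m \<in> homs D F B" for y a' m X B
  proof -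
    have yO: "y \<in> Obj D" using shift_stableD(1)[OF st y] .
    have "kills D m y" using left_perpD[OF Fp y] m yO unfolding kills_def by auto
    then show ?thesis using kills_Comp[OF a' m yO] by blast
  qed
  have ka: "\<forall>y \<in> Y. kills D a y"
    using Fkill[OF _ a(1), of _ "Ident D F" F] a(1) by simp
  have Gc: "\<And>G. G \<in> \<G> \<Longrightarrow> compact_object \<kappa> D G" using gen by (simp add: generating_def)
  obtain R r q where R: "compact_object \<kappa> D R" and r: "r \<in> homs D P R" and q: "q \<in> homs D R F"
      and qr: "q \<cdot> r = a" and kr: "\<forall>y \<in> Y. kills D r y"
    using compact_factorization[OF gen thick_over_compacts[OF Gc] P a(1) ka] by blast
  have "r \<in> compact_annihilator \<kappa> D Y" using r R P kr by (simp add: compact_annihilator_iff)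
  moreover have "k \<cdot> q \<in> compact_annihilator \<kappa> D Y"
    using Fkill[OF _ q, of _ k Q] q R Q by (simp add: compact_annihilator_iff)
  moreover have "Cod D r = Dom D (k \<cdot> q)" using q r by simp
  moreover have "k \<cdot> q \<cdot> r = f" using a(2) qr q r by auto
  ultimately show ?thesis using that by blast
qed

lemma annihilator_idempotent:
  assumes gen: "generating \<G>"
  shows "idempotent_class (compacts \<kappa> D) (compact_annihilator \<kappa> D Y)"
  unfolding idempotent_class_def
proof (intro equalityI subsetI)
  note id = compact_annihilator_ideal[OF localizingD(1)[OF Y]]
  have A: "compact_annihilator \<kappa> D Y \<subseteq> Arr (compacts \<kappa> D)" by (auto simp: compact_annihilator_iff)
  fix f
  show "f \<in> compact_annihilator \<kappa> D Y"
    if "f \<in> ideal_product (compacts \<kappa> D) (compact_annihilator \<kappa> D Y) (compact_annihilator \<kappa> D Y)"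
    using that ideal_product_subset[OF id(1) A] by blast
  assume "f \<in> compact_annihilator \<kappa> D Y"
  then obtain g h where gh: "g \<in> compact_annihilator \<kappa> D Y" "h \<in> compact_annihilator \<kappa> D Y"
      "Cod D g = Dom D h" "h \<cdot> g = f"
    by (rule annihilator_factor[OF gen])
  from ideal_product_composite[OF gh(1-3) A A] gh(4)
  show "f \<in> ideal_product (compacts \<kappa> D) (compact_annihilator \<kappa> D Y) (compact_annihilator \<kappa> D Y)"
    by simp
qed

text \<open>If \<open>M\<close> is orthogonal to the ideal, then the fibre \<open>F\<close> of \<open>M \<rightarrow> L M\<close> vanishes: a map \<open>G \<rightarrow> F\<close> from a
  generator factors through a map of the ideal, hence through the composite of two of them; the
  second one pushes the map to \<open>F\<close> into the shifted object \<open>X\<close> of \<open>Y\<close>, where the first one kills it.\<close>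

lemma mor_perp_annihilator:
  assumes gen: "generating \<G>" shows "mor_perp D (compact_annihilator \<kappa> D Y) = Y"
proof (intro equalityI subsetI)
  have st: "shift_stable Y" by (rule localizingD(1)[OF Y])
  show "M \<in> mor_perp D (compact_annihilator \<kappa> D Y)" if "M \<in> Y" for M
    using that shift_stableD(1)[OF st that] by (simp add: mor_perp_def compact_annihilator_iff)
  fix M assume "M \<in> mor_perp D (compact_annihilator \<kappa> D Y)"
  then have MO: "M \<in> Obj D" and M: "\<And>f. f \<in> compact_annihilator \<kappa> D Y \<Longrightarrow> kills D f M"
    by (auto simp: mor_perp_def)
  obtain F k h where t: "tri F M (L M) k (\<eta> M) h" by (rule fibre_exists[OF unit[OF MO]])
  obtain X d where tX: "tri X F M d k (\<eta> M)" "ShO D X = L M" by (rule tri_rotate_back[OF t])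
  note [simp] = triD(1-6,10-12)[OF tX(1)]
  have XY: "X \<in> Y" using shift_stableD(3)[OF st] tX(2) L_Y[OF MO] by simp
  have Fp: "F \<in> left_perp D Y" by (rule unit_fibre_left_perp[OF t])
  have Gc: "\<And>G. G \<in> \<G> \<Longrightarrow> compact_object \<kappa> D G" using gen by (simp add: generating_def)
  have "homs D G F = {Zer D G F}" if G: "G \<in> \<G>" for G
  proof (rule homs_eq_ZerI)
    show GO: "G \<in> Obj D" using Gc[OF G] by (simp add: compact_object_def)
    show "F \<in> Obj D" by simp
    fix a assume a: "a \<in> homs D G F"
    have "\<forall>y \<in> Y. kills D a y"
    proof
      fix y assume y: "y \<in> Y"
      have "kills D (Ident D F) y"
        using left_perpD[OF Fp y] by (auto simp: kills_def)
      then show "kills D a y"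
        using kills_Comp[OF a, of "Ident D F" F y] shift_stableD(1)[OF st y] a by simp
    qed
    then obtain R r q where R: "compact_object \<kappa> D R" and r: "r \<in> homs D G R" and q: "q \<in> homs D R F"
        and qr: "q \<cdot> r = a" and kr: "\<forall>y \<in> Y. kills D r y"
      using compact_factorization[OF gen thick_over_compacts[OF Gc] Gc[OF G] a] by blast
    have "r \<in> compact_annihilator \<kappa> D Y" using r R Gc[OF G] kr by (simp add: compact_annihilator_iff)
    then obtain r1 r2 where r1: "r1 \<in> compact_annihilator \<kappa> D Y" and r2: "r2 \<in> compact_annihilator \<kappa> D Y"
        and rr: "Cod D r1 = Dom D r2" "r2 \<cdot> r1 = r"
      by (rule annihilator_factor[OF gen])
    have [simp]: "r1 \<in> Arr D" "r2 \<in> Arr D" using r1 r2 by (auto simp: compact_annihilator_iff)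
    have [simp]: "Dom D r1 = G" "Cod D r2 = R" using r rr by auto
    note [simp] = rr(1)
    note [simp] = homsD[OF q]
    have "k \<cdot> (q \<cdot> r2) = (k \<cdot> q) \<cdot> r2" by simp
    also have "\<dots> = Zer D (Dom D r2) M" using M[OF r2] unfolding kills_def by simp
    finally obtain y where y: "y \<in> homs D (Dom D r2) X" "d \<cdot> y = q \<cdot> r2"
      using weak_kernel[OF tX(1), of "q \<cdot> r2" "Dom D r2"] by auto
    have "y \<cdot> r1 = Zer D G X" using r1 XY y(1) by (simp add: compact_annihilator_iff kills_def)
    then have "d \<cdot> (y \<cdot> r1) = Zer D G F" using GO by simp
    moreover have "d \<cdot> (y \<cdot> r1) = (d \<cdot> y) \<cdot> r1" using y(1) by simp
    moreover have "(d \<cdot> y) \<cdot> r1 = a" unfolding y(2) using rr(2) qr by simp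
    ultimately show "a = Zer D G F" by simp
  qed
  then have "is_zero_object D F" using gen by (simp add: generating_def)
  then show "M \<in> Y" using localizing_iso(2)[OF Y t] L_Y[OF MO] by blast
qed

text \<open>A coproduct of objects of \<open>Y\<close> lies in \<open>Y\<close> again, so maps into
  it from \<open>L A\<close> correspond to maps from \<open>A\<close>.\<close>

lemma unit_rcompact:
  assumes A: "rcompact (Obj D) A" shows "rcompact Y (L A)"
  unfolding rcompact_def
proof (intro conjI allI impI)
  note AO [simp] = rcompact_Obj[OF A]
  show "L A \<in> Obj D" by simp
  fix I :: "'u set" and M S \<iota> u
  assume I: "|I| <o \<kappa>" and M: "\<forall>i \<in> I. M i \<in> Y" and cp: "is_coproduct D I M S \<iota>"
    and u: "u \<in> homs D (L A) S"
  note [simp] = coproductD(1)[OF cp] cpart(1-3)[OF cp]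
  have SY: "S \<in> Y" using localizing_coproduct[OF Y I _ cp] M by blast
  have "u \<cdot> \<eta> A \<in> homs D A S" using u by simp
  then obtain J where J: "J \<subseteq> I" "finite J" "cpart I M S \<iota> J \<cdot> (u \<cdot> \<eta> A) = u \<cdot> \<eta> A"
    using rcompactD[OF A I _ cp, of "u \<cdot> \<eta> A"] coproductD(5)[OF cp] by metis
  then have "cpart I M S \<iota> J \<cdot> u = u"
    using unit_ext[OF AO SY, of "cpart I M S \<iota> J \<cdot> u" u] u by simp
  then show "\<exists>J \<subseteq> I. finite J \<and> cpart I M S \<iota> J \<cdot> u = u" using J by blast
qed

text \<open>The reflections of compact generators are compact generators of \<open>Y\<close>; Brown towers built from
  them provide the right adjoint of the inclusion of \<open>Y\<close>.\<close>

lemma coreflection_triangle: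
  assumes gen: "generating \<G>" and M: "M \<in> Obj D"
  shows "\<exists>H W f g h. tri H M W f g h \<and> H \<in> Y \<and> W \<in> right_perp D Y"
proof -
  have st: "shift_stable Y" by (rule localizingD(1)[OF Y])
  have G: "|\<G>| <o \<kappa>" "\<And>G. G \<in> \<G> \<Longrightarrow> rcompact (Obj D) G"
    using gen by (auto simp: generating_def compact_iff)
  have GO: "\<G> \<subseteq> Obj D" using G(2) rcompact_Obj by blast
  define \<H> where "\<H> = shift_closure (L ` \<G>)"
  have LGO: "L ` \<G> \<subseteq> Obj D" using GO by auto
  have H: "|\<H>| <o \<kappa>" "shift_stable \<H>"
    unfolding \<H>_def using shift_closure_small[OF small_image[OF G(1)]] shift_closure_stable[OF LGO] by auto
  have HY: "X \<in> Y \<and> rcompact Y X" if X: "X \<in> \<H>" for X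
  proof (rule shift_closure_induct[OF X[unfolded \<H>_def] LGO])
    show "X \<in> Y \<and> rcompact Y X" if "X \<in> L ` \<G>" for X
      using that L_Y unit_rcompact[OF G(2)] GO by auto
    show "ShO D X \<in> Y \<and> rcompact Y (ShO D X) \<longleftrightarrow> X \<in> Y \<and> rcompact Y X" if "X \<in> Obj D" for X
      using rcompact_shift[OF st that] st that by (auto simp: shift_stable_def)
  qed
  have HYs: "\<H> \<subseteq> Y" using HY by blast
  have HO: "\<H> \<subseteq> Obj D" using H(2) by (simp add: shift_stable_def)
  \<comment> \<open>A localizing class containing \<open>\<H>\<close>, in the role of the one
    generated by it. The inclusion of \<open>Y\<close> in \<open>N\<close> turns orthogonality to
    \<open>\<H>\<close> into orthogonality to \<open>Y\<close>.\<close>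
  define N where "N = left_perp D (right_perp D \<H>)"
  have N: "localizing N" unfolding N_def by (rule left_perp_localizing[OF right_perp_shift_stable[OF H(2)]])
  have HN: "\<H> \<subseteq> N"
    using HO right_perpD by (auto simp: N_def left_perp_def right_perp_def)
  have tower: "\<exists>H W f g h. tri H A W f g h \<and> H \<in> Y \<and> H \<in> N \<and> W \<in> right_perp D \<H>" if A: "A \<in> Obj D" for A
  proof -
    obtain H W f g h where t: "tri H A W f g h" and "H \<in> Y"
      and inN: "\<forall>N'. localizing N' \<longrightarrow> \<H> \<subseteq> N' \<longrightarrow> H \<in> N'"
      and zero: "\<forall>N' Q T. localizing N' \<longrightarrow> \<H> \<subseteq> N' \<longrightarrow> rcompact N' Q \<longrightarrow> T \<in> \<H> \<longrightarrow>
         (\<forall>r \<in> homs D T Q. \<forall>w \<in> homs D Q W. w \<cdot> r = Zer D T W)"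
      by (rule brown_triangle[OF H Y HYs A])
    have "W \<in> right_perp D \<H>"
    proof (rule right_perpI[OF triD(12)[OF t] HO])
      fix T w assume T: "T \<in> \<H>" and w: "w \<in> homs D T W"
      have TO: "T \<in> Obj D" using T HO by blast
      have "w \<cdot> Ident D T = Zer D T W"
        using zero Y HYs HY[OF T] T Ident_homs[OF TO] w by blast
      then show "w = Zer D T W" using w by simp
    qed
    then show ?thesis using t \<open>H \<in> Y\<close> inN N HN by blast
  qed
  \<comment> \<open>For \<open>y\<close> in \<open>Y\<close> the cone \<open>W\<close> lies in
    \<open>Y\<close> too. By adjunction, maps from a generator to \<open>W\<close> are maps from its
    reflection, so they vanish; \<open>W\<close> is zero and \<open>y\<close> is isomorphic to
    \<open>H\<close>.\<close>
  have YN: "y \<in> N" if y: "y \<in> Y" for y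
  proof -
    have yO: "y \<in> Obj D" using shift_stableD(1)[OF st y] .
    obtain H W f g h where t: "tri H y W f g h" and HYN: "H \<in> Y" "H \<in> N" and W: "W \<in> right_perp D \<H>"
      using tower[OF yO] by blast
    note [simp] = triD(12)[OF t]
    have WY: "W \<in> Y" using localizingD(3)[OF Y t HYN(1) y] .
    have "homs D A W = {Zer D A W}" if A: "A \<in> \<G>" for A
    proof (rule homs_eq_ZerI)
      show AO: "A \<in> Obj D" "W \<in> Obj D" using A GO by auto
      fix u assume u: "u \<in> homs D A W"
      obtain v where v: "v \<in> homs D (L A) W" "v \<cdot> \<eta> A = u" by (rule unit_factor[OF WY u])
      have "L A \<in> \<H>" using A shift_closure_superset unfolding \<H>_def by blast
      then have "v = Zer D (L A) W" using right_perpD[OF W _ v(1)] by blast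
      then show "u = Zer D A W" using v(2) AO by auto
    qed
    then have zW: "is_zero_object D W" using gen by (simp add: generating_def)
    obtain F k where F: "tri F H y k f g" "ShO D F = W" by (rule tri_rotate_back[OF t])
    have "is_zero_object D F" using zero_object_shift[OF triD(10)[OF F(1)]] F(2) zW by simp
    then show "y \<in> N" using localizing_iso(1)[OF N F(1)] HYN(2) by blast
  qed
  obtain H W f g h where t: "tri H M W f g h" and HYN: "H \<in> Y" and W: "W \<in> right_perp D \<H>"
    using tower[OF M] by blast
  have YO: "Y \<subseteq> Obj D" using st by (simp add: shift_stable_def)
  have "W \<in> right_perp D Y"
  proof (rule right_perpI[OF triD(12)[OF t] YO])
    show "u = Zer D y W" if "y \<in> Y" "u \<in> homs D y W" for y u
      using left_perpD[of y D "right_perp D \<H>" W u] YN[OF that(1)] W that(2) unfolding N_def by blast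
  qed
  then show ?thesis using t HYN by blast
qed

end

section \<open>From ideals to TTF triples\<close>

context cocomplete_triangulated_category
begin

text \<open>The composites already form a subgroup: \<open>h1 g1 + h2 g2\<close> is a row times a
  column through the biproduct of the two middle objects, and both matrices lie in the
  ideal.\<close>

lemma ideal_factor:
  assumes I: "two_sided_ideal (compacts \<kappa> D) \<I>" and idem: "idempotent_class (compacts \<kappa> D) \<I>" and f: "f \<in> \<I>"
  obtains g h where "g \<in> \<I>" "h \<in> \<I>" "Cod D g = Dom D h" "h \<cdot> g = f"
proof -
  define A B where "A = Dom D f" and "B = Cod D f"
  have cAB: "compact_object \<kappa> D A" "compact_object \<kappa> D B" using ideal_Comp(2,3)[OF I f] by (simp_all add: A_def B_def)
  then have [simp]: "A \<in> Obj D" "B \<in> Obj D" by (simp_all add: compact_object_def)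
  interpret G: comm_group "hom_group D A B" by (rule comm_group_hom_group) simp_all
  define H where "H = {h \<cdot> g | g h. g \<in> \<I> \<and> h \<in> \<I> \<and> Dom D g = A \<and> Cod D g = Dom D h \<and> Cod D h = B}"
  have "f \<in> ideal_product (compacts \<kappa> D) \<I> \<I>" using f idem by (simp add: idempotent_class_def)
  then have fgen: "f \<in> generate (hom_group D A B) H"
    using homs_compacts[OF cAB] by (simp add: ideal_product_def H_def A_def B_def)
  have HI: "h \<cdot> g \<in> H" if "g \<in> \<I>" "h \<in> \<I>" "Dom D g = A" "Cod D g = Dom D h" "Cod D h = B" for g h
    using that unfolding H_def by blast
  have "subgroup H (hom_group D A B)"
  proof
    show "H \<subseteq> carrier (hom_group D A B)"
      using ideal_Comp(1)[OF I] by (auto simp: H_def)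
    interpret SA: subgroup "\<I> \<inter> homs D A A" "hom_group D A A" by (rule ideal_subgroup[OF I cAB(1) cAB(1)])
    interpret SB: subgroup "\<I> \<inter> homs D A B" "hom_group D A B" by (rule ideal_subgroup[OF I cAB])
    have "Zer D A B \<cdot> Zer D A A \<in> H"
      by (rule HI) (use SA.one_closed SB.one_closed in simp_all)
    then show "\<one>\<^bsub>hom_group D A B\<^esub> \<in> H" by simp
    show "inv\<^bsub>hom_group D A B\<^esub> x \<in> H" if x: "x \<in> H" for x
    proof -
      obtain g h where gh: "x = h \<cdot> g" "g \<in> \<I>" "h \<in> \<I>" "Dom D g = A" "Cod D g = Dom D h" "Cod D h = B"
        using x unfolding H_def by blast
      have [simp]: "g \<in> Arr D" "h \<in> Arr D" using ideal_Comp(1)[OF I] gh by auto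
      have h: "h \<in> \<I> \<inter> homs D (Dom D h) B" using gh by simp
      have "inv\<^bsub>hom_group D (Dom D h) B\<^esub> h \<in> \<I> \<inter> homs D (Dom D h) B"
        by (rule subgroup.m_inv_closed[OF ideal_subgroup[OF I ideal_Comp(2)[OF I gh(3)] cAB(2)] h])
      then have "neg_mor D h \<in> \<I>" using gh(6) by (simp add: neg_mor_def)
      then have "neg_mor D h \<cdot> g \<in> H" by (rule HI[OF gh(2)]) (use gh in simp_all)
      moreover have "inv\<^bsub>hom_group D A B\<^esub> x = neg_mor D (h \<cdot> g)" using gh by (simp add: neg_mor_def)
      ultimately show ?thesis using gh(5) by (simp add: neg_Comp)
    qed
    show "x \<otimes>\<^bsub>hom_group D A B\<^esub> y \<in> H" if x: "x \<in> H" and y: "y \<in> H" for x y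
    proof -
      obtain g1 h1 where 1: "x = h1 \<cdot> g1" "g1 \<in> \<I>" "h1 \<in> \<I>" "Dom D g1 = A" "Cod D g1 = Dom D h1" "Cod D h1 = B"
        using x unfolding H_def by blast
      obtain g2 h2 where 2: "y = h2 \<cdot> g2" "g2 \<in> \<I>" "h2 \<in> \<I>" "Dom D g2 = A" "Cod D g2 = Dom D h2" "Cod D h2 = B"
        using y unfolding H_def by blast
      define X1 X2 where "X1 = Dom D h1" and "X2 = Dom D h2"
      have g [simp]: "g1 \<in> Arr D" "Dom D g1 = A" "Cod D g1 = X1" "h1 \<in> Arr D" "Dom D h1 = X1" "Cod D h1 = B"
        "g2 \<in> Arr D" "Dom D g2 = A" "Cod D g2 = X2" "h2 \<in> Arr D" "Dom D h2 = X2" "Cod D h2 = B"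
        using 1 2 ideal_Comp(1)[OF I] by (simp_all add: X1_def X2_def)
      have cX: "compact_object \<kappa> D X1" "compact_object \<kappa> D X2"
        using ideal_Comp(2)[OF I 1(3)] ideal_Comp(2)[OF I 2(3)] by simp_all
      then have X [simp]: "X1 \<in> Obj D" "X2 \<in> Obj D" by (simp_all add: compact_object_def)
      obtain S i j p q where bp: "is_biproduct D X1 X2 S i j p q" using biproduct[OF X] by blast
      have cS: "compact_object \<kappa> D S" using rcompact_biproduct[OF bp] cX compact_iff by simp
      have b [simp]: "i \<in> Arr D" "Dom D i = X1" "Cod D i = S" "j \<in> Arr D" "Dom D j = X2" "Cod D j = S"
        "p \<in> Arr D" "Dom D p = S" "Cod D p = X1" "q \<in> Arr D" "Dom D q = S" "Cod D q = X2" "S \<in> Obj D"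
        "p \<cdot> i = Ident D X1" "q \<cdot> j = Ident D X2" "p \<cdot> j = Zer D X2 X1" "q \<cdot> i = Zer D X1 X2"
        using bp by (auto simp: is_biproduct_def)
      interpret S1: subgroup "\<I> \<inter> homs D A S" "hom_group D A S" by (rule ideal_subgroup[OF I cAB(1) cS])
      interpret S2: subgroup "\<I> \<inter> homs D S B" "hom_group D S B" by (rule ideal_subgroup[OF I cS cAB(2)])
      have "i \<cdot> g1 \<in> \<I> \<inter> homs D A S" "j \<cdot> g2 \<in> \<I> \<inter> homs D A S"
        using ideal_Comp(4)[OF I 1(2), of i S] ideal_Comp(4)[OF I 2(2), of j S] cS by simp_all
      from S1.m_closed[OF this] have u: "i \<cdot> g1 \<^bold>+ j \<cdot> g2 \<in> \<I>" by simp
      have "h1 \<cdot> p \<in> \<I> \<inter> homs D S B" "h2 \<cdot> q \<in> \<I> \<inter> homs D S B"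
        using ideal_Comp(5)[OF I 1(3), of p S] ideal_Comp(5)[OF I 2(3), of q S] cS by simp_all
      from S2.m_closed[OF this] have v: "h1 \<cdot> p \<^bold>+ h2 \<cdot> q \<in> \<I>" by simp
      have vi: "(h1 \<cdot> p \<^bold>+ h2 \<cdot> q) \<cdot> i = h1" "(h1 \<cdot> p \<^bold>+ h2 \<cdot> q) \<cdot> j = h2" by simp_all
      have va: "h1 \<cdot> p \<^bold>+ h2 \<cdot> q \<in> homs D S B" by simp
      have "(h1 \<cdot> p \<^bold>+ h2 \<cdot> q) \<cdot> (i \<cdot> g1 \<^bold>+ j \<cdot> g2) =
          ((h1 \<cdot> p \<^bold>+ h2 \<cdot> q) \<cdot> i) \<cdot> g1 \<^bold>+ ((h1 \<cdot> p \<^bold>+ h2 \<cdot> q) \<cdot> j) \<cdot> g2"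
      proof -
        have "w \<cdot> (i \<cdot> g1 \<^bold>+ j \<cdot> g2) = (w \<cdot> i) \<cdot> g1 \<^bold>+ (w \<cdot> j) \<cdot> g2" if "w \<in> homs D S B" for w
          using that by simp
        from this[OF va] show ?thesis .
      qed
      then have "x \<^bold>+ y = (h1 \<cdot> p \<^bold>+ h2 \<cdot> q) \<cdot> (i \<cdot> g1 \<^bold>+ j \<cdot> g2)" unfolding vi 1(1) 2(1) by simp
      then show ?thesis using HI[OF u v] by simp
    qed
  qed
  from G.generate_subgroup_incl[OF subset_refl this] fgen have "f \<in> H" by blast
  then show ?thesis using that unfolding H_def by blast
qed

lemma mor_perp_shift_stable:
  assumes I: "\<I> \<subseteq> Arr D" and S: "ShA D ` \<I> = \<I>" shows "shift_stable (mor_perp D \<I>)"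
  unfolding shift_stable_def
proof (intro conjI ballI)
  show "mor_perp D \<I> \<subseteq> Obj D" by (auto simp: mor_perp_def)
  fix X assume X: "X \<in> Obj D"
  have "(\<forall>f \<in> ShA D ` \<I>. kills D f (ShO D X)) \<longleftrightarrow> (\<forall>f \<in> \<I>. kills D f X)"
    using kills_shift[OF _ X] I by auto
  then show "ShO D X \<in> mor_perp D \<I> \<longleftrightarrow> X \<in> mor_perp D \<I>" using X by (simp add: S mor_perp_def)
qed

text \<open>Closure under cones is where idempotency enters. With \<open>e = e2 e1\<close>, the map
  \<open>u e2\<close> lifts to \<open>B\<close> because \<open>A[1]\<close> is orthogonal to the
  ideal, and \<open>e1\<close> kills the lift. For coproducts, compactness of the codomain of
  \<open>e\<close> reduces to finite parts.\<close>

lemma mor_perp_localizing: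
  assumes I: "two_sided_ideal (compacts \<kappa> D) \<I>" and idem: "idempotent_class (compacts \<kappa> D) \<I>"
    and S: "ShA D ` \<I> = \<I>"
  shows "localizing (mor_perp D \<I>)"
  unfolding localizing_def
proof (intro conjI allI impI)
  have IA: "\<I> \<subseteq> Arr D" using ideal_Comp(1)[OF I] by blast
  show st: "shift_stable (mor_perp D \<I>)" by (rule mor_perp_shift_stable[OF IA S])
  have kill: "u \<cdot> f = Zer D (Dom D f) X" if "f \<in> \<I>" "X \<in> mor_perp D \<I>" "u \<in> homs D (Cod D f) X" for f X u
    using that unfolding mor_perp_def kills_def by blast
  show "Z \<in> mor_perp D \<I>" if Z: "is_zero_object D Z" for Z
    unfolding mor_perp_def kills_def
  proof (intro CollectI conjI ballI)
    show "Z \<in> Obj D" using Z by (simp add: is_zero_object_def)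
    fix f g assume f: "f \<in> \<I>" and g: "g \<in> homs D (Cod D f) Z"
    then have "g \<cdot> f \<in> homs D (Dom D f) Z" using IA by auto
    then show "g \<cdot> f = Zer D (Dom D f) Z" by (rule zero_object_Arr_in[OF Z])
  qed
  show "B' \<in> mor_perp D \<I>" if t: "tri A B B' f g h" and A: "A \<in> mor_perp D \<I>" and B: "B \<in> mor_perp D \<I>"
    for A B B' f g h
    unfolding mor_perp_def kills_def
  proof (intro CollectI conjI ballI)
    note [simp] = triD[OF t]
    show "B' \<in> Obj D" by simp
    fix e u assume e: "e \<in> \<I>" and u: "u \<in> homs D (Cod D e) B'"
    obtain e1 e2 where ee: "e1 \<in> \<I>" "e2 \<in> \<I>" "Cod D e1 = Dom D e2" "e2 \<cdot> e1 = e"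
      by (rule ideal_factor[OF I idem e])
    have [simp]: "e1 \<in> Arr D" "e2 \<in> Arr D" using ee IA by auto
    have ec: "Dom D e = Dom D e1" "Cod D e = Cod D e2" using ee(3,4) by auto
    have u' [simp]: "u \<in> Arr D" "Dom D u = Cod D e2" "Cod D u = B'" using u ec by auto
    have "h \<cdot> (u \<cdot> e2) = (h \<cdot> u) \<cdot> e2" by simp
    also have "\<dots> = Zer D (Dom D e2) (ShO D A)"
      by (rule kill[OF ee(2) shift_stableD(2)[OF st A]]) simp
    finally obtain v where v: "v \<in> homs D (Dom D e2) B" "g \<cdot> v = u \<cdot> e2"
      using weak_kernel2[OF t, of "u \<cdot> e2" "Dom D e2"] by auto
    have "v \<cdot> e1 = Zer D (Dom D e1) B" using kill[OF ee(1) B] v(1) ee(3) by simp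
    then have "g \<cdot> (v \<cdot> e1) = Zer D (Dom D e1) B'" by simp
    moreover have "g \<cdot> (v \<cdot> e1) = (g \<cdot> v) \<cdot> e1" using v(1) ee(3) by simp
    moreover have "(g \<cdot> v) \<cdot> e1 = u \<cdot> e" unfolding v(2) using ee(3,4) by simp
    ultimately show "u \<cdot> e = Zer D (Dom D e) B'" using ec by simp
  qed
  show "T \<in> mor_perp D \<I>" if K: "|K| <o \<kappa>" and M: "\<forall>i \<in> K. M i \<in> mor_perp D \<I>"
      and cp: "is_coproduct D K M T \<iota>" for K :: "'u set" and M T \<iota>
    unfolding mor_perp_def kills_def
  proof (intro CollectI conjI ballI)
    show "T \<in> Obj D" by (rule coproductD(1)[OF cp])
    fix e u assume e: "e \<in> \<I>" and u: "u \<in> homs D (Cod D e) T"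
    have [simp]: "e \<in> Arr D" "u \<in> Arr D" "Dom D u = Cod D e" "Cod D u = T" using e u IA by auto
    note [simp] = cpart(1-3)[OF cp]
    have c: "rcompact (Obj D) (Cod D e)" using ideal_Comp(3)[OF I e] compact_iff by simp
    obtain J where J: "J \<subseteq> K" "finite J" "cpart K M T \<iota> J \<cdot> u = u"
      using rcompactD[OF c K coproductD(5)[OF cp] cp u] by blast
    show "u \<cdot> e = Zer D (Dom D e) T"
    proof (rule finite_part_eq_Zer[OF cp _ _ J(2,1)])
      show "u \<cdot> e \<in> homs D (Dom D e) T" by simp
      have "cpart K M T \<iota> J \<cdot> (u \<cdot> e) = (cpart K M T \<iota> J \<cdot> u) \<cdot> e" by simp
      then show "cpart K M T \<iota> J \<cdot> (u \<cdot> e) = u \<cdot> e" unfolding J(3) .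
      fix i assume i: "i \<in> K"
      note [simp] = cproj(1-3)[OF cp i]
      have "cproj K M T \<iota> i \<cdot> (u \<cdot> e) = (cproj K M T \<iota> i \<cdot> u) \<cdot> e" by simp
      also have "\<dots> = Zer D (Dom D e) (M i)" using kill[OF e, of "M i"] M i by simp
      finally show "cproj K M T \<iota> i \<cdot> (u \<cdot> e) = Zer D (Dom D e) (M i)" .
    qed
  qed
qed

text \<open>Iterating the factorization of \<open>f\<close> gives a sequence of maps in the ideal; take its homotopy colimit.\<close>

lemma ideal_factor_left_perp:
  assumes I: "two_sided_ideal (compacts \<kappa> D) \<I>" and idem: "idempotent_class (compacts \<kappa> D) \<I>"
    and S: "ShA D ` \<I> = \<I>" and f: "f \<in> \<I>"
  obtains T s r where "T \<in> left_perp D (mor_perp D \<I>)" "s \<in> homs D (Dom D f) T" "r \<in> homs D T (Cod D f)" "r \<cdot> s = f"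
proof -
  have IA: "\<I> \<subseteq> Arr D" using ideal_Comp(1)[OF I] by blast
  \<comment> \<open>\<open>u n\<close> is the part of \<open>f\<close> still to be factored, always
    ending in the codomain of \<open>f\<close>; \<open>R\<close> splits off a first factor in the
    ideal and hands on the second.\<close>
  define P where "P n u \<longleftrightarrow> u \<in> \<I> \<and> Cod D u = Cod D f \<and> (n = 0 \<longrightarrow> u = f)" for n :: nat and u
  define R where "R n u u' \<longleftrightarrow> (\<exists>p \<in> \<I>. Dom D p = Dom D u \<and> Cod D p = Dom D u' \<and> u' \<cdot> p = u)" for n :: nat and u u'
  have "\<exists>u. P 0 u" using f by (auto simp: P_def)
  moreover have "\<exists>u'. P (Suc n) u' \<and> R n u u'" if u: "P n u" for n u
  proof -
    have "u \<in> \<I>" using u by (simp add: P_def)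
    then obtain g h where gh: "g \<in> \<I>" "h \<in> \<I>" "Cod D g = Dom D h" "h \<cdot> g = u"
      by (rule ideal_factor[OF I idem])
    have "g \<in> Arr D" "h \<in> Arr D" using gh IA by auto
    then have "Dom D g = Dom D u" "Cod D h = Cod D u" using gh(3,4) by auto
    then show ?thesis using gh u unfolding P_def R_def by (intro exI[of _ h]) auto
  qed
  ultimately obtain u where u: "\<And>n. P n (u n)" "\<And>n. R n (u n) (u (Suc n))"
    using dependent_nat_choice[of P R] by metis
  from u(2) obtain b where b: "\<And>n. b n \<in> \<I>" "\<And>n. Dom D (b n) = Dom D (u n)" "\<And>n. Cod D (b n) = Dom D (u (Suc n))"
      "\<And>n. u (Suc n) \<cdot> b n = u n"
    unfolding R_def by metis
  have uI: "u n \<in> \<I>" "Cod D (u n) = Cod D f" for n using u(1)[of n] by (auto simp: P_def)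
  have u0: "u 0 = f" using u(1)[of 0] by (simp add: P_def)
  define B where "B n = Dom D (u n)" for n
  have BO: "B n \<in> Obj D" for n using subsetD[OF IA uI(1)] by (simp add: B_def)
  have bB: "b n \<in> homs D (B n) (B (Suc n))" for n using b(2,3) subsetD[OF IA b(1)] by (simp add: B_def)
  obtain H j where hc: "hocolim B b H j" by (rule hocolim_exists[of "Obj D" B b, OF localizing_Obj BO bB])
  have uB: "u n \<in> homs D (B n) (Cod D f)" for n using uI(2) subsetD[OF IA uI(1)] by (simp add: B_def)
  obtain r where r: "r \<in> homs D H (Cod D f)" "\<And>n. r \<cdot> j n = u n"
    by (rule hocolim_desc[of B b H j u, OF hc uB b(4)]) blast
  have "H \<in> left_perp D (mor_perp D \<I>)"
  proof (rule hocolim_left_perp[OF hc mor_perp_shift_stable[OF IA S]])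
    show "kills D (b n) y" if "y \<in> mor_perp D \<I>" for n y using that b(1) by (auto simp: mor_perp_def)
  qed
  moreover have "j 0 \<in> homs D (Dom D f) H" using hocolim_legs(1)[OF hc, of 0] u0 by (simp add: B_def)
  ultimately show ?thesis using that r u0 by metis
qed

text \<open>The tower is built from the objects \<open>T f\<close> with \<open>f\<close> in the
  ideal between members of a small \<open>\<Q>\<close>. Any other map of the ideal is a retract of
  such an \<open>f\<close>, and factoring \<open>f\<close> through \<open>T f\<close> shows that the
  cone kills it.\<close>

lemma ideal_triangle:
  assumes gen: "generating \<G>" and I: "two_sided_ideal (compacts \<kappa> D) \<I>"
    and idem: "idempotent_class (compacts \<kappa> D) \<I>" and S: "ShA D ` \<I> = \<I>" and M: "M \<in> Obj D"
  shows "\<exists>X W f g h. tri X M W f g h \<and> X \<in> left_perp D (mor_perp D \<I>) \<and> W \<in> mor_perp D \<I>"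
proof -
  have IA: "\<I> \<subseteq> Arr D" using ideal_Comp(1)[OF I] by blast
  obtain \<Q> where \<Q>: "thick_over \<G> \<Q>" "|\<Q>| <o \<kappa>"
    using small_thick_over[of \<G>] gen by (auto simp: generating_def)
  have QO: "\<Q> \<subseteq> Obj D" using thick_overD(2)[OF \<Q>(1)] rcompact_Obj by blast
  define K where "K = \<I> \<inter> (\<Union>A\<in>\<Q>. \<Union>B\<in>\<Q>. homs D A B)"
  have "|\<Union>A\<in>\<Q>. \<Union>B\<in>\<Q>. homs D A B| <o \<kappa>"
    using locally_small QO unfolding locally_small_def by (intro small_UN[OF inaccessible \<Q>(2)]) blast
  then have K: "|K| <o \<kappa>" by (rule small_subset) (auto simp: K_def)
  have "\<exists>T. T \<in> left_perp D (mor_perp D \<I>) \<and> (\<exists>s \<in> homs D (Dom D f) T. \<exists>r \<in> homs D T (Cod D f). r \<cdot> s = f)"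
    if "f \<in> \<I>" for f using ideal_factor_left_perp[OF I idem S that] by metis
  then obtain T where T: "\<And>f. f \<in> \<I> \<Longrightarrow> T f \<in> left_perp D (mor_perp D \<I>)"
      "\<And>f. f \<in> \<I> \<Longrightarrow> \<exists>s \<in> homs D (Dom D f) (T f). \<exists>r \<in> homs D (T f) (Cod D f). r \<cdot> s = f"
    by metis
  define \<T> where "\<T> = shift_closure (T ` K)"
  have TKO: "T ` K \<subseteq> Obj D" using left_perp_Obj[OF T(1)] by (auto simp: K_def)
  have TT: "|\<T>| <o \<kappa>" "shift_stable \<T>"
    unfolding \<T>_def using shift_closure_small[OF small_image[OF K]] shift_closure_stable[OF TKO] by auto
  have X: "localizing (left_perp D (mor_perp D \<I>))"
    by (rule left_perp_localizing[OF mor_perp_shift_stable[OF IA S]])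
  have TX: "\<T> \<subseteq> left_perp D (mor_perp D \<I>)"
  proof
    fix A assume A: "A \<in> \<T>"
    show "A \<in> left_perp D (mor_perp D \<I>)"
    proof (rule shift_closure_induct[OF A[unfolded \<T>_def] TKO])
      show "A \<in> left_perp D (mor_perp D \<I>)" if "A \<in> T ` K" for A using that T(1) by (auto simp: K_def)
      show "ShO D A \<in> left_perp D (mor_perp D \<I>) \<longleftrightarrow> A \<in> left_perp D (mor_perp D \<I>)" if "A \<in> Obj D" for A
        using localizingD(1)[OF X] that by (simp add: shift_stable_def)
    qed
  qed
  have TO: "\<T> \<subseteq> Obj D" using TT(2) by (simp add: shift_stable_def)
  obtain H W \<alpha> \<gamma> \<delta> where t: "tri H M W \<alpha> \<gamma> \<delta>" and H: "H \<in> left_perp D (mor_perp D \<I>)"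
    and "\<forall>N'. localizing N' \<longrightarrow> \<T> \<subseteq> N' \<longrightarrow> H \<in> N'"
    and zero: "\<forall>N' Q T. localizing N' \<longrightarrow> \<T> \<subseteq> N' \<longrightarrow> rcompact N' Q \<longrightarrow> T \<in> \<T> \<longrightarrow>
         (\<forall>r \<in> homs D T Q. \<forall>w \<in> homs D Q W. w \<cdot> r = Zer D T W)"
    by (rule brown_triangle[OF TT X TX M])
  have WO: "W \<in> Obj D" using triD(12)[OF t] .
  have "W \<in> mor_perp D \<I>"
    unfolding mor_perp_def kills_def
  proof (intro CollectI conjI ballI)
    show "W \<in> Obj D" by (rule WO)
    fix f g assume f: "f \<in> \<I>" and g: "g \<in> homs D (Cod D f) W"
    define P Q where "P = Dom D f" and "Q = Cod D f"
    have c: "compact_object \<kappa> D P" "compact_object \<kappa> D Q" using ideal_Comp[OF I f] by (simp_all add: P_def Q_def)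
    have fPQ [simp]: "f \<in> Arr D" "Dom D f = P" "Cod D f = Q" using IA f by (auto simp: P_def Q_def)
    have gQ [simp]: "g \<in> Arr D" "Dom D g = Q" "Cod D g = W" using g by auto
    obtain P' i p where P': "P' \<in> \<Q>" "i \<in> homs D P P'" "p \<in> homs D P' P" "p \<cdot> i = Ident D P"
      by (rule compact_retract[OF gen \<Q>(1) c(1)])
    obtain Q' j q where Q': "Q' \<in> \<Q>" "j \<in> homs D Q Q'" "q \<in> homs D Q' Q" "q \<cdot> j = Ident D Q"
      by (rule compact_retract[OF gen \<Q>(1) c(2)])
    note [simp] = homsD[OF P'(2)] homsD[OF P'(3)] homsD[OF Q'(2)] homsD[OF Q'(3)]
    \<comment> \<open>\<open>f\<close> is recovered as \<open>q f' i\<close>, so it suffices that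
      \<open>f'\<close> is killed.\<close>
    define f' where "f' = j \<cdot> (f \<cdot> p)"
    have rQ': "rcompact (Obj D) Q'" using thick_overD(2)[OF \<Q>(1) Q'(1)] .
    have cP': "compact_object \<kappa> D P'" using thick_overD(2)[OF \<Q>(1) P'(1)] compact_iff by simp
    have "f \<cdot> p \<in> \<I>" using ideal_Comp(5)[OF I f, of p P'] cP' by simp
    then have f'I: "f' \<in> \<I>"
      using ideal_Comp(4)[OF I, of "f \<cdot> p" j Q'] rQ' compact_iff by (simp add: f'_def)
    have f'h [simp]: "f' \<in> Arr D" "Dom D f' = P'" "Cod D f' = Q'" by (simp_all add: f'_def)
    have "f' \<in> homs D P' Q'" by simp
    then have f'K: "f' \<in> K" using f'I P'(1) Q'(1) unfolding K_def by blast
    obtain s r where sr: "s \<in> homs D P' (T f')" "r \<in> homs D (T f') Q'" "r \<cdot> s = f'"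
      using T(2)[OF f'I] by auto
    have "T f' \<in> \<T>" using f'K shift_closure_superset unfolding \<T>_def by blast
    moreover have "g \<cdot> q \<in> homs D Q' W" by simp
    \<comment> \<open>\<open>T f'\<close> need not be compact; what counts is its map
      \<open>r\<close> to the compact object \<open>Q'\<close>.\<close>
    ultimately have z: "(g \<cdot> q) \<cdot> r = Zer D (T f') W"
      using zero localizing_Obj TO rQ' sr(2) by blast
    have "g \<cdot> f = g \<cdot> ((q \<cdot> j) \<cdot> (f \<cdot> (p \<cdot> i)))" unfolding P'(4) Q'(4) by simp
    also have "\<dots> = (g \<cdot> q) \<cdot> (f' \<cdot> i)" by (simp add: f'_def)
    also have "\<dots> = ((g \<cdot> q) \<cdot> r) \<cdot> (s \<cdot> i)" unfolding sr(3)[symmetric] using sr(1,2) by simp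
    also have "\<dots> = Zer D P W" unfolding z using sr(1) WO by simp
    finally show "g \<cdot> f = Zer D (Dom D f) W" by simp
  qed
  then show ?thesis using t H by blast
qed

text \<open>The first t-structure provides the reflection from which
  \<open>coreflection_triangle\<close> produces the second.\<close>

lemma ideal_to_TTF_mem:
  assumes gen: "generating \<G>" and I: "\<I> \<in> closed_idempotent_stable_ideals \<kappa> D"
  shows "ideal_to_TTF D \<I> \<in> TTF_triples D"
proof -
  have id: "two_sided_ideal (compacts \<kappa> D) \<I>" "idempotent_class (compacts \<kappa> D) \<I>" "ShA D ` \<I> = \<I>"
    using I by (auto simp: closed_idempotent_stable_ideals_def)
  define Y where "Y = mor_perp D \<I>"
  have Y: "localizing Y" unfolding Y_def by (rule mor_perp_localizing[OF id])
  have tr: "\<And>M. M \<in> Obj D \<Longrightarrow> \<exists>X W f g h. tri X M W f g h \<and> X \<in> left_perp D Y \<and> W \<in> Y"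
    unfolding Y_def by (rule ideal_triangle[OF gen id])
  obtain L \<eta> where "reflective_localizing D \<kappa> Y L \<eta>" by (rule reflection_exists[OF Y tr])
  then interpret R: reflective_localizing D \<kappa> Y L \<eta> .
  have X: "localizing (left_perp D Y)" by (rule left_perp_localizing[OF localizingD(1)[OF Y]])
  have YO: "Y \<subseteq> Obj D" using localizingD(1)[OF Y] by (simp add: shift_stable_def)
  have "t_structure D (left_perp D Y) Y"
    by (rule t_structureI[OF localizing_strictly_full[OF X] localizingD(1)[OF X]
      localizing_strictly_full[OF Y] localizingD(1)[OF Y] left_perpD tr])
  moreover have "t_structure D Y (right_perp D Y)"
    by (rule t_structureI[OF localizing_strictly_full[OF Y] localizingD(1)[OF Y]
      right_perp_strictly_full[OF YO] right_perp_shift_stable[OF localizingD(1)[OF Y]] right_perpD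
      R.coreflection_triangle[OF gen]])
  ultimately show ?thesis by (simp add: TTF_triples_def ideal_to_TTF_def Y_def)
qed

text \<open>A TTF triple is determined by its middle class, which
  \<open>mor_perp_annihilator\<close> recovers from the ideal.\<close>

lemma TTF_to_ideal_mem:
  assumes gen: "generating \<G>" and T: "T \<in> TTF_triples D"
  shows "TTF_to_ideal \<kappa> D T \<in> closed_idempotent_stable_ideals \<kappa> D" "ideal_to_TTF D (TTF_to_ideal \<kappa> D T) = T"
proof -
  obtain \<X> \<Y> \<Z> where T': "T = (\<X>, \<Y>, \<Z>)" by (cases T)
  note p = TTF_triple_props[OF T[unfolded T']]
  obtain L \<eta> where "reflective_localizing D \<kappa> \<Y> L \<eta>" by (rule reflection_exists[OF p(3,4)])
  then interpret R: reflective_localizing D \<kappa> \<Y> L \<eta> .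
  show "TTF_to_ideal \<kappa> D T \<in> closed_idempotent_stable_ideals \<kappa> D"
    using compact_annihilator_ideal[OF localizingD(1)[OF p(3)]] R.annihilator_idempotent[OF gen]
    by (simp add: T' TTF_to_ideal_def closed_idempotent_stable_ideals_def)
  show "ideal_to_TTF D (TTF_to_ideal \<kappa> D T) = T"
    using p(1,2) by (simp add: T' TTF_to_ideal_def ideal_to_TTF_def R.mor_perp_annihilator[OF gen])
qed

end

theorem theorem5p5p15:
  fixes \<kappa> :: "'u rel" and D :: "('o, 'm) tricat"
  assumes "inaccessible \<kappa>"
    and "triangulated_category D"
    and "locally_small \<kappa> D"
    and "compactly_generated \<kappa> D"
  shows "bij_betw (TTF_to_ideal \<kappa> D) (TTF_triples D) (closed_idempotent_stable_ideals \<kappa> D) \<and>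
    bij_betw (ideal_to_TTF D) (closed_idempotent_stable_ideals \<kappa> D) (TTF_triples D) \<and>
    (\<forall>T \<in> TTF_triples D. ideal_to_TTF D (TTF_to_ideal \<kappa> D T) = T) \<and>
    (\<forall>\<I> \<in> closed_idempotent_stable_ideals \<kappa> D. TTF_to_ideal \<kappa> D (ideal_to_TTF D \<I>) = \<I>)"
proof -
  interpret triangulated_category D by fact
  interpret cocomplete_triangulated_category D \<kappa>
    using assms by unfold_locales (auto simp: compactly_generated_def)
  obtain \<G> where gen: "generating \<G>" by (rule generating_exists[OF assms(4)])
  note m1 = TTF_to_ideal_mem[OF gen] and m2 = ideal_to_TTF_mem[OF gen]
  \<comment> \<open>This round trip is literally the closedness of the ideal.\<close>
  have m3: "TTF_to_ideal \<kappa> D (ideal_to_TTF D \<I>) = \<I>" if "\<I> \<in> closed_idempotent_stable_ideals \<kappa> D" for \<I>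
    using that by (simp add: closed_idempotent_stable_ideals_def closed_class_def TTF_to_ideal_def ideal_to_TTF_def)
  have "bij_betw (TTF_to_ideal \<kappa> D) (TTF_triples D) (closed_idempotent_stable_ideals \<kappa> D)"
    by (rule bij_betw_byWitness[where f' = "ideal_to_TTF D"]) (use m1 m2 m3 in blast)+
  moreover have "bij_betw (ideal_to_TTF D) (closed_idempotent_stable_ideals \<kappa> D) (TTF_triples D)"
    by (rule bij_betw_byWitness[where f' = "TTF_to_ideal \<kappa> D"]) (use m1 m2 m3 in blast)+
  ultimately show ?thesis using m1(2) m3 by blast
qed

end
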